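(* Let $p,q\in\mathcal A_{\exp}$ with $q^\emptyset\ne1$. Then the unique solution $\ell\in T((\mathbb R^d))$ of the linear equation $$\ell=p+\ell q$$ belongs to $\mathcal A_{\exp}$. Moreover, it also belongs to $\mathcal I(\widehat W)$.
   Context: Let $d\ge2$, $T>0$, and let $W=(W^2,\dots,W^d)$ be a $(d-1)$-dimensional Brownian motion on a complete filtered probability space satisfying the usual conditions; $\widehat W_t=(t,W_t^2,\dots,W_t^d)$. $A_d=\{\mathbf 1,\dots,\mathbf d\}$; $V_n$ is the set of words of length $n$ in $A_d$, $V_0=\{\emptyset\}$, $V=\bigcup_nV_n$. $T((\mathbb R^d))$ is the space of formal series $\ell=\sum_{n\ge0}\sum_{v\in V_n}\ell^vv$, $\ell^v\in\mathbb R$, with concatenation product $(\ell\varphi)^w=\sum_{uv=w}\ell^u\varphi^v$ and unit $\emptyset$. The projection is $\ell|_u=\sum_{v\in V}\ell^{vu}v$. The shuffle product $\sqcup\!\sqcup$ is the bilinear product determined by $(v\mathbf i)\sqcup\!\sqcup(w\mathbf j)=(v\sqcup\!\sqcup(w\mathbf j))\mathbf i+((v\mathbf i)\sqcup\!\sqcup w)\mathbf j$, $w\sqcup\!\sqcup\emptyset=\emptyset\sqcup\!\sqcup w=w$; $e^{\sqcup\!\sqcup\ell}=\sum_{n\ge0}\ell^{\sqcup\!\sqcup n}/n!$. Write $\ell\preceq\varphi$ if $|\ell^v|\le\varphi^v$ for all $v\in V$, and $$\mathcal A_{\exp}=\Big\{\ell\in T((\mathbb R^d)):\exists C\in\mathbb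 R_+,\ \ell\preceq C\,e^{\sqcup\!\sqcup C\sum_{\mathbf i\in A_d}\mathbf i}\Big\}.$$ The signature is $\widehat{\mathbb W}^{\emptyset}_t=1$, $\widehat{\mathbb W}^{v\mathbf i}_t=\int_0^t\widehat{\mathbb W}^v_s\circ d\widehat W^{\mathbf i}_s$ (Stratonovich; coordinate $\mathbf 1$ is time). Set $\|\ell\|_t^{\mathcal A}=\sum_{n\ge0}\big|\sum_{v\in V_n}\ell^v\widehat{\mathbb W}^v_t\big|$ and $\mathcal A=\{\ell:\|\ell\|_t^{\mathcal A}<\infty\ \forall t\in[0,T]\text{ a.s.}\}$. $\mathcal I(\widehat W)$ is the set of $\ell\in\mathcal A$ with $\ell|_{\mathbf 1},\ell|_{\mathbf j},\ell|_{\mathbf{jj}}\in\mathcal A$ for $\mathbf j\in\{\mathbf 2,\dots,\mathbf d\}$ and $\int_0^T\|\ell|_{\mathbf 1}\|_t^{\mathcal A}dt+\sum_{\mathbf j=\mathbf 2}^{\mathbf d}\int_0^T\big(\|\ell|_{\mathbf{jj}}\|_t^{\mathcal A}+(\|\ell|_{\mathbf j}\|_t^{\mathcal A})^2\big)dt<\infty$ a.s. *)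

theory Defs
  imports "HOL-Probability.Probability" "HOL-Library.Multiset"
begin

section \<open>Words and formal series\<close>

text \<open>
  The alphabet with \<open>d = CARD('n) + 1\<close> letters is the type \<^typ>\<open>'n option\<close>, for an arbitrary finite
  \<^emph>\<open>nonempty\<close> type \<open>'n\<close> (so \<open>d \<ge> 2\<close>): the time letter \<open>1\<close> is \<^term>\<open>None\<close>, and the letters
  \<open>2, \<dots>, d\<close> are the \<^term>\<open>Some j\<close>.  Words are lists of letters, the empty word is \<^term>\<open>[]\<close>.
\<close>

type_synonym 'n word = "'n option list"
type_synonym 'n series = "'n word \<Rightarrow> real"

definition words :: "nat \<Rightarrow> 'n word set" where
  "words n = {v. length v = n}"

definition word_series :: "'n word \<Rightarrow> 'n series" where
  "word_series v = (\<lambda>u. if u = v then 1 else 0)"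

definition concat_prod :: "'n series \<Rightarrow> 'n series \<Rightarrow> 'n series" (infixl \<open>\<odot>\<close> 70) where
  "(l \<odot> \<phi>) = (\<lambda>w. \<Sum>(u, v) | u @ v = w. l u * \<phi> v)"

definition projection :: "'n series \<Rightarrow> 'n word \<Rightarrow> 'n series" where
  "projection l u = (\<lambda>v. l (v @ u))"

text \<open>
  The shuffle product of two words is a sum of words with multiplicities, hence a multiset
  (the library's \<^const>\<open>shuffles\<close> only yields the underlying set).
\<close>

function shuffle_words :: "'a list \<Rightarrow> 'a list \<Rightarrow> 'a list multiset" where
  "shuffle_words [] w = {#w#}"
| "shuffle_words (v @ [i]) [] = {#v @ [i]#}"
| "shuffle_words (v @ [i]) (w @ [j]) =
     image_mset (\<lambda>u. u @ [i]) (shuffle_words v (w @ [j])) +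
     image_mset (\<lambda>u. u @ [j]) (shuffle_words (v @ [i]) w)"
proof goal_cases
  case (1 P x)
  obtain a b where x: "x = (a, b)" by (cases x)
  show P
    by (cases a rule: rev_cases; cases b rule: rev_cases) (use 1 x in blast)+
qed auto
termination by (relation "Wellfounded.measure (\<lambda>(v, w). length v + length w)") auto

lemma shuffle_words_Nil_right: "shuffle_words v [] = {#v#}"
  by (cases v rule: rev_cases) auto

lemma length_shuffle_words:
  "u \<in># shuffle_words v w \<Longrightarrow> length u = length v + length w"
  by (induction v w arbitrary: u rule: shuffle_words.induct) fastforce+

lemma set_shuffle_words:
  "u \<in># shuffle_words v w \<Longrightarrow> set u = set v \<union> set w"
  by (induction v w arbitrary: u rule: shuffle_words.induct) fastforce+

definition shuffle_prod :: "'n series \<Rightarrow> 'n series \<Rightarrow> 'n series" where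
  "shuffle_prod l \<phi> =
     (\<lambda>u. \<Sum>(v, w) | u \<in># shuffle_words v w. l v * \<phi> w * real (count (shuffle_words v w) u))"

text \<open>The sums defining the two products range over finite sets.\<close>

lemma finite_concat_support: "finite {(u, v). u @ v = w}"
proof (rule finite_subset)
  show "{(u, v). u @ v = w} \<subseteq> (\<lambda>k. (take k w, drop k w)) ` {..length w}"
  proof clarify
    fix u v :: "'a list"
    show "(u, v) \<in> (\<lambda>k. (take k (u @ v), drop k (u @ v))) ` {..length (u @ v)}"
      by (rule image_eqI[of _ _ "length u"]) auto
  qed
qed simp

lemma finite_shuffle_support: "finite {(v, w). u \<in># shuffle_words v w}"
proof (rule finite_subset)
  let ?L = "{v. set v \<subseteq> set u \<and> length v \<le> length u}"
  show "{(v, w). u \<in># shuffle_words v w} \<subseteq> ?L \<times> ?L"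
    using length_shuffle_words set_shuffle_words by fastforce
  show "finite (?L \<times> ?L)"
    by (simp add: finite_lists_length_le)
qed

primrec shuffle_power :: "'n series \<Rightarrow> nat \<Rightarrow> 'n series" where
  "shuffle_power l 0 = word_series []"
| "shuffle_power l (Suc n) = shuffle_prod l (shuffle_power l n)"

definition shuffle_exp :: "'n series \<Rightarrow> 'n series" where
  "shuffle_exp l = (\<lambda>v. \<Sum>n. shuffle_power l n v / fact n)"

definition series_le :: "'n series \<Rightarrow> 'n series \<Rightarrow> bool" (infix \<open>\<preceq>\<close> 50) where
  "l \<preceq> \<phi> \<longleftrightarrow> (\<forall>v. \<bar>l v\<bar> \<le> \<phi> v)"

definition A_exp :: "('n::finite) series set" where
  "A_exp = {l. \<exists>C\<ge>0. l \<preceq> (\<lambda>v. C * shuffle_exp (\<lambda>u. C * (\<Sum>i\<in>UNIV. word_series [i] u)) v)}"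


section \<open>Brownian motion\<close>

text \<open>
  The library's filtrations are indexed by a whole type, here \<^typ>\<open>real\<close>.  Times are the \<open>t \<ge> 0\<close>;
  the sigma-algebras at negative indices are immaterial (a filtration on \<open>[0, \<infinity>)\<close> extends by
  \<open>F t = F 0\<close>).
\<close>

definition usual_conditions :: "'a measure \<Rightarrow> (real \<Rightarrow> 'a measure) \<Rightarrow> bool" where
  "usual_conditions M F \<longleftrightarrow>
     prob_space M \<and> complete_measure M \<and>
     filtration (space M) F \<and> (\<forall>t\<ge>0. subalgebra M (F t)) \<and>
     null_sets M \<subseteq> sets (F 0) \<and>
     (\<forall>t\<ge>0. sets (F t) = (\<Inter>s\<in>{t<..}. sets (F s)))"

definition brownian_motion ::
  "'a measure \<Rightarrow> (real \<Rightarrow> 'a measure) \<Rightarrow> (real \<Rightarrow> 'a \<Rightarrow> real ^ 'n) \<Rightarrow> bool" where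
  "brownian_motion M F W \<longleftrightarrow>
     (\<forall>t\<ge>0. W t \<in> borel_measurable (F t)) \<and>
     (AE \<omega> in M. W 0 \<omega> = 0) \<and>
     (AE \<omega> in M. continuous_on {0..} (\<lambda>t. W t \<omega>)) \<and>
     (\<forall>s t. 0 \<le> s \<and> s < t \<longrightarrow>
        prob_space.indep_set M (sets (F s))
          {(\<lambda>\<omega>. W t \<omega> - W s \<omega>) -` A \<inter> space M | A. A \<in> sets borel} \<and>
        prob_space.indep_vars M (\<lambda>_. borel) (\<lambda>j \<omega>. (W t \<omega> - W s \<omega>) $ j) UNIV \<and>
        (\<forall>j. distributed M lborel (\<lambda>\<omega>. (W t \<omega> - W s \<omega>) $ j) (normal_density 0 (sqrt (t - s)))))"

definition time_extension ::
  "(real \<Rightarrow> 'a \<Rightarrow> real ^ 'n) \<Rightarrow> 'n option \<Rightarrow> real \<Rightarrow> 'a \<Rightarrow> real" where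
  "time_extension W i t \<omega> = (case i of None \<Rightarrow> t | Some j \<Rightarrow> W t \<omega> $ j)"


section \<open>Stochastic integrals\<close>

definition continuous_adapted ::
  "'a measure \<Rightarrow> (real \<Rightarrow> 'a measure) \<Rightarrow> real \<Rightarrow> (real \<Rightarrow> 'a \<Rightarrow> real) \<Rightarrow> bool" where
  "continuous_adapted M F T X \<longleftrightarrow>
     (\<forall>t\<in>{0..T}. X t \<in> borel_measurable (F t)) \<and>
     (AE \<omega> in M. continuous_on {0..T} (\<lambda>t. X t \<omega>))"

definition null_in_prob :: "'a measure \<Rightarrow> (nat \<Rightarrow> 'a \<Rightarrow> ennreal) \<Rightarrow> bool" where
  "null_in_prob M X \<longleftrightarrow>
     (\<forall>n. X n \<in> borel_measurable M) \<and>
     (\<forall>\<epsilon>>0. (\<lambda>n. measure M {\<omega>\<in>space M. ennreal \<epsilon> < X n \<omega>}) \<longlonglongrightarrow> 0)"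

text \<open>A partition \<open>0 = \<pi> 0 < \<dots> < \<pi> k = t\<close> of \<open>[0, t]\<close>; the values of \<open>\<pi>\<close> beyond \<open>k\<close> are irrelevant.\<close>

definition time_partition :: "real \<Rightarrow> nat \<Rightarrow> (nat \<Rightarrow> real) \<Rightarrow> bool" where
  "time_partition t k \<pi> \<longleftrightarrow> \<pi> 0 = 0 \<and> \<pi> k = t \<and> (\<forall>i<k. \<pi> i < \<pi> (Suc i))"

definition vanishing_partitions ::
  "real \<Rightarrow> (nat \<Rightarrow> nat) \<Rightarrow> (nat \<Rightarrow> nat \<Rightarrow> real) \<Rightarrow> bool" where
  "vanishing_partitions t k \<pi> \<longleftrightarrow>
     (\<forall>n. time_partition t (k n) (\<pi> n)) \<and>
     (\<forall>\<delta>>0. eventually (\<lambda>n. \<forall>i<k n. \<pi> n (Suc i) - \<pi> n i < \<delta>) sequentially)"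

text \<open>
  Simple processes \<open>\<Sum>i<k. \<xi>\<^sub>i 1\<^bsub>(\<pi>\<^sub>i, \<pi>\<^sub>i\<^sub>+\<^sub>1]\<^esub>\<close>, given by a partition \<open>k, \<pi>\<close> of \<open>[0, T]\<close> and bounded
  \<open>F (\<pi> i)\<close>-measurable random variables \<open>\<xi> i\<close>.
\<close>

definition simple_integrand ::
  "'a measure \<Rightarrow> (real \<Rightarrow> 'a measure) \<Rightarrow> real \<Rightarrow> nat \<Rightarrow> (nat \<Rightarrow> real) \<Rightarrow> (nat \<Rightarrow> 'a \<Rightarrow> real) \<Rightarrow> bool" where
  "simple_integrand M F T k \<pi> \<xi> \<longleftrightarrow>
     time_partition T k \<pi> \<and>
     (\<forall>i<k. \<xi> i \<in> borel_measurable (F (\<pi> i)) \<and> (\<exists>c. \<forall>\<omega>\<in>space M. \<bar>\<xi> i \<omega>\<bar> \<le> c))"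

definition simple_process ::
  "nat \<Rightarrow> (nat \<Rightarrow> real) \<Rightarrow> (nat \<Rightarrow> 'a \<Rightarrow> real) \<Rightarrow> real \<Rightarrow> 'a \<Rightarrow> real" where
  "simple_process k \<pi> \<xi> t \<omega> = (\<Sum>i<k. \<xi> i \<omega> * indicator {\<pi> i<..\<pi> (Suc i)} t)"

definition simple_integral ::
  "nat \<Rightarrow> (nat \<Rightarrow> real) \<Rightarrow> (nat \<Rightarrow> 'a \<Rightarrow> real) \<Rightarrow> (real \<Rightarrow> 'a \<Rightarrow> real) \<Rightarrow> real \<Rightarrow> 'a \<Rightarrow> real" where
  "simple_integral k \<pi> \<xi> B t \<omega> =
     (\<Sum>i<k. \<xi> i \<omega> * (B (min t (\<pi> (Suc i))) \<omega> - B (min t (\<pi> i)) \<omega>))"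

text \<open>
  Stochastic integrals are only defined up to indistinguishability, so they are rendered as
  relations between the integrand \<open>Y\<close> and the versions \<open>I\<close> of the integral process on \<open>[0, T]\<close>.
  For the Ito integral with respect to a real Brownian motion \<open>B\<close>: \<open>I\<close> is the limit, uniformly on
  \<open>[0, T]\<close> in probability, of the integrals of simple processes converging to \<open>Y\<close> in \<open>L\<^sup>2[0, T]\<close>
  in probability.
\<close>

definition has_ito_integral ::
  "'a measure \<Rightarrow> (real \<Rightarrow> 'a measure) \<Rightarrow> real \<Rightarrow> (real \<Rightarrow> 'a \<Rightarrow> real) \<Rightarrow> (real \<Rightarrow> 'a \<Rightarrow> real) \<Rightarrow>
   (real \<Rightarrow> 'a \<Rightarrow> real) \<Rightarrow> bool" where
  "has_ito_integral M F T Y B I \<longleftrightarrow>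
     continuous_adapted M F T I \<and>
     (\<exists>k \<pi> \<xi>.
        (\<forall>n. simple_integrand M F T (k n) (\<pi> n) (\<xi> n)) \<and>
        null_in_prob M
          (\<lambda>n \<omega>. \<integral>\<^sup>+ t\<in>{0..T}. ennreal ((simple_process (k n) (\<pi> n) (\<xi> n) t \<omega> - Y t \<omega>)\<^sup>2) \<partial>lborel) \<and>
        null_in_prob M
          (\<lambda>n \<omega>. \<Squnion>t\<in>{0..T}. ennreal \<bar>simple_integral (k n) (\<pi> n) (\<xi> n) B t \<omega> - I t \<omega>\<bar>))"

definition has_time_integral ::
  "'a measure \<Rightarrow> (real \<Rightarrow> 'a measure) \<Rightarrow> real \<Rightarrow> (real \<Rightarrow> 'a \<Rightarrow> real) \<Rightarrow> (real \<Rightarrow> 'a \<Rightarrow> real) \<Rightarrow> bool" where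
  "has_time_integral M F T Y I \<longleftrightarrow>
     continuous_adapted M F T I \<and>
     (AE \<omega> in M. \<forall>t\<in>{0..T}. I t \<omega> = (LINT s:{0..t}|lborel. Y s \<omega>))"

definition has_quadratic_covariation ::
  "'a measure \<Rightarrow> (real \<Rightarrow> 'a measure) \<Rightarrow> real \<Rightarrow> (real \<Rightarrow> 'a \<Rightarrow> real) \<Rightarrow> (real \<Rightarrow> 'a \<Rightarrow> real) \<Rightarrow>
   (real \<Rightarrow> 'a \<Rightarrow> real) \<Rightarrow> bool" where
  "has_quadratic_covariation M F T X Y A \<longleftrightarrow>
     continuous_adapted M F T A \<and>
     (\<forall>t\<in>{0..T}. \<forall>k \<pi>. vanishing_partitions t k \<pi> \<longrightarrow>
        null_in_prob M (\<lambda>n \<omega>. ennreal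
          \<bar>(\<Sum>i<k n. (X (\<pi> n (Suc i)) \<omega> - X (\<pi> n i) \<omega>) * (Y (\<pi> n (Suc i)) \<omega> - Y (\<pi> n i) \<omega>)) - A t \<omega>\<bar>))"

text \<open>
  \<open>\<integral> Y \<circ> dX = \<integral> Y dX + [Y, X] / 2\<close> for the coordinate \<open>X\<close> of the time-extended Brownian motion
  with letter \<open>i\<close>.
\<close>

definition has_stratonovich_integral ::
  "'a measure \<Rightarrow> (real \<Rightarrow> 'a measure) \<Rightarrow> real \<Rightarrow> (real \<Rightarrow> 'a \<Rightarrow> real ^ 'n) \<Rightarrow>
   (real \<Rightarrow> 'a \<Rightarrow> real) \<Rightarrow> 'n option \<Rightarrow> (real \<Rightarrow> 'a \<Rightarrow> real) \<Rightarrow> bool" where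
  "has_stratonovich_integral M F T W Y i I \<longleftrightarrow>
     (\<exists>J A.
        (case i of
           None \<Rightarrow> has_time_integral M F T Y J
         | Some j \<Rightarrow> has_ito_integral M F T Y (time_extension W (Some j)) J) \<and>
        has_quadratic_covariation M F T Y (time_extension W i) A \<and>
        (AE \<omega> in M. \<forall>t\<in>{0..T}. I t \<omega> = J t \<omega> + A t \<omega> / 2))"


section \<open>Signature and admissible series\<close>

text \<open>\<open>S\<close> is a (continuous adapted) version on \<open>[0, T]\<close> of the signature of the time extension of \<open>W\<close>.\<close>

definition is_signature ::
  "'a measure \<Rightarrow> (real \<Rightarrow> 'a measure) \<Rightarrow> real \<Rightarrow> (real \<Rightarrow> 'a \<Rightarrow> real ^ 'n) \<Rightarrow>
   ('n word \<Rightarrow> real \<Rightarrow> 'a \<Rightarrow> real) \<Rightarrow> bool" where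
  "is_signature M F T W S \<longleftrightarrow>
     (\<forall>v. continuous_adapted M F T (S v)) \<and>
     (AE \<omega> in M. \<forall>t\<in>{0..T}. S [] t \<omega> = 1) \<and>
     (\<forall>v i. has_stratonovich_integral M F T W (S v) i (S (v @ [i])))"

definition sig_norm ::
  "(('n::finite) word \<Rightarrow> real \<Rightarrow> 'a \<Rightarrow> real) \<Rightarrow> 'n series \<Rightarrow> real \<Rightarrow> 'a \<Rightarrow> ennreal" where
  "sig_norm S l t \<omega> = (\<Sum>n. ennreal \<bar>\<Sum>v\<in>words n. l v * S v t \<omega>\<bar>)"

definition A_space ::
  "'a measure \<Rightarrow> real \<Rightarrow> (('n::finite) word \<Rightarrow> real \<Rightarrow> 'a \<Rightarrow> real) \<Rightarrow> 'n series set" where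
  "A_space M T S = {l. AE \<omega> in M. \<forall>t\<in>{0..T}. sig_norm S l t \<omega> < \<infinity>}"

definition I_space ::
  "'a measure \<Rightarrow> real \<Rightarrow> (('n::finite) word \<Rightarrow> real \<Rightarrow> 'a \<Rightarrow> real) \<Rightarrow> 'n series set" where
  "I_space M T S = {l \<in> A_space M T S.
     projection l [None] \<in> A_space M T S \<and>
     (\<forall>j. projection l [Some j] \<in> A_space M T S \<and>
          projection l [Some j, Some j] \<in> A_space M T S) \<and>
     (AE \<omega> in M.
        (\<integral>\<^sup>+ t\<in>{0..T}. sig_norm S (projection l [None]) t \<omega> \<partial>lborel) +
        (\<Sum>j\<in>UNIV. \<integral>\<^sup>+ t\<in>{0..T}. (sig_norm S (projection l [Some j, Some j]) t \<omega> +
                                (sig_norm S (projection l [Some j]) t \<omega>)\<^sup>2) \<partial>lborel) < \<infinity>)}"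

lemma finite_words: "finite (words n :: ('n::finite) word set)"
  using finite_lists_length_eq[of "UNIV :: 'n option set" n] by (simp add: words_def)

end

theory Submission
  imports Defs
begin

text \<open>
  The coefficient of a word \<open>v\<close> in the shuffle exponential of \<open>C \<Sum>\<^sub>i i\<close> is \<open>C\<^bsup>|v|\<^esup>\<close>, so that \<open>A_exp\<close>
  consists of the series of at most geometric growth (\<open>A_exp_iff\<close>).  The equation \<open>l = p + l q\<close>
  determines \<open>l w\<close> from the values of \<open>l\<close> at the shorter prefixes of \<open>w\<close>, because the remaining term
  \<open>l w q\<^sup>\<emptyset>\<close> can be absorbed on the left when \<open>q\<^sup>\<emptyset> \<noteq> 1\<close>; existence and uniqueness are immediate, and a
  geometric bound with a sufficiently large ratio reproduces itself along this recursion
  (\<open>linear_equation_A_exp\<close>).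

  The analytic part is the inclusion of \<open>A_exp\<close> in \<open>I_space\<close> (\<open>A_exp_subset_I_space\<close>).
  Projections preserve geometric growth, so everything follows from one statement about the
  signature: for every \<open>C\<close>, almost surely, \<open>\<Sum>\<^sub>n C\<^sup>n \<Sum>\<^bsub>|v| = n\<^esub> |S\<^sup>v\<^sub>t|\<close> is bounded uniformly in \<open>t \<in> [0, T]\<close>
  (\<open>signature_geometric_bound\<close>).  Rough path theory deduces this from factorial decay.  Here it is
  enough that the levels of the signature decay geometrically at every prescribed rate, and this can
  be seen from second moments.  For \<open>0 < \<rho> \<le> 1\<close> there is \<open>\<alpha>\<close> with
  \<open>E (S\<^sup>v\<^sub>t)\<^sup>2 \<le> \<rho>\<^bsup>|v|\<^esup> exp (\<alpha> t)\<close> for all words \<open>v\<close> (\<open>signature_moments\<close>): by induction on the word, an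
  integration in time of such a bound gains the factor \<open>1 / \<alpha>\<close>, and \<open>\<alpha>\<close> may be chosen after \<open>\<rho>\<close>.
  The Stratonovich integral is the sum of an Ito integral, to which the Ito isometry applies, and of
  half a bracket, which is a time integral of an earlier level of the signature.  A maximal
  inequality and the Borel--Cantelli lemma turn the moment bounds into pathwise ones.

  The stochastic integrals and brackets are specified only as limits in probability, and an Ito
  integral may be approximated along arbitrary partitions by simple processes without moment bounds.
  The bridge to second moments is \<open>ito_left_sums\<close>: the integral of a continuous, square integrable
  process is the limit in probability of its left sums along partitions that contain any prescribed
  finite set of times.  It rests on a domination inequality, which bounds a discrete stochastic
  integral in probability by its accumulated variance.  Second moments of the limits are then
  controlled by Fatou's lemma.  The brackets are identified by expanding the signature to first order,
  \<open>dS\<^bsup>uj\<^esup> = S\<^sup>u dW\<^sup>j + O(dt)\<close> in second moments (\<open>quadratic_covariation_brownian\<close>).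
\<close>

section \<open>Exponential series are the series of geometric growth\<close>

lemma words_Suc_bij:
  "bij_betw (\<lambda>(w, j). w @ [j]) (words n \<times> UNIV) (words (Suc n) :: 'n word set)"
proof -
  have "(\<lambda>(w, j). w @ [j]) ` (words n \<times> UNIV) = (words (Suc n) :: 'n word set)"
  proof (intro equalityI subsetI)
    fix u :: "'n word" assume u: "u \<in> words (Suc n)"
    then show "u \<in> (\<lambda>(w, j). w @ [j]) ` (words n \<times> UNIV)"
      by (cases u rule: rev_cases) (auto simp: words_def)
  qed (auto simp: words_def)
  then show ?thesis by (auto simp: bij_betw_def inj_on_def)
qed

lemma sum_words_Suc:
  "(\<Sum>w\<in>words (Suc n). f w) = (\<Sum>w\<in>(words n :: ('n::finite) word set). \<Sum>j\<in>UNIV. f (w @ [j]))"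
proof -
  have "(\<Sum>w\<in>words (Suc n). f w) = (\<Sum>(w, j)\<in>(words n :: 'n word set) \<times> UNIV. f (w @ [j]))"
    using sum.reindex_bij_betw[OF words_Suc_bij, of f n] by (simp add: case_prod_unfold)
  then show ?thesis by (simp add: sum.cartesian_product)
qed

lemma card_words: "card (words n :: ('n::finite) word set) = (CARD('n) + 1) ^ n"
proof -
  have "words n = {xs :: 'n word. set xs \<subseteq> UNIV \<and> length xs = n}" by (auto simp: words_def)
  then show ?thesis using card_lists_length_eq[of "UNIV :: 'n option set" n] by (simp add: card_UNIV_option)
qed

lemma count_image_mset_snoc:
  "count (image_mset (\<lambda>u. u @ [i]) A) (u @ [l]) = (if l = i then count A u else 0)"
proof (induction A)
  case (add x A)
  then show ?case by auto
qed simp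

text \<open>A word arises by shuffling in a letter in as many ways as it has positions.\<close>

lemma sum_count_shuffle_letter:
  fixes u :: "('n::finite) word"
  assumes "length u = Suc n"
  shows "(\<Sum>w\<in>words n. \<Sum>i\<in>UNIV. count (shuffle_words [i] w) u) = Suc n"
  using assms
proof (induction n arbitrary: u)
  case 0
  then obtain l where u: "u = [l]" by (metis length_0_conv length_Suc_conv)
  have "words 0 = {[] :: 'n word}" by (auto simp: words_def)
  moreover have "count (shuffle_words [i] []) u = (if i = l then 1 else 0)" for i
    by (simp add: u shuffle_words_Nil_right)
  ultimately show ?case by simp
next
  case (Suc n)
  then obtain u' l where u: "u = u' @ [l]" and u': "length u' = Suc n"
    by (cases u rule: rev_cases) auto
  have step: "count (shuffle_words [i] (w @ [j])) u =
      (if l = i then of_bool (u' = w @ [j]) else 0) +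
      (if l = j then count (shuffle_words [i] w) u' else 0)" for i j and w :: "'n word"
    using shuffle_words.simps(3)[of "[]" i w j]
    by (simp add: u count_image_mset_snoc)
  have fst: "(\<Sum>w\<in>words n. \<Sum>j\<in>UNIV. \<Sum>i\<in>UNIV.
      (if l = i then of_bool (u' = w @ [j]) else 0)) = (1::nat)" (is "?L = _")
  proof -
    have "?L = (\<Sum>w\<in>words (Suc n). of_bool (u' = w))"
      by (simp add: sum_words_Suc)
    also have "\<dots> = 1"
      using u' by (simp add: of_bool_def finite_words) (simp add: words_def)
    finally show ?thesis .
  qed
  have snd: "(\<Sum>w\<in>words n. \<Sum>j\<in>UNIV. \<Sum>i\<in>UNIV.
      (if l = j then count (shuffle_words [i] w) u' else 0)) = Suc n" (is "?R = _")
  proof -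
    have "?R = (\<Sum>w\<in>words n. \<Sum>i\<in>UNIV. \<Sum>j\<in>UNIV.
      (if l = j then count (shuffle_words [i] w) u' else 0))"
      by (intro sum.cong refl sum.swap)
    also have "\<dots> = Suc n" using Suc.IH[OF u'] by simp
    finally show ?thesis .
  qed
  show ?case
    unfolding sum_words_Suc step sum.distrib fst snd by simp
qed

text \<open>
  The factorial counts the orders in which the letters of a word of length \<open>n\<close> are shuffled in; it is
  the one that the exponential divides by.
\<close>

lemma shuffle_power_letters:
  fixes C :: real and v :: "('n::finite) word"
  defines "s \<equiv> \<lambda>u :: 'n word. C * (\<Sum>i\<in>UNIV. word_series [i] u)"
  shows "shuffle_power s n v = (if length v = n then C ^ n * fact n else 0)"
proof (induction n arbitrary: v)
  case 0
  show ?case by (auto simp: word_series_def)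
next
  case (Suc n)
  have s_eq: "s u = (if length u = 1 then C else 0)" for u
  proof (cases "length u = 1")
    case True
    then obtain l where "u = [l]" by (metis One_nat_def length_0_conv length_Suc_conv)
    then show ?thesis by (simp add: s_def word_series_def)
  next
    case False
    then show ?thesis by (auto simp: s_def word_series_def intro!: sum.neutral)
  qed
  let ?t = "\<lambda>(a, w). s a * shuffle_power s n w * real (count (shuffle_words a w) v)"
  let ?S = "{(a, w). v \<in># shuffle_words a w}"
  let ?P = "(\<lambda>(w, i). ([i], w)) ` ((words n :: 'n word set) \<times> (UNIV :: 'n option set))"
  \<comment> \<open>only one-letter words times words of length \<open>n\<close> contribute, so the sum may be taken over \<open>?P\<close>\<close>
  have zero: "?t x = 0" if "x \<notin> ?P \<or> x \<notin> ?S" for x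
  proof (cases x)
    case (Pair a w)
    show ?thesis
    proof (cases "length a = 1 \<and> length w = n")
      case True
      then obtain l where "a = [l]" by (metis One_nat_def length_0_conv length_Suc_conv)
      then have "x \<in> ?P" using True by (auto simp: Pair words_def)
      then show ?thesis using that by (auto simp: Pair not_in_iff)
    next
      case False
      then show ?thesis by (auto simp: Pair s_eq Suc.IH)
    qed
  qed
  have finS: "finite ?S" by (rule finite_shuffle_support)
  have finP: "finite ?P" by (intro finite_imageI finite_cartesian_product finite_words finite)
  have "shuffle_power s (Suc n) v = sum ?t ?S"
    by (simp add: shuffle_prod_def)
  also have "\<dots> = sum ?t (?S \<union> ?P)"
    by (rule sum.mono_neutral_left) (use finS finP zero in \<open>auto\<close>)
  also have "\<dots> = sum ?t ?P"
    by (rule sum.mono_neutral_right) (use finS finP zero in \<open>auto\<close>)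
  also have "\<dots> = (\<Sum>(w, i)\<in>words n \<times> UNIV. C * (C ^ n * fact n) * real (count (shuffle_words [i] w) v))"
    by (subst sum.reindex) (auto simp: inj_on_def s_eq Suc.IH words_def intro!: sum.cong)
  also have "\<dots> = C ^ Suc n * fact n * real (\<Sum>w\<in>words n. \<Sum>i\<in>UNIV. count (shuffle_words [i] w) v)"
    by (simp add: sum.cartesian_product sum_distrib_left case_prod_unfold mult_ac)
  also have "\<dots> = (if length v = Suc n then C ^ Suc n * fact (Suc n) else 0)"
  proof (cases "length v = Suc n")
    case True
    then show ?thesis by (simp only: sum_count_shuffle_letter[OF True]) simp
  next
    case False
    have "count (shuffle_words [i] w) v = 0" if "w \<in> words n" for i and w :: "'n word"
      using False that length_shuffle_words[of v "[i]" w] by (auto simp: words_def not_in_iff[symmetric])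
    then show ?thesis using False by simp
  qed
  finally show ?case .
qed

lemma shuffle_exp_letters:
  "shuffle_exp (\<lambda>u. C * (\<Sum>i\<in>UNIV. word_series [i] u)) v = C ^ length (v :: ('n::finite) word)"
proof -
  have "(\<lambda>n. shuffle_power (\<lambda>u. C * (\<Sum>i\<in>UNIV. word_series [i] u)) n v / fact n) =
        (\<lambda>n. if n = length v then C ^ n else 0)"
    by (auto simp: shuffle_power_letters)
  then show ?thesis
    using suminf_finite[of "{length v}" "\<lambda>n. if n = length v then C ^ n else 0"]
    by (simp add: shuffle_exp_def)
qed

lemma A_exp_iff: "l \<in> A_exp \<longleftrightarrow> (\<exists>C\<ge>0. \<forall>v. \<bar>l v\<bar> \<le> C * C ^ length v)"
  by (simp add: A_exp_def series_le_def shuffle_exp_letters)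

text \<open>
  The constant and the ratio of the bound may be chosen independently: their maximum serves as both.
\<close>

lemma A_exp_I:
  assumes "\<And>v. \<bar>l v\<bar> \<le> K * R ^ length v" and "0 \<le> R"
  shows "l \<in> A_exp"
proof -
  have "\<bar>l v\<bar> \<le> max \<bar>K\<bar> R * max \<bar>K\<bar> R ^ length v" for v
  proof -
    have "K * R ^ length v \<le> max \<bar>K\<bar> R * max \<bar>K\<bar> R ^ length v"
      using assms(2) by (intro mult_mono power_mono) auto
    then show ?thesis using assms(1)[of v] by linarith
  qed
  then show ?thesis unfolding A_exp_iff using assms(2) by (intro exI[of _ "max \<bar>K\<bar> R"]) auto
qed

lemma A_exp_projection:
  assumes "l \<in> A_exp"
  shows "projection l u \<in> A_exp"
proof -
  obtain C where C: "C \<ge> 0" "\<And>v. \<bar>l v\<bar> \<le> C * C ^ length v"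
    using assms by (auto simp: A_exp_iff)
  show ?thesis
    by (rule A_exp_I[where K = "C * C ^ length u" and R = C])
      (use C(1) C(2)[of "_ @ u"] in \<open>auto simp: projection_def power_add mult_ac\<close>)
qed


section \<open>The linear equation\<close>

lemma concat_prod_take_drop:
  "(l \<odot> \<phi>) w = (\<Sum>k\<le>length w. l (take k w) * \<phi> (drop k w))"
proof -
  have "{(u, v). u @ v = w} = (\<lambda>k. (take k w, drop k w)) ` {..length w}"
  proof (intro equalityI subsetI; clarify?)
    fix u v assume "w = u @ v"
    then show "(u, v) \<in> (\<lambda>k. (take k (u @ v), drop k (u @ v))) ` {..length (u @ v)}"
      by (intro image_eqI[of _ _ "length u"]) auto
  qed auto
  moreover have "inj_on (\<lambda>k. (take k w, drop k w)) {..length w}"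
    by (rule inj_onI) (metis Pair_inject atMost_iff length_take min.absorb2)
  ultimately show ?thesis
    by (simp add: concat_prod_def sum.reindex)
qed

text \<open>
  Isolating the summand \<open>l w * q []\<close> turns the equation into a recursion on the length of the word.
\<close>

lemma linear_equation_iff:
  assumes "q [] \<noteq> (1 :: real)"
  shows "l = (\<lambda>w. p w + (l \<odot> q) w) \<longleftrightarrow>
    (\<forall>w. l w = (p w + (\<Sum>k<length w. l (take k w) * q (drop k w))) / (1 - q []))"
proof -
  have "l w = p w + (l \<odot> q) w \<longleftrightarrow>
     l w = (p w + (\<Sum>k<length w. l (take k w) * q (drop k w))) / (1 - q [])" for w
    using assms unfolding concat_prod_take_drop
    by (simp add: field_simps flip: lessThan_Suc_atMost)
  then show ?thesis by (auto simp: fun_eq_iff)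
qed

function equation_solution :: "'n series \<Rightarrow> 'n series \<Rightarrow> 'n series" where
  "equation_solution p q w =
     (p w + (\<Sum>k<length w. equation_solution p q (take k w) * q (drop k w))) / (1 - q [])"
  by auto
termination
  by (relation "Wellfounded.measure (\<lambda>(p, q, w). length w)") auto

declare equation_solution.simps [simp del]

lemma linear_equation_unique_solution:
  assumes "q [] \<noteq> (1 :: real)"
  shows "\<exists>!l. l = (\<lambda>w. p w + (l \<odot> q) w)"
proof (rule ex1I[of _ "equation_solution p q"])
  show "equation_solution p q = (\<lambda>w. p w + (equation_solution p q \<odot> q) w)"
    unfolding linear_equation_iff[where q = q, OF assms] by (metis equation_solution.simps)
next
  fix l assume "l = (\<lambda>w. p w + (l \<odot> q) w)"
  then have rec: "l w = (p w + (\<Sum>k<length w. l (take k w) * q (drop k w))) / (1 - q [])" for w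
    unfolding linear_equation_iff[where q = q, OF assms] by blast
  have "l w = equation_solution p q w" for w
  proof (induction w rule: length_induct)
    case (1 w)
    then have "l (take k w) = equation_solution p q (take k w)" if "k < length w" for k
      using that by simp
    then show ?case by (subst rec, subst equation_solution.simps) simp
  qed
  then show "l = equation_solution p q" ..
qed

text \<open>
  A ratio \<open>R\<close> that is large compared with a common constant \<open>C\<close> of \<open>p\<close> and \<open>q\<close> makes the contribution
  of the shorter prefixes at most half of the claimed bound \<open>K R\<^bsup>|w|\<^esup>\<close>; the other half is for \<open>p\<close>.
\<close>

lemma linear_equation_A_exp:
  assumes q1: "q [] \<noteq> 1" and p: "p \<in> A_exp" and q: "q \<in> A_exp"
    and l: "l = (\<lambda>w. p w + (l \<odot> q) w)"
  shows "l \<in> A_exp"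
proof -
  obtain C1 where C1: "C1 \<ge> 0" "\<And>v. \<bar>p v\<bar> \<le> C1 * C1 ^ length v"
    using p by (auto simp: A_exp_iff)
  obtain C2 where C2: "C2 \<ge> 0" "\<And>v. \<bar>q v\<bar> \<le> C2 * C2 ^ length v"
    using q by (auto simp: A_exp_iff)
  define C where "C = 1 + C1 + C2"
  have C: "C \<ge> 1" using C1 C2 by (simp add: C_def)
  have le: "D * D ^ n \<le> C * C ^ n" if "0 \<le> D" "D \<le> C" for D and n :: nat
    using that by (intro mult_mono power_mono) auto
  have Cp: "\<bar>p v\<bar> \<le> C * C ^ length v" for v
    using C1(2)[of v] le[of C1 "length v"] C1(1) C2(1) by (simp add: C_def)
  have Cq: "\<bar>q v\<bar> \<le> C * C ^ length v" for v
    using C2(2)[of v] le[of C2 "length v"] C1(1) C2(1) by (simp add: C_def)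
  define a where "a = inverse \<bar>1 - q []\<bar>"
  have a: "a > 0" using q1 by (simp add: a_def)
  define K where "K = 2 * a * C"
  define R where "R = C * (1 + 2 * a * C)"
  have R: "R \<ge> C" using a C by (simp add: R_def)
  have K: "K > 0" using a C by (simp add: K_def)
  have rec: "l w = (p w + (\<Sum>k<length w. l (take k w) * q (drop k w))) / (1 - q [])" for w
    using l unfolding linear_equation_iff[where q = q, OF q1] by blast
  have "\<bar>l w\<bar> \<le> K * R ^ length w" for w
  proof (induction w rule: length_induct)
    case (1 w)
    let ?n = "length w"
    have x: "(\<Sum>k<n. R ^ k * C ^ (n - k)) * (2 * a * C) \<le> R ^ n" for n
    proof (induction n)
      case (Suc n)
      have "(\<Sum>k<Suc n. R ^ k * C ^ (Suc n - k)) = C * (\<Sum>k<n. R ^ k * C ^ (n - k)) + R ^ n * C"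
        by (simp add: sum_distrib_left Suc_diff_le mult_ac)
      then have "(\<Sum>k<Suc n. R ^ k * C ^ (Suc n - k)) * (2 * a * C) =
        C * ((\<Sum>k<n. R ^ k * C ^ (n - k)) * (2 * a * C)) + R ^ n * C * (2 * a * C)"
        by (simp add: algebra_simps)
      also have "\<dots> \<le> C * R ^ n + R ^ n * C * (2 * a * C)"
        using Suc C by (intro add_right_mono mult_left_mono) auto
      also have "\<dots> = R ^ Suc n" by (simp add: R_def algebra_simps)
      finally show ?case .
    qed simp
    have "\<bar>l w\<bar> = a * \<bar>p w + (\<Sum>k<?n. l (take k w) * q (drop k w))\<bar>"
      by (subst rec) (simp add: a_def abs_divide abs_mult divide_inverse mult_ac)
    also have "\<bar>p w + (\<Sum>k<?n. l (take k w) * q (drop k w))\<bar> \<le>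
        C * C ^ ?n + (\<Sum>k<?n. \<bar>l (take k w) * q (drop k w)\<bar>)"
      using Cp[of w] sum_abs[of "\<lambda>k. l (take k w) * q (drop k w)" "{..<?n}"] by linarith
    also have "(\<Sum>k<?n. \<bar>l (take k w) * q (drop k w)\<bar>) \<le> (\<Sum>k<?n. (K * R ^ k) * (C * C ^ (?n - k)))"
    proof (rule sum_mono)
      fix k assume k: "k \<in> {..<?n}"
      have "\<bar>l (take k w)\<bar> \<le> K * R ^ k" using 1 k by (auto dest: spec[of _ "take k w"])
      moreover have "\<bar>q (drop k w)\<bar> \<le> C * C ^ (?n - k)" using Cq[of "drop k w"] by simp
      ultimately show "\<bar>l (take k w) * q (drop k w)\<bar> \<le> (K * R ^ k) * (C * C ^ (?n - k))"
        unfolding abs_mult using C by (intro mult_mono) auto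
    qed
    also have "\<dots> = K * C * (\<Sum>k<?n. R ^ k * C ^ (?n - k))"
      by (simp add: sum_distrib_left mult_ac)
    also have "C * C ^ ?n \<le> C * R ^ ?n"
      using R C by (intro mult_left_mono power_mono) auto
    also have "a * (C * R ^ ?n + K * C * (\<Sum>k<?n. R ^ k * C ^ (?n - k))) =
      K * R ^ ?n / 2 + K / 2 * ((\<Sum>k<?n. R ^ k * C ^ (?n - k)) * (2 * a * C))"
      by (simp add: K_def field_simps)
    also have "\<dots> \<le> K * R ^ ?n / 2 + K / 2 * R ^ ?n"
      using K by (intro add_left_mono mult_left_mono x) auto
    finally show ?case using a by (auto simp: mult_left_mono)
  qed
  then show ?thesis using R C by (intro A_exp_I[where K = K and R = R]) auto
qed

section \<open>Second moments\<close>

definition second_moment_le :: "'a measure \<Rightarrow> ('a \<Rightarrow> real) \<Rightarrow> real \<Rightarrow> bool" where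
  "second_moment_le M X c \<longleftrightarrow>
     X \<in> borel_measurable M \<and> integrable M (\<lambda>\<omega>. (X \<omega>)\<^sup>2) \<and> (\<integral>\<omega>. (X \<omega>)\<^sup>2 \<partial>M) \<le> c"

lemma second_moment_leD:
  assumes "second_moment_le M X c"
  shows "X \<in> borel_measurable M" "integrable M (\<lambda>\<omega>. (X \<omega>)\<^sup>2)" "(\<integral>\<omega>. (X \<omega>)\<^sup>2 \<partial>M) \<le> c"
  using assms by (auto simp: second_moment_le_def)

lemma second_moment_le_mono:
  "second_moment_le M X c \<Longrightarrow> c \<le> d \<Longrightarrow> second_moment_le M X d"
  by (auto simp: second_moment_le_def)

lemma second_moment_le_nonneg: "second_moment_le M X c \<Longrightarrow> 0 \<le> c"
  unfolding second_moment_le_def by (smt (verit) integral_nonneg_AE AE_I2 zero_le_power2)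

lemma second_moment_le_bound:
  assumes X: "X \<in> borel_measurable M" and Y: "integrable M Y" "(\<integral>\<omega>. Y \<omega> \<partial>M) \<le> c"
    and le: "AE \<omega> in M. (X \<omega>)\<^sup>2 \<le> Y \<omega>"
  shows "second_moment_le M X c"
proof -
  have i: "integrable M (\<lambda>\<omega>. (X \<omega>)\<^sup>2)"
    by (rule Bochner_Integration.integrable_bound[OF Y(1)]) (use X le in auto)
  moreover have "(\<integral>\<omega>. (X \<omega>)\<^sup>2 \<partial>M) \<le> (\<integral>\<omega>. Y \<omega> \<partial>M)"
    by (rule integral_mono_AE[OF i Y(1) le])
  ultimately show ?thesis using X Y(2) by (simp add: second_moment_le_def)
qed

lemma second_moment_le_dominated:
  assumes "second_moment_le M Y c" "X \<in> borel_measurable M" "AE \<omega> in M. \<bar>X \<omega>\<bar> \<le> \<bar>Y \<omega>\<bar>"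
  shows "second_moment_le M X c"
  by (rule second_moment_le_bound[OF assms(2) second_moment_leD(2,3)[OF assms(1)]])
    (use assms(3) in \<open>auto simp: abs_le_square_iff\<close>)

lemma second_moment_le_cong_AE:
  assumes "second_moment_le M Y c" "X \<in> borel_measurable M" "AE \<omega> in M. X \<omega> = Y \<omega>"
  shows "second_moment_le M X c"
  by (rule second_moment_le_dominated[OF assms(1,2)]) (use assms(3) in eventually_elim, simp)

lemma second_moment_le_zero: "0 \<le> c \<Longrightarrow> second_moment_le M (\<lambda>_. 0) c"
  by (simp add: second_moment_le_def)

lemma second_moment_le_cmult:
  assumes "second_moment_le M X c"
  shows "second_moment_le M (\<lambda>\<omega>. a * X \<omega>) (a\<^sup>2 * c)"
  using assms by (auto simp: second_moment_le_def power_mult_distrib intro!: mult_left_mono)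

lemma second_moment_le_add:
  assumes "second_moment_le M X c" "second_moment_le M Y d"
  shows "second_moment_le M (\<lambda>\<omega>. X \<omega> + Y \<omega>) (2 * c + 2 * d)"
proof (rule second_moment_le_bound)
  show "AE \<omega> in M. (X \<omega> + Y \<omega>)\<^sup>2 \<le> 2 * (X \<omega>)\<^sup>2 + 2 * (Y \<omega>)\<^sup>2"
  proof (intro AE_I2)
    fix \<omega> show "(X \<omega> + Y \<omega>)\<^sup>2 \<le> 2 * (X \<omega>)\<^sup>2 + 2 * (Y \<omega>)\<^sup>2"
      using sum_squares_bound[of "X \<omega>" "Y \<omega>"] by (simp add: power2_sum)
  qed
qed (use assms in \<open>auto simp: second_moment_le_def\<close>)

lemma second_moment_le_diff:
  assumes "second_moment_le M X c" "second_moment_le M Y d"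
  shows "second_moment_le M (\<lambda>\<omega>. X \<omega> - Y \<omega>) (2 * c + 2 * d)"
  using second_moment_le_add[OF assms(1) second_moment_le_cmult[OF assms(2), of "-1"]] by simp

lemma integrable_mult_second_moment:
  fixes X Y :: "'a \<Rightarrow> real"
  assumes "X \<in> borel_measurable M" "Y \<in> borel_measurable M"
    and "integrable M (\<lambda>\<omega>. (X \<omega>)\<^sup>2)" "integrable M (\<lambda>\<omega>. (Y \<omega>)\<^sup>2)"
  shows "integrable M (\<lambda>\<omega>. X \<omega> * Y \<omega>)"
proof (rule Bochner_Integration.integrable_bound)
  show "integrable M (\<lambda>\<omega>. (X \<omega>)\<^sup>2 + (Y \<omega>)\<^sup>2)" using assms by simp
  show "AE \<omega> in M. norm (X \<omega> * Y \<omega>) \<le> norm ((X \<omega>)\<^sup>2 + (Y \<omega>)\<^sup>2)"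
  proof (intro AE_I2)
    fix \<omega>
    have "2 * (\<bar>X \<omega>\<bar> * \<bar>Y \<omega>\<bar>) \<le> (X \<omega>)\<^sup>2 + (Y \<omega>)\<^sup>2"
      using sum_squares_bound[of "\<bar>X \<omega>\<bar>" "\<bar>Y \<omega>\<bar>"] by simp
    then show "norm (X \<omega> * Y \<omega>) \<le> norm ((X \<omega>)\<^sup>2 + (Y \<omega>)\<^sup>2)"
      using mult_nonneg_nonneg[OF abs_ge_zero[of "X \<omega>"] abs_ge_zero[of "Y \<omega>"]]
      unfolding real_norm_def abs_mult by linarith
  qed
qed (use assms in auto)

lemma (in prob_space) integrable_second_moment:
  assumes "second_moment_le M X c"
  shows "integrable M X"
proof -
  have "integrable M (\<lambda>\<omega>. X \<omega> * 1)"
    by (rule integrable_mult_second_moment) (use second_moment_leD[OF assms] in simp_all)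
  then show ?thesis by simp
qed

lemma (in prob_space) second_moment_le_Chebyshev:
  assumes "second_moment_le M X c" "a > 0"
  shows "prob {\<omega>\<in>space M. a \<le> \<bar>X \<omega>\<bar>} \<le> c / a\<^sup>2"
proof -
  have "prob {\<omega>\<in>space M. a \<le> \<bar>X \<omega>\<bar>} \<le> (\<integral>\<omega>. (X \<omega>)\<^sup>2 \<partial>M) / a\<^sup>2"
    using second_moment_method[of X a] assms by (simp add: second_moment_le_def)
  also have "\<dots> \<le> c / a\<^sup>2"
    using assms by (intro divide_right_mono) (auto simp: second_moment_le_def)
  finally show ?thesis .
qed


section \<open>Discrete stochastic integrals\<close>

text \<open>
  Independence of an increment from the past is specified on the events \<open>Z -` A\<close>; this is the form in
  which it factors expectations.
\<close>

lemma (in prob_space) indep_var_of_indep_set: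
  fixes f Z :: "'a \<Rightarrow> real"
  assumes G: "subalgebra M G" and f: "f \<in> borel_measurable G" and Z: "Z \<in> borel_measurable M"
    and ind: "indep_set (sets G) {Z -` A \<inter> space M | A. A \<in> sets borel}"
  shows "indep_var borel f borel Z"
proof -
  have fM: "f \<in> borel_measurable M" using measurable_from_subalg[OF G f] .
  have sp: "space G = space M" using G by (simp add: subalgebra_def)
  have 1: "sigma_sets (space M) {f -` A \<inter> space M |A. A \<in> sets borel} \<subseteq> sets G"
    unfolding sp[symmetric]
    by (rule sets.sigma_sets_subset) (use f in \<open>auto intro: measurable_sets\<close>)
  have "indep_set (sets G) (sigma_sets (space M) {Z -` A \<inter> space M | A. A \<in> sets borel})"
  proof -
    have "Int_stable {Z -` A \<inter> space M | A. A \<in> sets borel}"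
    proof (rule Int_stableI, clarify)
      fix A B :: "real set" assume "A \<in> sets borel" "B \<in> sets borel"
      then show "\<exists>C. Z -` A \<inter> space M \<inter> (Z -` B \<inter> space M) = Z -` C \<inter> space M \<and> C \<in> sets borel"
        by (intro exI[of _ "A \<inter> B"]) auto
    qed
    then have "indep_set (sigma_sets (space M) (sets G))
        (sigma_sets (space M) {Z -` A \<inter> space M | A. A \<in> sets borel})"
      by (intro indep_set_sigma_sets ind) (auto simp: Int_stable_def)
    then show ?thesis using sets.sigma_sets_eq[of G] by (simp add: sp)
  qed
  then have "indep_set (sigma_sets (space M) {f -` A \<inter> space M |A. A \<in> sets borel})
     (sigma_sets (space M) {Z -` A \<inter> space M | A. A \<in> sets borel})"
    unfolding indep_set_def
    by (rule indep_sets_mono_sets) (use 1 in \<open>auto split: bool.split\<close>)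
  then show ?thesis using fM Z by (simp add: indep_var_eq)
qed

text \<open>
  \<open>Z 0, \<dots>, Z (K - 1)\<close> is centred noise: each \<open>Z i\<close> is independent of the past \<open>G i\<close> and has variance
  at most \<open>v i\<close>.  It will be instantiated with the increments of a Brownian motion and with their
  compensated products.
\<close>

locale martingale_noise = prob_space M for M :: "'a measure" +
  fixes G :: "nat \<Rightarrow> 'a measure" and Z :: "nat \<Rightarrow> 'a \<Rightarrow> real" and v :: "nat \<Rightarrow> real" and K :: nat
  assumes subalg: "i \<le> K \<Longrightarrow> subalgebra M (G i)"
    and G_mono: "i < K \<Longrightarrow> sets (G i) \<subseteq> sets (G (Suc i))"
    and Z_meas: "i < K \<Longrightarrow> Z i \<in> borel_measurable (G (Suc i))"
    and Z_indep: "i < K \<Longrightarrow> indep_set (sets (G i)) {Z i -` A \<inter> space M | A. A \<in> sets borel}"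
    and Z_second: "i < K \<Longrightarrow> second_moment_le M (Z i) (v i)"
    and Z_mean: "i < K \<Longrightarrow> expectation (Z i) = 0"
begin

lemma v_nonneg: "i < K \<Longrightarrow> 0 \<le> v i"
  using Z_second second_moment_le_nonneg by blast

lemma G_le: "i \<le> j \<Longrightarrow> j \<le> K \<Longrightarrow> sets (G i) \<subseteq> sets (G j)"
proof (induction j rule: dec_induct)
  case (step n)
  then show ?case using G_mono[of n] by auto
qed simp

lemma G_measurable_mono:
  fixes f :: "'a \<Rightarrow> real"
  assumes "f \<in> borel_measurable (G i)" "i \<le> j" "j \<le> K"
  shows "f \<in> borel_measurable (G j)"
proof -
  have "subalgebra (G j) (G i)"
    using subalg[of i] subalg[of j] assms G_le[of i j] by (auto simp: subalgebra_def)
  then show ?thesis using assms(1) measurable_from_subalg by blast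
qed

lemma G_measurable_M:
  fixes f :: "'a \<Rightarrow> real"
  shows "f \<in> borel_measurable (G i) \<Longrightarrow> i \<le> K \<Longrightarrow> f \<in> borel_measurable M"
  using measurable_from_subalg subalg by blast

definition transform :: "(nat \<Rightarrow> 'a \<Rightarrow> real) \<Rightarrow> nat \<Rightarrow> 'a \<Rightarrow> real" where
  "transform \<eta> k \<omega> = (\<Sum>i<k. \<eta> i \<omega> * Z i \<omega>)"

lemma transform_Suc: "transform \<eta> (Suc k) \<omega> = transform \<eta> k \<omega> + \<eta> k \<omega> * Z k \<omega>"
  by (simp add: transform_def)

lemma transform_measurable:
  assumes "\<And>i. i < k \<Longrightarrow> \<eta> i \<in> borel_measurable (G i)" and "k \<le> K"
  shows "transform \<eta> k \<in> borel_measurable (G k)"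
proof -
  have "(\<lambda>\<omega>. \<eta> i \<omega> * Z i \<omega>) \<in> borel_measurable (G k)" if "i < k" for i
    using that assms G_measurable_mono[OF assms(1), of i k] G_measurable_mono[OF Z_meas, of i k]
    by (intro borel_measurable_times) auto
  then show ?thesis by (simp add: transform_def [abs_def] borel_measurable_sum)
qed

text \<open>The mixed terms vanish because \<open>Z i\<close> has mean zero and is independent of the other factors.\<close>

lemma transform_second_moment:
  assumes \<eta>: "\<And>i. i < k \<Longrightarrow> \<eta> i \<in> borel_measurable (G i)"
    and c: "\<And>i. i < k \<Longrightarrow> second_moment_le M (\<eta> i) (c i)" and "k \<le> K"
  shows "second_moment_le M (transform \<eta> k) (\<Sum>i<k. c i * v i)"
  using assms
proof (induction k)
  case 0
  then show ?case by (simp add: transform_def [abs_def] second_moment_le_def)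
next
  case (Suc k)
  then have k: "k < K" and IH: "second_moment_le M (transform \<eta> k) (\<Sum>i<k. c i * v i)" by auto
  let ?N = "transform \<eta> k"
  have NG: "?N \<in> borel_measurable (G k)" using Suc.prems k by (intro transform_measurable) auto
  have \<eta>G: "\<eta> k \<in> borel_measurable (G k)" using Suc.prems by auto
  have ZM: "Z k \<in> borel_measurable M" using Z_second[OF k] by (rule second_moment_leD)
  have \<eta>2: "second_moment_le M (\<eta> k) (c k)" using Suc.prems by auto
  have G: "subalgebra M (G k)" using subalg k by simp
  have \<eta>M: "\<eta> k \<in> borel_measurable M" and NM: "?N \<in> borel_measurable M"
    using \<eta>2 IH by (auto simp: second_moment_le_def)
  note Z2 = second_moment_leD[OF Z_second[OF k]]
  have Zint: "integrable M (Z k)" using integrable_second_moment Z_second[OF k] by blast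
  have N\<eta>: "integrable M (\<lambda>\<omega>. ?N \<omega> * \<eta> k \<omega>)"
    using integrable_mult_second_moment \<eta>2 IH by (auto simp: second_moment_le_def)
  have ind1: "indep_var borel (\<lambda>\<omega>. ?N \<omega> * \<eta> k \<omega>) borel (Z k)"
    by (rule indep_var_of_indep_set[OF G _ ZM Z_indep[OF k]]) (use NG \<eta>G in measurable)
  have ind: "indep_var borel (\<eta> k) borel (Z k)"
    by (rule indep_var_of_indep_set[OF G \<eta>G ZM Z_indep[OF k]])
  have ind2: "indep_var borel (\<lambda>\<omega>. (\<eta> k \<omega>)\<^sup>2) borel (\<lambda>\<omega>. (Z k \<omega>)\<^sup>2)"
    using indep_var_compose[OF ind, of "\<lambda>x. x\<^sup>2" borel "\<lambda>x. x\<^sup>2" borel] by (simp add: comp_def)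
  have e1: "expectation (\<lambda>\<omega>. (?N \<omega> * \<eta> k \<omega>) * Z k \<omega>) = 0"
    using indep_var_lebesgue_integral[OF ind1 N\<eta> Zint] Z_mean[OF k] by simp
  have i1: "integrable M (\<lambda>\<omega>. (?N \<omega> * \<eta> k \<omega>) * Z k \<omega>)"
    using indep_var_integrable[OF ind1 N\<eta> Zint] .
  have i2: "integrable M (\<lambda>\<omega>. (\<eta> k \<omega>)\<^sup>2 * (Z k \<omega>)\<^sup>2)"
    using indep_var_integrable[OF ind2 second_moment_leD(2)[OF \<eta>2] Z2(2)] .
  have "expectation (\<lambda>\<omega>. (\<eta> k \<omega>)\<^sup>2 * (Z k \<omega>)\<^sup>2) =
      expectation (\<lambda>\<omega>. (\<eta> k \<omega>)\<^sup>2) * expectation (\<lambda>\<omega>. (Z k \<omega>)\<^sup>2)"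
    using indep_var_lebesgue_integral[OF ind2 second_moment_leD(2)[OF \<eta>2] Z2(2)] .
  also have "\<dots> \<le> c k * v k"
    using second_moment_leD(3)[OF \<eta>2] Z2(3) second_moment_le_nonneg[OF \<eta>2]
    by (intro mult_mono) auto
  finally have e2: "expectation (\<lambda>\<omega>. (\<eta> k \<omega>)\<^sup>2 * (Z k \<omega>)\<^sup>2) \<le> c k * v k" .
  have eq: "(transform \<eta> (Suc k) \<omega>)\<^sup>2 =
      (?N \<omega>)\<^sup>2 + 2 * ((?N \<omega> * \<eta> k \<omega>) * Z k \<omega>) + (\<eta> k \<omega>)\<^sup>2 * (Z k \<omega>)\<^sup>2" for \<omega>
    by (simp add: transform_def power2_sum power_mult_distrib algebra_simps)
  have int: "integrable M (\<lambda>\<omega>. (transform \<eta> (Suc k) \<omega>)\<^sup>2)"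
    unfolding eq using i1 i2 second_moment_leD(2)[OF IH] by (intro Bochner_Integration.integrable_add) auto
  have "expectation (\<lambda>\<omega>. (transform \<eta> (Suc k) \<omega>)\<^sup>2) =
     expectation (\<lambda>\<omega>. (?N \<omega>)\<^sup>2) + expectation (\<lambda>\<omega>. (\<eta> k \<omega>)\<^sup>2 * (Z k \<omega>)\<^sup>2)"
    unfolding eq using i1 i2 second_moment_leD(2)[OF IH] e1 by simp
  also have "\<dots> \<le> (\<Sum>i<Suc k. c i * v i)"
    using e2 second_moment_leD(3)[OF IH] by simp
  finally show ?case
    using int G_measurable_M[OF transform_measurable[of "Suc k" \<eta>]] Suc.prems
    by (simp add: second_moment_le_def)
qed

text \<open>
  Stopping the integrand as soon as the integral has reached \<open>a\<close> keeps it there, so that Chebyshev's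
  inequality for the stopped integral controls the running maximum.
\<close>

lemma transform_maximal_inequality:
  assumes \<eta>: "\<And>i. i < K \<Longrightarrow> \<eta> i \<in> borel_measurable (G i)"
    and c: "\<And>i. i < K \<Longrightarrow> second_moment_le M (\<eta> i) (c i)" and a: "a > 0"
  shows "prob {\<omega>\<in>space M. \<exists>j\<le>K. a \<le> \<bar>transform \<eta> j \<omega>\<bar>} \<le> (\<Sum>i<K. c i * v i) / a\<^sup>2"
proof -
  define \<zeta> where "\<zeta> i \<omega> = (if \<forall>j\<le>i. \<bar>transform \<eta> j \<omega>\<bar> < a then \<eta> i \<omega> else 0)" for i \<omega>
  have \<zeta>G: "\<zeta> i \<in> borel_measurable (G i)" if i: "i < K" for i
  proof -
    have "transform \<eta> j \<in> borel_measurable (G i)" if "j \<le> i" for j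
      by (rule G_measurable_mono[OF transform_measurable]) (use \<eta> i that in auto)
    then have "(\<lambda>\<omega>. \<bar>transform \<eta> j \<omega>\<bar>) \<in> borel_measurable (G i)" if "j \<le> i" for j
      using that by measurable
    then have [measurable]: "Measurable.pred (G i) (\<lambda>\<omega>. \<forall>j\<in>{..i}. \<bar>transform \<eta> j \<omega>\<bar> < a)"
      by (intro pred_intros_finite) auto
    have [measurable]: "\<eta> i \<in> borel_measurable (G i)" by (rule \<eta>[OF i])
    have "\<zeta> i = (\<lambda>\<omega>. if \<forall>j\<in>{..i}. \<bar>transform \<eta> j \<omega>\<bar> < a then \<eta> i \<omega> else 0)"
      by (auto simp: \<zeta>_def fun_eq_iff)
    then show ?thesis by simp
  qed
  have \<zeta>2: "second_moment_le M (\<zeta> i) (c i)" if "i < K" for i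
  proof (rule second_moment_le_dominated[OF c[OF that]])
    show "\<zeta> i \<in> borel_measurable M" using G_measurable_M[OF \<zeta>G] that by simp
  qed (simp add: \<zeta>_def)
  have stop: "if \<exists>j\<le>k. a \<le> \<bar>transform \<eta> j \<omega>\<bar> then a \<le> \<bar>transform \<zeta> k \<omega>\<bar>
     else transform \<zeta> k \<omega> = transform \<eta> k \<omega>" for k \<omega>
  proof (induction k)
    case 0
    then show ?case by (simp add: transform_def)
  next
    case (Suc k)
    show ?case
    proof (cases "\<exists>j\<le>k. a \<le> \<bar>transform \<eta> j \<omega>\<bar>")
      case True
      then have "\<zeta> k \<omega> = 0" by (auto simp: \<zeta>_def)
      then have "transform \<zeta> (Suc k) \<omega> = transform \<zeta> k \<omega>" by (simp add: transform_def)
      then show ?thesis using Suc True by (auto intro: le_SucI)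
    next
      case False
      then have "\<forall>j\<le>k. \<bar>transform \<eta> j \<omega>\<bar> < a" by force
      then have "\<zeta> k \<omega> = \<eta> k \<omega>" by (simp add: \<zeta>_def)
      then have "transform \<zeta> (Suc k) \<omega> = transform \<eta> (Suc k) \<omega>"
        using Suc False by (simp add: transform_Suc)
      then show ?thesis using False by (auto simp: le_Suc_eq)
    qed
  qed
  have N: "second_moment_le M (transform \<zeta> K) (\<Sum>i<K. c i * v i)"
    by (rule transform_second_moment) (use \<zeta>G \<zeta>2 in auto)
  have "prob {\<omega>\<in>space M. \<exists>j\<le>K. a \<le> \<bar>transform \<eta> j \<omega>\<bar>} \<le> prob {\<omega>\<in>space M. a \<le> \<bar>transform \<zeta> K \<omega>\<bar>}"
  proof (rule finite_measure_mono)
    show "{\<omega>\<in>space M. a \<le> \<bar>transform \<zeta> K \<omega>\<bar>} \<in> sets M"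
      using second_moment_leD(1)[OF N] by measurable
    have "a \<le> \<bar>transform \<zeta> K \<omega>\<bar>" if "\<exists>j\<le>K. a \<le> \<bar>transform \<eta> j \<omega>\<bar>" for \<omega>
      using stop[of K \<omega>] that by simp
    then show "{\<omega>\<in>space M. \<exists>j\<le>K. a \<le> \<bar>transform \<eta> j \<omega>\<bar>} \<subseteq> {\<omega>\<in>space M. a \<le> \<bar>transform \<zeta> K \<omega>\<bar>}"
      by blast
  qed
  also have "\<dots> \<le> (\<Sum>i<K. c i * v i) / a\<^sup>2"
    by (rule second_moment_le_Chebyshev[OF N a])
  finally show ?thesis .
qed

text \<open>
  Here the integrand is stopped before its accumulated variance exceeds \<open>\<delta>\<close>, which changes it only
  on the event in the first term of the bound.  This controls integrals whose accumulated variance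
  tends to zero merely in probability, as for the simple processes that approximate an Ito integrand.
\<close>

lemma transform_domination_inequality:
  assumes \<eta>: "\<And>i. i < K \<Longrightarrow> \<eta> i \<in> borel_measurable (G i)"
    and c: "\<And>i. i < K \<Longrightarrow> integrable M (\<lambda>\<omega>. (\<eta> i \<omega>)\<^sup>2)" and a: "a > 0" and \<delta>: "\<delta> \<ge> 0"
  shows "prob {\<omega>\<in>space M. a \<le> \<bar>transform \<eta> K \<omega>\<bar>} \<le>
    prob {\<omega>\<in>space M. \<delta> < (\<Sum>i<K. (\<eta> i \<omega>)\<^sup>2 * v i)} + \<delta> / a\<^sup>2"
proof -
  define \<zeta> where "\<zeta> i \<omega> = (if (\<Sum>j\<le>i. (\<eta> j \<omega>)\<^sup>2 * v j) \<le> \<delta> then \<eta> i \<omega> else 0)" for i \<omega>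
  have \<zeta>G: "\<zeta> i \<in> borel_measurable (G i)" if i: "i < K" for i
  proof -
    have "(\<lambda>\<omega>. \<Sum>j\<le>i. (\<eta> j \<omega>)\<^sup>2 * v j) \<in> borel_measurable (G i)"
      using G_measurable_mono[OF \<eta>, of _ i] i
      by (intro borel_measurable_sum borel_measurable_times borel_measurable_power) auto
    then have [measurable]: "Measurable.pred (G i) (\<lambda>\<omega>. (\<Sum>j\<le>i. (\<eta> j \<omega>)\<^sup>2 * v j) \<le> \<delta>)"
      by measurable
    have [measurable]: "\<eta> i \<in> borel_measurable (G i)" by (rule \<eta>[OF i])
    show ?thesis unfolding \<zeta>_def[abs_def] by measurable
  qed
  have \<zeta>2: "second_moment_le M (\<zeta> i) (expectation (\<lambda>\<omega>. (\<zeta> i \<omega>)\<^sup>2))" if "i < K" for i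
  proof -
    have "second_moment_le M (\<eta> i) (expectation (\<lambda>\<omega>. (\<eta> i \<omega>)\<^sup>2))"
      using c[OF that] G_measurable_M[OF \<eta>[OF that]] that by (simp add: second_moment_le_def)
    then have "second_moment_le M (\<zeta> i) (expectation (\<lambda>\<omega>. (\<eta> i \<omega>)\<^sup>2))"
    proof (rule second_moment_le_dominated)
      show "\<zeta> i \<in> borel_measurable M" using G_measurable_M[OF \<zeta>G] that by simp
    qed (simp add: \<zeta>_def)
    then show ?thesis by (simp add: second_moment_le_def)
  qed
  have le: "(\<Sum>i<k. (\<zeta> i \<omega>)\<^sup>2 * v i) \<le> \<delta>" if "k \<le> K" for k \<omega>
    using that
  proof (induction k)
    case (Suc k)
    show ?case
    proof (cases "(\<Sum>j\<le>k. (\<eta> j \<omega>)\<^sup>2 * v j) \<le> \<delta>")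
      case True
      have "(\<Sum>i<Suc k. (\<zeta> i \<omega>)\<^sup>2 * v i) \<le> (\<Sum>i<Suc k. (\<eta> i \<omega>)\<^sup>2 * v i)"
        using Suc.prems v_nonneg by (intro sum_mono mult_right_mono) (auto simp: \<zeta>_def)
      then show ?thesis using True by (simp add: lessThan_Suc_atMost)
    next
      case False
      then have "\<zeta> k \<omega> = 0" by (simp add: \<zeta>_def)
      then show ?thesis using Suc by simp
    qed
  qed (use \<delta> in simp)
  have "second_moment_le M (transform \<zeta> K) (\<Sum>i<K. expectation (\<lambda>\<omega>. (\<zeta> i \<omega>)\<^sup>2) * v i)"
    by (rule transform_second_moment) (use \<zeta>G \<zeta>2 in auto)
  moreover have "(\<Sum>i<K. expectation (\<lambda>\<omega>. (\<zeta> i \<omega>)\<^sup>2) * v i) \<le> \<delta>"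
  proof -
    have "(\<Sum>i<K. expectation (\<lambda>\<omega>. (\<zeta> i \<omega>)\<^sup>2) * v i) = expectation (\<lambda>\<omega>. \<Sum>i<K. (\<zeta> i \<omega>)\<^sup>2 * v i)"
      using \<zeta>2 by (subst Bochner_Integration.integral_sum) (auto simp: second_moment_le_def)
    also have "\<dots> \<le> expectation (\<lambda>_. \<delta>)"
      using \<zeta>2 le by (intro integral_mono Bochner_Integration.integrable_sum)
        (auto simp: second_moment_le_def)
    finally show ?thesis by (simp add: prob_space)
  qed
  ultimately have N: "second_moment_le M (transform \<zeta> K) \<delta>" by (rule second_moment_le_mono)
  have same: "transform \<zeta> K \<omega> = transform \<eta> K \<omega>" if "(\<Sum>i<K. (\<eta> i \<omega>)\<^sup>2 * v i) \<le> \<delta>" for \<omega>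
  proof -
    have "\<zeta> i \<omega> = \<eta> i \<omega>" if i: "i < K" for i
    proof -
      have "{..i} \<subseteq> {..<K}" using i by auto
      then have "(\<Sum>j\<le>i. (\<eta> j \<omega>)\<^sup>2 * v j) \<le> (\<Sum>j<K. (\<eta> j \<omega>)\<^sup>2 * v j)"
        using v_nonneg by (intro sum_mono2) auto
      then show ?thesis using \<open>(\<Sum>i<K. (\<eta> i \<omega>)\<^sup>2 * v i) \<le> \<delta>\<close> by (simp add: \<zeta>_def)
    qed
    then show ?thesis by (simp add: transform_def)
  qed
  have meas: "{\<omega>\<in>space M. \<delta> < (\<Sum>i<K. (\<eta> i \<omega>)\<^sup>2 * v i)} \<in> sets M"
  proof -
    have "(\<lambda>\<omega>. \<Sum>j<K. (\<eta> j \<omega>)\<^sup>2 * v j) \<in> borel_measurable M"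
      using G_measurable_M[OF \<eta>]
      by (intro borel_measurable_sum borel_measurable_times borel_measurable_power) auto
    then show ?thesis by measurable
  qed
  have meas2: "{\<omega>\<in>space M. a \<le> \<bar>transform \<zeta> K \<omega>\<bar>} \<in> sets M"
    using second_moment_leD(1)[OF N] by measurable
  have "prob {\<omega>\<in>space M. a \<le> \<bar>transform \<eta> K \<omega>\<bar>} \<le>
    prob ({\<omega>\<in>space M. \<delta> < (\<Sum>i<K. (\<eta> i \<omega>)\<^sup>2 * v i)} \<union> {\<omega>\<in>space M. a \<le> \<bar>transform \<zeta> K \<omega>\<bar>})"
  proof (rule finite_measure_mono)
    show "{\<omega>\<in>space M. a \<le> \<bar>transform \<eta> K \<omega>\<bar>} \<subseteq>
        {\<omega>\<in>space M. \<delta> < (\<Sum>i<K. (\<eta> i \<omega>)\<^sup>2 * v i)} \<union> {\<omega>\<in>space M. a \<le> \<bar>transform \<zeta> K \<omega>\<bar>}"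
    proof
      fix \<omega> assume \<omega>: "\<omega> \<in> {\<omega>\<in>space M. a \<le> \<bar>transform \<eta> K \<omega>\<bar>}"
      show "\<omega> \<in> {\<omega>\<in>space M. \<delta> < (\<Sum>i<K. (\<eta> i \<omega>)\<^sup>2 * v i)} \<union> {\<omega>\<in>space M. a \<le> \<bar>transform \<zeta> K \<omega>\<bar>}"
        using same[of \<omega>] \<omega> by (cases "(\<Sum>i<K. (\<eta> i \<omega>)\<^sup>2 * v i) \<le> \<delta>") auto
    qed
  qed (intro sets.Un meas meas2)
  also have "\<dots> \<le> prob {\<omega>\<in>space M. \<delta> < (\<Sum>i<K. (\<eta> i \<omega>)\<^sup>2 * v i)} + prob {\<omega>\<in>space M. a \<le> \<bar>transform \<zeta> K \<omega>\<bar>}"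
    by (rule measure_Un_le[OF meas meas2])
  also have "prob {\<omega>\<in>space M. a \<le> \<bar>transform \<zeta> K \<omega>\<bar>} \<le> \<delta> / a\<^sup>2"
    by (rule second_moment_le_Chebyshev[OF N a])
  finally show ?thesis by simp
qed

end

section \<open>Convergence in probability\<close>

definition conv_in_prob :: "'a measure \<Rightarrow> (nat \<Rightarrow> 'a \<Rightarrow> real) \<Rightarrow> ('a \<Rightarrow> real) \<Rightarrow> bool" where
  "conv_in_prob M X Y \<longleftrightarrow>
     (\<forall>n. X n \<in> borel_measurable M) \<and> Y \<in> borel_measurable M \<and>
     (\<forall>\<epsilon>>0. (\<lambda>n. measure M {\<omega>\<in>space M. \<epsilon> < \<bar>X n \<omega> - Y \<omega>\<bar>}) \<longlonglongrightarrow> 0)"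

context prob_space
begin

lemma conv_in_probI_bound:
  assumes X: "\<And>n. X n \<in> borel_measurable M" "Y \<in> borel_measurable M"
    and le: "\<And>\<epsilon> n. \<epsilon> > 0 \<Longrightarrow> prob {\<omega>\<in>space M. \<epsilon> < \<bar>X n \<omega> - Y \<omega>\<bar>} \<le> b \<epsilon> n"
    and b: "\<And>\<epsilon>. \<epsilon> > 0 \<Longrightarrow> b \<epsilon> \<longlonglongrightarrow> (0 :: real)"
  shows "conv_in_prob M X Y"
  unfolding conv_in_prob_def
proof (intro conjI allI impI)
  fix \<epsilon> :: real assume "\<epsilon> > 0"
  then show "(\<lambda>n. prob {\<omega>\<in>space M. \<epsilon> < \<bar>X n \<omega> - Y \<omega>\<bar>}) \<longlonglongrightarrow> 0"
    by (intro tendsto_sandwich[OF _ _ tendsto_const b]) (auto simp: le)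
qed (use X in auto)

lemma conv_in_prob_add:
  assumes "conv_in_prob M X Y" "conv_in_prob M X' Y'"
  shows "conv_in_prob M (\<lambda>n \<omega>. X n \<omega> + X' n \<omega>) (\<lambda>\<omega>. Y \<omega> + Y' \<omega>)"
proof -
  have m[measurable]: "\<And>n. X n \<in> borel_measurable M" "\<And>n. X' n \<in> borel_measurable M"
     "Y \<in> borel_measurable M" "Y' \<in> borel_measurable M"
    using assms by (auto simp: conv_in_prob_def)
  show ?thesis
  proof (rule conv_in_probI_bound)
    fix \<epsilon> :: real and n assume "\<epsilon> > 0"
    have half: "\<epsilon>/2 < \<bar>x - y\<bar> \<or> \<epsilon>/2 < \<bar>x' - y'\<bar>" if "\<epsilon> < \<bar>x + x' - (y + y')\<bar>" for x x' y y' :: real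
      using that by linarith
    have "prob {\<omega>\<in>space M. \<epsilon> < \<bar>X n \<omega> + X' n \<omega> - (Y \<omega> + Y' \<omega>)\<bar>} \<le>
       prob ({\<omega>\<in>space M. \<epsilon>/2 < \<bar>X n \<omega> - Y \<omega>\<bar>} \<union> {\<omega>\<in>space M. \<epsilon>/2 < \<bar>X' n \<omega> - Y' \<omega>\<bar>})"
    proof (rule finite_measure_mono)
      show "{\<omega>\<in>space M. \<epsilon> < \<bar>X n \<omega> + X' n \<omega> - (Y \<omega> + Y' \<omega>)\<bar>} \<subseteq>
          {\<omega>\<in>space M. \<epsilon>/2 < \<bar>X n \<omega> - Y \<omega>\<bar>} \<union> {\<omega>\<in>space M. \<epsilon>/2 < \<bar>X' n \<omega> - Y' \<omega>\<bar>}"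
        using half by blast
    qed measurable
    also have "\<dots> \<le> prob {\<omega>\<in>space M. \<epsilon>/2 < \<bar>X n \<omega> - Y \<omega>\<bar>} + prob {\<omega>\<in>space M. \<epsilon>/2 < \<bar>X' n \<omega> - Y' \<omega>\<bar>}"
      by (rule measure_Un_le) auto
    finally show "prob {\<omega>\<in>space M. \<epsilon> < \<bar>X n \<omega> + X' n \<omega> - (Y \<omega> + Y' \<omega>)\<bar>} \<le> \<dots>" .
  next
    fix \<epsilon> :: real assume "\<epsilon> > 0"
    then show "(\<lambda>n. prob {\<omega>\<in>space M. \<epsilon>/2 < \<bar>X n \<omega> - Y \<omega>\<bar>} + prob {\<omega>\<in>space M. \<epsilon>/2 < \<bar>X' n \<omega> - Y' \<omega>\<bar>}) \<longlonglongrightarrow> 0"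
      using assms[unfolded conv_in_prob_def] half_gt_zero[of \<epsilon>] by (intro tendsto_add_zero) blast+
  qed auto
qed

lemma conv_in_prob_cmult:
  assumes "conv_in_prob M X Y"
  shows "conv_in_prob M (\<lambda>n \<omega>. a * X n \<omega>) (\<lambda>\<omega>. a * Y \<omega>)"
proof (cases "a = 0")
  case True
  then show ?thesis by (simp add: conv_in_prob_def)
next
  case False
  have m[measurable]: "\<And>n. X n \<in> borel_measurable M" "Y \<in> borel_measurable M"
    using assms by (auto simp: conv_in_prob_def)
  have "\<epsilon> < \<bar>a * X n \<omega> - a * Y \<omega>\<bar> \<longleftrightarrow> \<epsilon> / \<bar>a\<bar> < \<bar>X n \<omega> - Y \<omega>\<bar>" for \<epsilon> n \<omega>
    using False by (simp add: pos_divide_less_eq abs_mult mult.commute flip: right_diff_distrib)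
  then show ?thesis using assms False by (simp add: conv_in_prob_def)
qed

lemma conv_in_prob_diff:
  assumes "conv_in_prob M X Y" "conv_in_prob M X' Y'"
  shows "conv_in_prob M (\<lambda>n \<omega>. X n \<omega> - X' n \<omega>) (\<lambda>\<omega>. Y \<omega> - Y' \<omega>)"
  using conv_in_prob_add[OF assms(1) conv_in_prob_cmult[OF assms(2), of "-1"]] by simp

lemma conv_in_prob_const: "Y \<in> borel_measurable M \<Longrightarrow> conv_in_prob M (\<lambda>_. Y) Y"
  by (simp add: conv_in_prob_def)

lemma conv_in_probI_L1:
  assumes X: "\<And>n. X n \<in> borel_measurable M" "Y \<in> borel_measurable M"
    and i: "\<And>n. integrable M (\<lambda>\<omega>. X n \<omega> - Y \<omega>)"
    and le: "\<And>n. expectation (\<lambda>\<omega>. \<bar>X n \<omega> - Y \<omega>\<bar>) \<le> a n" and a: "a \<longlonglongrightarrow> 0"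
  shows "conv_in_prob M X Y"
proof (rule conv_in_probI_bound[OF X, where b = "\<lambda>\<epsilon> n. a n / \<epsilon>"])
  fix \<epsilon> :: real and n assume \<epsilon>: "\<epsilon> > 0"
  have [measurable]: "X n \<in> borel_measurable M" "Y \<in> borel_measurable M" using X by auto
  have "prob {\<omega>\<in>space M. \<epsilon> < \<bar>X n \<omega> - Y \<omega>\<bar>} \<le> prob {\<omega>\<in>space M. \<epsilon> \<le> \<bar>X n \<omega> - Y \<omega>\<bar>}"
    by (rule finite_measure_mono) auto
  also have "\<dots> \<le> expectation (\<lambda>\<omega>. \<bar>X n \<omega> - Y \<omega>\<bar>) / \<epsilon>"
    by (rule integral_Markov_inequality_measure[where A = "space M"]) (use i \<epsilon> in auto)
  also have "\<dots> \<le> a n / \<epsilon>" using le \<epsilon> by (intro divide_right_mono) auto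
  finally show "prob {\<omega>\<in>space M. \<epsilon> < \<bar>X n \<omega> - Y \<omega>\<bar>} \<le> a n / \<epsilon>" .
next
  fix \<epsilon> :: real
  show "(\<lambda>n. a n / \<epsilon>) \<longlonglongrightarrow> 0" using tendsto_divide_zero[OF a] .
qed

lemma conv_in_probI_L2:
  assumes X: "\<And>n. second_moment_le M (X n) (a n)" and a: "a \<longlonglongrightarrow> 0"
  shows "conv_in_prob M X (\<lambda>_. 0)"
proof (rule conv_in_probI_bound[where b = "\<lambda>\<epsilon> n. a n / \<epsilon>\<^sup>2"])
  show "X n \<in> borel_measurable M" for n using second_moment_leD(1)[OF X] .
  then have [measurable]: "X n \<in> borel_measurable M" for n .
  fix \<epsilon> :: real and n assume \<epsilon>: "\<epsilon> > 0"
  have "prob {\<omega>\<in>space M. \<epsilon> < \<bar>X n \<omega> - 0\<bar>} \<le> prob {\<omega>\<in>space M. \<epsilon> \<le> \<bar>X n \<omega>\<bar>}"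
    by (rule finite_measure_mono) auto
  also have "\<dots> \<le> a n / \<epsilon>\<^sup>2" by (rule second_moment_le_Chebyshev[OF X \<epsilon>])
  finally show "prob {\<omega>\<in>space M. \<epsilon> < \<bar>X n \<omega> - 0\<bar>} \<le> a n / \<epsilon>\<^sup>2" .
next
  fix \<epsilon> :: real
  show "(\<lambda>n. a n / \<epsilon>\<^sup>2) \<longlonglongrightarrow> 0" using tendsto_divide_zero[OF a] .
qed simp

lemma conv_in_probI_AE:
  assumes m[measurable]: "\<And>n. X n \<in> borel_measurable M" "Y \<in> borel_measurable M"
    and lim: "AE \<omega> in M. (\<lambda>n. X n \<omega>) \<longlonglongrightarrow> Y \<omega>"
  shows "conv_in_prob M X Y"
  unfolding conv_in_prob_def
proof (intro conjI allI impI)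
  fix \<epsilon> :: real assume \<epsilon>: "\<epsilon> > 0"
  let ?A = "\<lambda>n. {\<omega>\<in>space M. \<epsilon> < \<bar>X n \<omega> - Y \<omega>\<bar>}"
  have "(\<lambda>n. integral\<^sup>L M (\<lambda>\<omega>. indicator (?A n) \<omega> :: real)) \<longlonglongrightarrow> integral\<^sup>L M (\<lambda>\<omega>. 0)"
  proof (rule integral_dominated_convergence[where w = "\<lambda>_. 1"])
    show "AE \<omega> in M. (\<lambda>n. indicator (?A n) \<omega> :: real) \<longlonglongrightarrow> 0"
      using lim
    proof (rule AE_mp, intro AE_I2 impI)
      fix \<omega> assume "(\<lambda>n. X n \<omega>) \<longlonglongrightarrow> Y \<omega>"
      then have "eventually (\<lambda>n. dist (X n \<omega>) (Y \<omega>) < \<epsilon>) sequentially"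
        using \<epsilon> by (auto simp: tendsto_iff)
      then have "eventually (\<lambda>n. indicator (?A n) \<omega> = (0 :: real)) sequentially"
        by (rule eventually_mono) (auto simp: dist_real_def)
      then show "(\<lambda>n. indicator (?A n) \<omega> :: real) \<longlonglongrightarrow> 0"
        by (rule tendsto_eventually)
    qed
  qed auto
  then show "(\<lambda>n. prob (?A n)) \<longlonglongrightarrow> 0" by simp
qed (rule m)+

text \<open>
  The truncated distances \<open>min 1 |X n - Y|\<close> tend to zero in \<open>L\<^sup>1\<close>, so that a subsequence of them tends to
  zero almost surely.
\<close>

lemma conv_in_prob_AE_subseq:
  assumes "conv_in_prob M X Y"
  obtains r :: "nat \<Rightarrow> nat" where "strict_mono r" "AE \<omega> in M. (\<lambda>n. X (r n) \<omega>) \<longlonglongrightarrow> Y \<omega>"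
proof -
  have m[measurable]: "\<And>n. X n \<in> borel_measurable M" "Y \<in> borel_measurable M"
    and lim: "\<And>\<epsilon>. \<epsilon> > 0 \<Longrightarrow> (\<lambda>n. prob {\<omega>\<in>space M. \<epsilon> < \<bar>X n \<omega> - Y \<omega>\<bar>}) \<longlonglongrightarrow> 0"
    using assms by (auto simp: conv_in_prob_def)
  define u where "u n \<omega> = min 1 \<bar>X n \<omega> - Y \<omega>\<bar>" for n \<omega>
  have [measurable]: "u n \<in> borel_measurable M" for n unfolding u_def[abs_def] by measurable
  have int: "integrable M (u n)" for n
    by (rule integrable_const_bound[where B = 1]) (auto simp: u_def)
  have "(\<lambda>n. expectation (\<lambda>\<omega>. norm (u n \<omega>))) \<longlonglongrightarrow> 0"
    unfolding tendsto_iff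
  proof (intro allI impI)
    fix \<epsilon> :: real assume \<epsilon>: "\<epsilon> > 0"
    have le: "expectation (\<lambda>\<omega>. norm (u n \<omega>)) \<le> \<epsilon>/2 + prob {\<omega>\<in>space M. \<epsilon>/2 < \<bar>X n \<omega> - Y \<omega>\<bar>}" for n
    proof -
      have "expectation (\<lambda>\<omega>. norm (u n \<omega>)) \<le>
         expectation (\<lambda>\<omega>. \<epsilon>/2 + indicator {\<omega>\<in>space M. \<epsilon>/2 < \<bar>X n \<omega> - Y \<omega>\<bar>} \<omega>)"
      proof (rule integral_mono)
        show "integrable M (\<lambda>\<omega>. \<epsilon>/2 + indicator {\<omega>\<in>space M. \<epsilon>/2 < \<bar>X n \<omega> - Y \<omega>\<bar>} \<omega> :: real)"
          by (rule integrable_const_bound[where B = "\<epsilon>/2 + 1"])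
            (use \<epsilon> in \<open>auto simp: indicator_def intro!: AE_I2\<close>)
        fix \<omega> assume "\<omega> \<in> space M"
        then show "norm (u n \<omega>) \<le> \<epsilon>/2 + indicator {\<omega>\<in>space M. \<epsilon>/2 < \<bar>X n \<omega> - Y \<omega>\<bar>} \<omega>"
          using \<epsilon> by (cases "\<epsilon>/2 < \<bar>X n \<omega> - Y \<omega>\<bar>") (simp_all add: u_def min_def)
      qed (use int in simp)
      also have "\<dots> = \<epsilon>/2 + prob {\<omega>\<in>space M. \<epsilon>/2 < \<bar>X n \<omega> - Y \<omega>\<bar>}"
      proof (subst Bochner_Integration.integral_add)
        show "integrable M (\<lambda>\<omega>. indicator {\<omega>\<in>space M. \<epsilon>/2 < \<bar>X n \<omega> - Y \<omega>\<bar>} \<omega> :: real)"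
          by (rule integrable_const_bound[where B = 1]) (auto simp: indicator_def intro!: AE_I2)
      qed (auto simp: prob_space)
      finally show ?thesis .
    qed
    have "eventually (\<lambda>n. prob {\<omega>\<in>space M. \<epsilon>/2 < \<bar>X n \<omega> - Y \<omega>\<bar>} < \<epsilon>/2) sequentially"
      using order_tendstoD(2)[OF lim[of "\<epsilon>/2"], of "\<epsilon>/2"] \<epsilon> by simp
    then show "eventually (\<lambda>n. dist (expectation (\<lambda>\<omega>. norm (u n \<omega>))) 0 < \<epsilon>) sequentially"
    proof (rule eventually_mono)
      fix n assume "prob {\<omega>\<in>space M. \<epsilon>/2 < \<bar>X n \<omega> - Y \<omega>\<bar>} < \<epsilon>/2"
      moreover have "0 \<le> expectation (\<lambda>\<omega>. norm (u n \<omega>))" by (rule integral_nonneg_AE) auto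
      ultimately show "dist (expectation (\<lambda>\<omega>. norm (u n \<omega>))) 0 < \<epsilon>"
        using le[of n] by (simp add: dist_real_def)
    qed
  qed
  then obtain r :: "nat \<Rightarrow> nat" where r: "strict_mono r" "AE \<omega> in M. (\<lambda>n. u (r n) \<omega>) \<longlonglongrightarrow> 0"
    using tendsto_L1_AE_subseq[where u = u, OF int] by blast
  have "AE \<omega> in M. (\<lambda>n. X (r n) \<omega>) \<longlonglongrightarrow> Y \<omega>"
    using r(2)
  proof (rule AE_mp, intro AE_I2 impI)
    fix \<omega> assume u0: "(\<lambda>n. u (r n) \<omega>) \<longlonglongrightarrow> 0"
    have "eventually (\<lambda>n. u (r n) \<omega> < 1) sequentially" using order_tendstoD(2)[OF u0, of 1] by simp
    then have "eventually (\<lambda>n. u (r n) \<omega> = \<bar>X (r n) \<omega> - Y \<omega>\<bar>) sequentially"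
      by (rule eventually_mono) (auto simp: u_def min_def split: if_splits)
    then have "(\<lambda>n. \<bar>X (r n) \<omega> - Y \<omega>\<bar>) \<longlonglongrightarrow> 0" using u0 by (simp add: tendsto_cong)
    then show "(\<lambda>n. X (r n) \<omega>) \<longlonglongrightarrow> Y \<omega>"
      by (simp add: tendsto_rabs_zero_iff LIM_zero_iff)
  qed
  with r(1) that show thesis by blast
qed

lemma conv_in_prob_subseq:
  assumes "conv_in_prob M X Y" "strict_mono r"
  shows "conv_in_prob M (\<lambda>n. X (r n)) Y"
  using assms LIMSEQ_subseq_LIMSEQ[OF _ assms(2)] by (fastforce simp: conv_in_prob_def comp_def)

lemma conv_in_prob_unique:
  assumes "conv_in_prob M X Y" "conv_in_prob M X Y'"
  shows "AE \<omega> in M. Y \<omega> = Y' \<omega>"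
proof -
  obtain r where r: "strict_mono r" "AE \<omega> in M. (\<lambda>n. X (r n) \<omega>) \<longlonglongrightarrow> Y \<omega>"
    using conv_in_prob_AE_subseq[OF assms(1)] .
  obtain s where s: "strict_mono s" "AE \<omega> in M. (\<lambda>n. X (r (s n)) \<omega>) \<longlonglongrightarrow> Y' \<omega>"
    using conv_in_prob_AE_subseq[OF conv_in_prob_subseq[OF assms(2) r(1)]] .
  show ?thesis using r(2) s(2)
  proof eventually_elim
    case (elim \<omega>)
    then show ?case
      using LIMSEQ_unique LIMSEQ_subseq_LIMSEQ[OF elim(1) s(1)] by (auto simp: comp_def)
  qed
qed

text \<open>Fatou's lemma along an almost surely convergent subsequence.\<close>

lemma conv_in_prob_second_moment:
  assumes lim: "conv_in_prob M X Y" and le: "\<And>n. second_moment_le M (X n) c"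
  shows "second_moment_le M Y c"
proof -
  obtain r where r: "strict_mono r" "AE \<omega> in M. (\<lambda>n. X (r n) \<omega>) \<longlonglongrightarrow> Y \<omega>"
    using conv_in_prob_AE_subseq[OF lim] .
  have m[measurable]: "\<And>n. X n \<in> borel_measurable M" "Y \<in> borel_measurable M"
    using lim by (auto simp: conv_in_prob_def)
  have c: "0 \<le> c" using second_moment_le_nonneg[OF le] .
  have "(\<integral>\<^sup>+\<omega>. ennreal ((Y \<omega>)\<^sup>2) \<partial>M) = (\<integral>\<^sup>+\<omega>. liminf (\<lambda>n. ennreal ((X (r n) \<omega>)\<^sup>2)) \<partial>M)"
  proof (rule nn_integral_cong_AE, use r(2) in eventually_elim)
    case (elim \<omega>)
    then have "(\<lambda>n. ennreal ((X (r n) \<omega>)\<^sup>2)) \<longlonglongrightarrow> ennreal ((Y \<omega>)\<^sup>2)"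
      by (intro tendsto_ennrealI tendsto_power)
    then show ?case using lim_imp_Liminf[OF sequentially_bot] by metis
  qed
  also have "\<dots> \<le> liminf (\<lambda>n. \<integral>\<^sup>+\<omega>. ennreal ((X (r n) \<omega>)\<^sup>2) \<partial>M)"
    by (rule nn_integral_liminf) measurable
  also have "\<dots> \<le> ennreal c"
  proof -
    have "(\<integral>\<^sup>+\<omega>. ennreal ((X n \<omega>)\<^sup>2) \<partial>M) \<le> ennreal c" for n
      using le[of n] by (subst nn_integral_eq_integral) (auto simp: second_moment_le_def ennreal_leI)
    then show ?thesis by (intro Liminf_le) auto
  qed
  finally have nn: "(\<integral>\<^sup>+\<omega>. ennreal ((Y \<omega>)\<^sup>2) \<partial>M) \<le> ennreal c" .
  have int: "integrable M (\<lambda>\<omega>. (Y \<omega>)\<^sup>2)"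
    by (rule integrableI_nonneg) (use nn in \<open>auto simp: less_top[symmetric] top_unique\<close>)
  moreover have "expectation (\<lambda>\<omega>. (Y \<omega>)\<^sup>2) \<le> c"
    using nn c int by (simp add: nn_integral_eq_integral)
  ultimately show ?thesis by (simp add: second_moment_le_def)
qed

end


section \<open>Brownian increments\<close>

lemma increasing_nonneg:
  fixes \<sigma> :: "nat \<Rightarrow> real"
  assumes "0 \<le> \<sigma> 0" and "\<And>i. i < k \<Longrightarrow> \<sigma> i < \<sigma> (Suc i)" and "i \<le> k"
  shows "0 \<le> \<sigma> i"
  using assms(3)
proof (induction i)
  case (Suc i)
  then show ?case using assms(2)[of i] by simp
qed (rule assms(1))

lemma normal_moments:
  fixes X :: "'a \<Rightarrow> real"
  assumes D: "distributed M lborel X (normal_density 0 \<sigma>)" and \<sigma>: "\<sigma> > 0"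
  shows "integrable M X" "integrable M (\<lambda>\<omega>. (X \<omega>)\<^sup>2)" "integrable M (\<lambda>\<omega>. (X \<omega>) ^ 4)"
    and "(\<integral>\<omega>. X \<omega> \<partial>M) = 0" "(\<integral>\<omega>. (X \<omega>)\<^sup>2 \<partial>M) = \<sigma>\<^sup>2" "(\<integral>\<omega>. (X \<omega>) ^ 4 \<partial>M) = 3 * \<sigma> ^ 4"
proof -
  have int: "integrable M (\<lambda>\<omega>. X \<omega> ^ k)" for k
    using distributed_integrable[OF D, of "\<lambda>x. x ^ k"] integrable_normal_moment[OF \<sigma>, of 0 k]
    by simp
  have ev: "(\<integral>\<omega>. X \<omega> ^ k \<partial>M) = (\<integral>x. normal_density 0 \<sigma> x * x ^ k \<partial>lborel)" for k
    using distributed_integral[OF D, of "\<lambda>x. x ^ k"] by simp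
  show "integrable M X" "integrable M (\<lambda>\<omega>. (X \<omega>)\<^sup>2)" "integrable M (\<lambda>\<omega>. (X \<omega>) ^ 4)"
    using int[of 1] int[of 2] int[of 4] by auto
  show "(\<integral>\<omega>. X \<omega> \<partial>M) = 0"
    using ev[of 1] integral_normal_moment_odd[OF \<sigma>, of 0 0] by simp
  show "(\<integral>\<omega>. (X \<omega>)\<^sup>2 \<partial>M) = \<sigma>\<^sup>2"
    using ev[of 2] integral_normal_moment_even[OF \<sigma>, of 0 1] by (simp add: fact_numeral)
  show "(\<integral>\<omega>. (X \<omega>) ^ 4 \<partial>M) = 3 * \<sigma> ^ 4"
    using ev[of 4] integral_normal_moment_even[OF \<sigma>, of 0 2] \<sigma>
    by (simp add: fact_numeral power2_eq_square field_simps eval_nat_numeral)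
qed

locale brownian = prob_space M for M :: "'a measure" +
  fixes F :: "real \<Rightarrow> 'a measure" and T :: real and W :: "real \<Rightarrow> 'a \<Rightarrow> real ^ ('n::finite)"
  assumes T_pos: "T > 0" and usual: "usual_conditions M F" and bm: "brownian_motion M F W"
begin

abbreviation dW :: "'n \<Rightarrow> real \<Rightarrow> real \<Rightarrow> 'a \<Rightarrow> real" where
  "dW j s t \<omega> \<equiv> W t \<omega> $ j - W s \<omega> $ j"

lemma F_subalgebra: "0 \<le> t \<Longrightarrow> subalgebra M (F t)"
  using usual by (auto simp: usual_conditions_def)

lemma F_mono: "s \<le> t \<Longrightarrow> sets (F s) \<subseteq> sets (F t)"
proof -
  have "filtration (space M) F" using usual by (simp add: usual_conditions_def)
  then show "s \<le> t \<Longrightarrow> sets (F s) \<subseteq> sets (F t)" by (rule filtration.sets_F_mono)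
qed

lemma F_measurable_mono:
  assumes "f \<in> measurable (F s) N" "0 \<le> s" "s \<le> t"
  shows "f \<in> measurable (F t) N"
proof -
  have "subalgebra (F t) (F s)"
    using F_subalgebra[of s] F_subalgebra[of t] F_mono[of s t] assms by (auto simp: subalgebra_def)
  then show ?thesis using assms(1) measurable_from_subalg by blast
qed

lemma F_measurable_M: "f \<in> measurable (F t) N \<Longrightarrow> 0 \<le> t \<Longrightarrow> f \<in> measurable M N"
  using measurable_from_subalg F_subalgebra by blast

lemma W_measurable: "0 \<le> t \<Longrightarrow> W t \<in> borel_measurable (F t)"
  using bm by (auto simp: brownian_motion_def)

lemma W_component_measurable: "0 \<le> t \<Longrightarrow> (\<lambda>\<omega>. W t \<omega> $ j) \<in> borel_measurable (F t)"
  using measurable_compose[OF W_measurable, of t "\<lambda>x. x $ j" borel]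
    borel_measurable_continuous_onI[of "\<lambda>x :: real ^ 'n. x $ j"]
  by (simp add: continuous_on_component)

lemma increment_measurable:
  "0 \<le> s \<Longrightarrow> s \<le> t \<Longrightarrow> (\<lambda>\<omega>. W t \<omega> - W s \<omega>) \<in> borel_measurable (F t)"
  using W_measurable[of t] F_measurable_mono[OF W_measurable[of s], of t]
  by (intro borel_measurable_diff) auto

lemma increment_moments:
  assumes st: "0 \<le> s" "s < t"
  shows "second_moment_le M (dW j s t) (t - s)"
    and "expectation (dW j s t) = 0"
    and "integrable M (\<lambda>\<omega>. (dW j s t \<omega>) ^ 4)"
    and "expectation (\<lambda>\<omega>. (dW j s t \<omega>) ^ 4) = 3 * (t - s)\<^sup>2"
    and "expectation (\<lambda>\<omega>. (dW j s t \<omega>)\<^sup>2) = t - s"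
proof -
  have D: "distributed M lborel (dW j s t) (normal_density 0 (sqrt (t - s)))"
    using bm st by (auto simp: brownian_motion_def)
  have s0: "sqrt (t - s) > 0" using st by simp
  have s4: "sqrt (t - s) ^ 4 = (t - s)\<^sup>2"
    using st real_sqrt_pow2[of "t - s"] power_mult[of "sqrt (t - s)" 2 2] by simp
  note N = normal_moments[OF D s0]
  show "second_moment_le M (dW j s t) (t - s)"
    using N(2,5) st N(1)[THEN borel_measurable_integrable] by (simp add: second_moment_le_def)
  show "expectation (dW j s t) = 0"
    "integrable M (\<lambda>\<omega>. (dW j s t \<omega>) ^ 4)"
    "expectation (\<lambda>\<omega>. (dW j s t \<omega>) ^ 4) = 3 * (t - s)\<^sup>2"
    "expectation (\<lambda>\<omega>. (dW j s t \<omega>)\<^sup>2) = t - s"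
    using N s4 st by auto
qed

text \<open>
  The compensated products of increments; on the diagonal the variance \<open>2 (t - s)\<^sup>2\<close> is that of the
  square of a normal variable.
\<close>

lemma increment_product_moments:
  fixes j l :: 'n
  assumes st: "0 \<le> s" "s < t"
  defines "X \<equiv> \<lambda>\<omega>. dW j s t \<omega> * dW l s t \<omega> - of_bool (j = l) * (t - s)"
  shows "second_moment_le M X (2 * (t - s)\<^sup>2)" and "expectation X = 0"
proof -
  let ?D = "\<lambda>j \<omega>. dW j s t \<omega>"
  note m = increment_moments[OF st]
  have meas: "?D j \<in> borel_measurable M" for j using m(1) by (rule second_moment_leD)
  have "second_moment_le M X (2 * (t - s)\<^sup>2) \<and> expectation X = 0"
  proof (cases "j = l")
    case True
    have X2: "X = (\<lambda>\<omega>. (?D l \<omega>)\<^sup>2 - (t - s))"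
      using True by (simp add: X_def power2_eq_square)
    have X4: "(X \<omega>)\<^sup>2 = (?D l \<omega>) ^ 4 - 2 * (t - s) * (?D l \<omega>)\<^sup>2 + (t - s)\<^sup>2" for \<omega>
    proof -
      have "(x\<^sup>2 - c)\<^sup>2 = x ^ 4 - 2 * c * x\<^sup>2 + c\<^sup>2" for x c :: real
        by (simp add: power2_diff mult_ac)
      then show ?thesis unfolding X2 .
    qed
    have i2: "integrable M (\<lambda>\<omega>. (?D l \<omega>)\<^sup>2)" using m(1) by (rule second_moment_leD)
    have "integrable M (\<lambda>\<omega>. (X \<omega>)\<^sup>2)"
      unfolding X4 using i2 m(3)[of l] by (intro Bochner_Integration.integrable_add Bochner_Integration.integrable_diff) auto
    moreover have "expectation (\<lambda>\<omega>. (X \<omega>)\<^sup>2) = 2 * (t - s)\<^sup>2"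
      unfolding X4 using i2 m(3)[of l] m(4,5)[of l] by (simp add: prob_space power2_eq_square)
    moreover have "expectation X = 0" unfolding X2 using i2 m(5)[of l] by (simp add: prob_space)
    moreover have "X \<in> borel_measurable M" unfolding X2 using meas by measurable
    ultimately show ?thesis by (simp add: second_moment_le_def)
  next
    case False
    then have X: "X = (\<lambda>\<omega>. ?D j \<omega> * ?D l \<omega>)" by (simp add: X_def)
    have "indep_vars (\<lambda>_. borel) ?D UNIV"
      using bm st by (simp add: brownian_motion_def)
    then have ind: "indep_vars (\<lambda>_. borel) ?D {j, l}" by (rule indep_vars_subset) simp
    then have ind2: "indep_vars (\<lambda>_. borel) (\<lambda>j \<omega>. (?D j \<omega>)\<^sup>2) {j, l}"
      by (rule indep_vars_compose2) simp
    have i1: "integrable M (?D j)" for j using integrable_second_moment[OF m(1)] .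
    have i2: "integrable M (\<lambda>\<omega>. (?D j \<omega>)\<^sup>2)" for j using m(1) by (rule second_moment_leD)
    have "expectation X = 0"
      using indep_vars_lebesgue_integral[OF _ ind i1] False m(2) by (simp add: X)
    moreover have "integrable M (\<lambda>\<omega>. (X \<omega>)\<^sup>2)"
      using indep_vars_integrable[OF _ ind2 i2] False by (simp add: X power_mult_distrib)
    moreover have "expectation (\<lambda>\<omega>. (X \<omega>)\<^sup>2) = (t - s)\<^sup>2"
      using indep_vars_lebesgue_integral[OF _ ind2 i2] False m(5)
      by (simp add: X power_mult_distrib power2_eq_square[of "t - s"])
    moreover have "X \<in> borel_measurable M" unfolding X using meas by measurable
    ultimately show ?thesis by (simp add: second_moment_le_def)
  qed
  then show "second_moment_le M X (2 * (t - s)\<^sup>2)" and "expectation X = 0" by auto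
qed

text \<open>
  A Borel function of an increment generates fewer events than the increment, so it inherits the
  independence from the past.
\<close>

lemma noise_of_increments:
  fixes \<phi> :: "nat \<Rightarrow> real ^ 'n \<Rightarrow> real"
  assumes \<sigma>0: "0 \<le> \<sigma> 0" and \<sigma>: "\<And>i. i < k \<Longrightarrow> \<sigma> i < \<sigma> (Suc i)"
    and \<phi>: "\<And>i. \<phi> i \<in> borel_measurable borel"
    and mom: "\<And>i. i < k \<Longrightarrow> second_moment_le M (\<lambda>\<omega>. \<phi> i (W (\<sigma> (Suc i)) \<omega> - W (\<sigma> i) \<omega>)) (v i)"
      "\<And>i. i < k \<Longrightarrow> expectation (\<lambda>\<omega>. \<phi> i (W (\<sigma> (Suc i)) \<omega> - W (\<sigma> i) \<omega>)) = 0"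
  shows "martingale_noise M (\<lambda>i. F (\<sigma> i)) (\<lambda>i \<omega>. \<phi> i (W (\<sigma> (Suc i)) \<omega> - W (\<sigma> i) \<omega>)) v k"
proof
  have pos: "0 \<le> \<sigma> i" if "i \<le> k" for i by (rule increasing_nonneg[OF \<sigma>0 \<sigma> that])
  show "subalgebra M (F (\<sigma> i))" if "i \<le> k" for i using F_subalgebra pos that by blast
  fix i assume i: "i < k"
  let ?D = "\<lambda>\<omega>. W (\<sigma> (Suc i)) \<omega> - W (\<sigma> i) \<omega>"
  show "sets (F (\<sigma> i)) \<subseteq> sets (F (\<sigma> (Suc i)))" using F_mono \<sigma>[OF i] by simp
  show "(\<lambda>\<omega>. \<phi> i (?D \<omega>)) \<in> borel_measurable (F (\<sigma> (Suc i)))"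
    by (rule measurable_compose[OF increment_measurable \<phi>]) (use \<sigma>[OF i] pos[of i] i in auto)
  have ind: "indep_set (sets (F (\<sigma> i))) {?D -` A \<inter> space M | A. A \<in> sets borel}"
    using bm \<sigma>[OF i] pos[of i] i by (simp add: brownian_motion_def)
  have sub: "{(\<lambda>\<omega>. \<phi> i (?D \<omega>)) -` A \<inter> space M | A. A \<in> sets borel} \<subseteq> {?D -` A \<inter> space M | A. A \<in> sets borel}"
  proof clarify
    fix A :: "real set" assume "A \<in> sets borel"
    then have "\<phi> i -` A \<in> sets borel" using measurable_sets[OF \<phi>, of A i] by simp
    moreover have "(\<lambda>\<omega>. \<phi> i (?D \<omega>)) -` A \<inter> space M = ?D -` (\<phi> i -` A) \<inter> space M" by auto
    ultimately show "\<exists>B. (\<lambda>\<omega>. \<phi> i (?D \<omega>)) -` A \<inter> space M = ?D -` B \<inter> space M \<and> B \<in> sets borel"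
      by blast
  qed
  show "indep_set (sets (F (\<sigma> i))) {(\<lambda>\<omega>. \<phi> i (?D \<omega>)) -` A \<inter> space M | A. A \<in> sets borel}"
    using ind unfolding indep_set_def
    by (rule indep_sets_mono_sets) (use sub in \<open>auto split: bool.split\<close>)
qed (use mom in auto)

lemma component_noise:
  assumes "0 \<le> \<sigma> 0" and "\<And>i. i < k \<Longrightarrow> \<sigma> i < \<sigma> (Suc i)"
  shows "martingale_noise M (\<lambda>i. F (\<sigma> i)) (\<lambda>i. dW j (\<sigma> i) (\<sigma> (Suc i)))
     (\<lambda>i. \<sigma> (Suc i) - \<sigma> i) k"
proof -
  have pos: "0 \<le> \<sigma> i" if "i \<le> k" for i by (rule increasing_nonneg[OF assms that])
  show ?thesis
    using noise_of_increments[of \<sigma> k "\<lambda>_ x. x $ j" "\<lambda>i. \<sigma> (Suc i) - \<sigma> i", OF assms]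
      increment_moments(1,2)[of "\<sigma> _" "\<sigma> (Suc _)" j] assms(2) pos
      borel_measurable_continuous_onI[of "\<lambda>x :: real ^ 'n. x $ j"]
    by (simp add: continuous_on_component)
qed

lemma product_noise:
  fixes j l :: 'n
  assumes "0 \<le> \<sigma> 0" and "\<And>i. i < k \<Longrightarrow> \<sigma> i < \<sigma> (Suc i)"
  shows "martingale_noise M (\<lambda>i. F (\<sigma> i))
     (\<lambda>i \<omega>. dW j (\<sigma> i) (\<sigma> (Suc i)) \<omega> * dW l (\<sigma> i) (\<sigma> (Suc i)) \<omega>
        - of_bool (j = l) * (\<sigma> (Suc i) - \<sigma> i))
     (\<lambda>i. 2 * (\<sigma> (Suc i) - \<sigma> i)\<^sup>2) k"
proof -
  have pos: "0 \<le> \<sigma> i" if "i \<le> k" for i by (rule increasing_nonneg[OF assms that])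
  have "(\<lambda>x :: real ^ 'n. x $ j * x $ l - c) \<in> borel_measurable borel" for c
    by (intro borel_measurable_continuous_onI continuous_intros)
  then show ?thesis
    using noise_of_increments[of \<sigma> k "\<lambda>i x. x $ j * x $ l - of_bool (j = l) * (\<sigma> (Suc i) - \<sigma> i)"
        "\<lambda>i. 2 * (\<sigma> (Suc i) - \<sigma> i)\<^sup>2", OF assms]
      increment_product_moments[of "\<sigma> _" "\<sigma> (Suc _)" j l] assms(2) pos
    by simp
qed

end

section \<open>Partitions\<close>

lemma time_partition_less:
  assumes "time_partition t k \<pi>" "i < j" "j \<le> k"
  shows "\<pi> i < \<pi> j"
  using assms(2,3)
proof (induction j)
  case (Suc j)
  then have "\<pi> j < \<pi> (Suc j)" using assms(1) by (auto simp: time_partition_def)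
  then show ?case using Suc by (cases "i = j") auto
qed simp

lemma time_partition_le:
  "time_partition t k \<pi> \<Longrightarrow> i \<le> j \<Longrightarrow> j \<le> k \<Longrightarrow> \<pi> i \<le> \<pi> j"
  using time_partition_less[of t k \<pi> i j] by (cases "i = j") auto

lemma time_partition_less_iff:
  "time_partition t k \<pi> \<Longrightarrow> i \<le> k \<Longrightarrow> j \<le> k \<Longrightarrow> \<pi> i < \<pi> j \<longleftrightarrow> i < j"
  using time_partition_less[of t k \<pi> i j] time_partition_le[of t k \<pi> j i] by (cases "i < j") auto

lemma time_partition_le_iff:
  "time_partition t k \<pi> \<Longrightarrow> i \<le> k \<Longrightarrow> j \<le> k \<Longrightarrow> \<pi> i \<le> \<pi> j \<longleftrightarrow> i \<le> j"
  using time_partition_less_iff[of t k \<pi> j i] by auto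

lemma time_partition_range:
  assumes "time_partition t k \<pi>" "i \<le> k"
  shows "\<pi> i \<in> {0..t}"
  using time_partition_le[OF assms(1), of 0 i] time_partition_le[OF assms(1), of i k] assms
  by (auto simp: time_partition_def)

lemma time_partition_below:
  assumes "time_partition t k \<pi>" "j \<le> k"
  shows "{i. i < k \<and> \<pi> i < \<pi> j} = {..<j}"
  using time_partition_less_iff[OF assms(1) _ assms(2)] assms(2) by auto

lemma time_partition_telescope:
  fixes f :: "real \<Rightarrow> real"
  assumes p: "time_partition t k \<pi>" and a: "a \<in> \<pi> ` {..k}" and b: "b \<in> \<pi> ` {..k}" and "a \<le> b"
  shows "(\<Sum>i\<in>{i. i < k \<and> a \<le> \<pi> i \<and> \<pi> i < b}. f (\<pi> (Suc i)) - f (\<pi> i)) = f b - f a"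
proof -
  obtain i j where ij: "a = \<pi> i" "i \<le> k" "b = \<pi> j" "j \<le> k" using a b by auto
  then have "i \<le> j" using \<open>a \<le> b\<close> time_partition_le_iff[OF p] by simp
  moreover have "{l. l < k \<and> a \<le> \<pi> l \<and> \<pi> l < b} = {i..<j}"
    using ij time_partition_le_iff[OF p, of i] time_partition_less_iff[OF p, of _ j] by auto
  ultimately show ?thesis
    using sum_Suc_diff'[of i j "\<lambda>l. f (\<pi> l)"] ij by simp
qed

lemma time_partition_of_finite_set:
  assumes "finite P" "P \<subseteq> {0..t}" "0 \<in> P" "t \<in> P"
  obtains k \<pi> where "time_partition t k \<pi>" "\<pi> ` {..k} = P"
proof -
  define xs where "xs = sorted_list_of_set P"
  have set: "set xs = P" and sorted: "sorted_wrt (<) xs" using assms by (simp_all add: xs_def)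
  then have ne: "xs \<noteq> []" using assms by auto
  define k where "k = length xs - 1"
  have k: "length xs = Suc k" using ne by (simp add: k_def)
  have mono: "xs ! i < xs ! j" if "i < j" "j \<le> k" for i j
    using sorted_wrt_nth_less[OF sorted, of i j] that k by simp
  have le: "xs ! i \<le> xs ! j" if "i \<le> j" "j \<le> k" for i j
    using mono[of i j] that by (cases "i = j") auto
  have img: "(!) xs ` {..k} = P"
    using set k by (auto simp: set_conv_nth less_Suc_eq_le)
  obtain i j where i: "i \<le> k" "xs ! i = 0" and j: "j \<le> k" "xs ! j = t"
    using assms(3,4) unfolding img[symmetric] by auto
  have in_P: "xs ! l \<in> {0..t}" if "l \<le> k" for l using that img assms(2) by blast
  have "xs ! 0 = 0" using le[of 0 i] i in_P[of 0] by auto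
  moreover have "xs ! k = t" using le[of j k] j in_P[of k] by auto
  ultimately have "time_partition t k ((!) xs)" using mono by (auto simp: time_partition_def)
  with img that show thesis by blast
qed

text \<open>
  Add a uniform grid to the given points: a larger gap would contain a grid point.
\<close>

lemma fine_time_partition:
  assumes t: "t > 0" and P: "finite P" "P \<subseteq> {0..t}"
  obtains k \<pi> where "time_partition t k \<pi>" "P \<subseteq> \<pi> ` {..k}"
    "\<And>i. i < k \<Longrightarrow> \<pi> (Suc i) - \<pi> i \<le> t / real (Suc n)"
proof -
  define g where "g i = t * real i / real (Suc n)" for i
  let ?Q = "P \<union> g ` {..Suc n}"
  have g_range: "g i \<in> {0..t}" if "i \<le> Suc n" for i
  proof -
    have "t * real i \<le> t * real (Suc n)" using t that by (intro mult_left_mono) auto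
    then show ?thesis using t by (simp add: g_def divide_le_eq)
  qed
  have "g 0 = 0" "g (Suc n) = t" by (simp_all add: g_def)
  then have "0 \<in> g ` {..Suc n}" "t \<in> g ` {..Suc n}" by (metis imageI atMost_iff le0, metis imageI atMost_iff order_refl)
  then obtain k \<pi> where p: "time_partition t k \<pi>" "\<pi> ` {..k} = ?Q"
    using time_partition_of_finite_set[of ?Q t] P g_range by blast
  have "\<pi> (Suc i) - \<pi> i \<le> t / real (Suc n)" if i: "i < k" for i
  proof (rule ccontr)
    assume "\<not> ?thesis"
    then have gap: "\<pi> i + t / real (Suc n) < \<pi> (Suc i)" by simp
    have r: "0 \<le> \<pi> i" "\<pi> (Suc i) \<le> t"
      using time_partition_range[OF p(1), of i] time_partition_range[OF p(1), of "Suc i"] i by auto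
    define x where "x = \<pi> i * real (Suc n) / t"
    define l where "l = nat \<lfloor>x\<rfloor> + 1"
    have x: "0 \<le> x" using r t by (simp add: x_def)
    have l: "x < real l" "real l \<le> x + 1" using x unfolding l_def by linarith+
    have \<pi>i: "\<pi> i = t * x / real (Suc n)" using t by (simp add: x_def)
    have g1: "\<pi> i < g l"
      unfolding \<pi>i g_def using l(1) t by (intro divide_strict_right_mono mult_strict_left_mono) auto
    have "g l \<le> t * (x + 1) / real (Suc n)"
      unfolding g_def using l(2) t by (intro divide_right_mono mult_left_mono) auto
    also have "\<dots> = \<pi> i + t / real (Suc n)" unfolding \<pi>i by (simp add: distrib_left add_divide_distrib)
    finally have g2: "g l < \<pi> (Suc i)" using gap by simp
    have "t * real l < t * real (Suc n)"
    proof -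
      have "t * real l / real (Suc n) < t" using g2 r(2) by (simp add: g_def)
      then show ?thesis by (subst (asm) pos_divide_less_eq) auto
    qed
    then have "l \<le> Suc n" using t by simp
    then obtain j where j: "j \<le> k" "\<pi> j = g l" using p(2) by (metis UnCI atMost_iff imageE image_eqI)
    have "i < j" "j < Suc i"
      using g1 g2 i time_partition_less_iff[OF p(1), of i j] j
        time_partition_less_iff[OF p(1), of j "Suc i"] by auto
    then show False by simp
  qed
  with p that show thesis by blast
qed

text \<open>
  Left sums of an increasing function are bounded by its integral.  This is where an integration gains
  the factor \<open>1 / \<alpha>\<close>.
\<close>

lemma exp_left_sum_le:
  fixes \<sigma> :: "nat \<Rightarrow> real"
  assumes \<alpha>: "\<alpha> > 0" and c: "c \<ge> 0"
  shows "(\<Sum>i<l. c * exp (\<alpha> * \<sigma> i) * (\<sigma> (Suc i) - \<sigma> i)) \<le> c * exp (\<alpha> * \<sigma> l) / \<alpha>"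
proof -
  have one: "c * exp (\<alpha> * x) * (y - x) \<le> c / \<alpha> * (exp (\<alpha> * y) - exp (\<alpha> * x))" for x y
  proof -
    have "exp (\<alpha> * x) * (1 + \<alpha> * (y - x)) \<le> exp (\<alpha> * x) * exp (\<alpha> * (y - x))"
      using exp_ge_add_one_self[of "\<alpha> * (y - x)"] by (intro mult_left_mono) auto
    also have "\<dots> = exp (\<alpha> * y)" by (simp add: exp_add[symmetric] algebra_simps)
    finally have "\<alpha> * (exp (\<alpha> * x) * (y - x)) \<le> exp (\<alpha> * y) - exp (\<alpha> * x)"
      by (simp add: algebra_simps)
    then have "c / \<alpha> * (\<alpha> * (exp (\<alpha> * x) * (y - x))) \<le> c / \<alpha> * (exp (\<alpha> * y) - exp (\<alpha> * x))"
      using \<alpha> c by (intro mult_left_mono) auto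
    then show ?thesis using \<alpha> by (simp add: mult.assoc)
  qed
  have "(\<Sum>i<l. c * exp (\<alpha> * \<sigma> i) * (\<sigma> (Suc i) - \<sigma> i)) \<le>
      (\<Sum>i<l. c / \<alpha> * (exp (\<alpha> * \<sigma> (Suc i)) - exp (\<alpha> * \<sigma> i)))"
    by (intro sum_mono one)
  also have "\<dots> = c / \<alpha> * (exp (\<alpha> * \<sigma> l) - exp (\<alpha> * \<sigma> 0))"
    unfolding sum_distrib_left[symmetric] sum_lessThan_telescope[of "\<lambda>i. exp (\<alpha> * \<sigma> i)"] ..
  also have "\<dots> \<le> c / \<alpha> * exp (\<alpha> * \<sigma> l)"
    using \<alpha> c by (intro mult_left_mono) auto
  finally show ?thesis by simp
qed

text \<open>
  The value that a simple process takes immediately after time \<open>s\<close>; unlike the simple process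
  itself it can be read off at the points of any finer partition.
\<close>

definition simple_value :: "nat \<Rightarrow> (nat \<Rightarrow> real) \<Rightarrow> (nat \<Rightarrow> 'a \<Rightarrow> real) \<Rightarrow> real \<Rightarrow> 'a \<Rightarrow> real" where
  "simple_value k \<pi> \<xi> s \<omega> = (\<Sum>i<k. \<xi> i \<omega> * indicator {\<pi> i..<\<pi> (Suc i)} s)"

lemma simple_process_refine:
  assumes p: "time_partition t m \<sigma>" and sub: "\<pi> ` {..k} \<subseteq> \<sigma> ` {..m}"
    and j: "j < m" and s: "s \<in> {\<sigma> j<..\<sigma> (Suc j)}"
  shows "simple_process k \<pi> \<xi> s \<omega> = simple_value k \<pi> \<xi> (\<sigma> j) \<omega>"
proof -
  have eq: "\<pi> i < s \<longleftrightarrow> \<pi> i \<le> \<sigma> j" if i: "i \<le> k" for i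
  proof -
    obtain l where l: "l \<le> m" "\<pi> i = \<sigma> l" using sub i by blast
    have "\<sigma> l < s \<longleftrightarrow> l \<le> j"
    proof
      assume "\<sigma> l < s"
      then have "\<sigma> l < \<sigma> (Suc j)" using s by auto
      then show "l \<le> j" using time_partition_less_iff[OF p l(1), of "Suc j"] j by auto
    next
      assume "l \<le> j"
      then show "\<sigma> l < s" using time_partition_le[OF p, of l j] j s by auto
    qed
    then show ?thesis using l time_partition_le_iff[OF p l(1), of j] j by auto
  qed
  have "s \<in> {\<pi> i<..\<pi> (Suc i)} \<longleftrightarrow> \<sigma> j \<in> {\<pi> i..<\<pi> (Suc i)}" if "i < k" for i
    using eq[of i] eq[of "Suc i"] that by (simp add: linorder_not_less[symmetric])
  then show ?thesis
    unfolding simple_process_def simple_value_def by (intro sum.cong refl) (auto simp: indicator_def)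
qed

lemma simple_integral_refine:
  assumes p: "time_partition t m \<sigma>" and q: "time_partition t k \<pi>" and sub: "\<pi> ` {..k} \<subseteq> \<sigma> ` {..m}"
    and r: "r \<in> \<sigma> ` {..m}"
  shows "simple_integral k \<pi> \<xi> B r \<omega> =
    (\<Sum>j\<in>{j. j < m \<and> \<sigma> j < r}. simple_value k \<pi> \<xi> (\<sigma> j) \<omega> * (B (\<sigma> (Suc j)) \<omega> - B (\<sigma> j) \<omega>))"
    (is "_ = ?R")
proof -
  let ?J = "{j. j < m \<and> \<sigma> j < r}" and ?d = "\<lambda>j. B (\<sigma> (Suc j)) \<omega> - B (\<sigma> j) \<omega>"
  have fin: "finite ?J" by simp
  have "?R = (\<Sum>j\<in>?J. \<Sum>i<k. \<xi> i \<omega> * (indicator {\<pi> i..<\<pi> (Suc i)} (\<sigma> j) * ?d j))"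
    unfolding simple_value_def sum_distrib_right mult.assoc ..
  also have "\<dots> = (\<Sum>i<k. \<Sum>j\<in>?J. \<xi> i \<omega> * (indicator {\<pi> i..<\<pi> (Suc i)} (\<sigma> j) * ?d j))"
    by (rule sum.swap)
  also have "\<dots> = (\<Sum>i<k. \<xi> i \<omega> * (\<Sum>j\<in>?J. indicator {\<pi> i..<\<pi> (Suc i)} (\<sigma> j) * ?d j))"
    unfolding sum_distrib_left ..
  also have "\<dots> = (\<Sum>i<k. \<xi> i \<omega> * (B (min r (\<pi> (Suc i))) \<omega> - B (min r (\<pi> i)) \<omega>))"
  proof (intro sum.cong refl arg_cong[where f = "\<lambda>x. _ * x"])
    fix i assume i: "i \<in> {..<k}"
    have lt: "\<pi> i < \<pi> (Suc i)" using q i by (auto simp: time_partition_def)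
    have mem: "min r (\<pi> l) \<in> \<sigma> ` {..m}" if "l \<le> k" for l
      using r sub that by (auto simp: min_def)
    have "(\<Sum>j\<in>?J. indicator {\<pi> i..<\<pi> (Suc i)} (\<sigma> j) * ?d j) =
        (\<Sum>j\<in>{j\<in>?J. \<sigma> j \<in> {\<pi> i..<\<pi> (Suc i)}}. ?d j)"
      unfolding sum.inter_filter[OF fin] by (intro sum.cong refl) (simp add: indicator_def)
    also have "{j\<in>?J. \<sigma> j \<in> {\<pi> i..<\<pi> (Suc i)}} = {j. j < m \<and> min r (\<pi> i) \<le> \<sigma> j \<and> \<sigma> j < min r (\<pi> (Suc i))}"
      by (auto simp: min_le_iff_disj)
    also have "(\<Sum>j\<in>\<dots>. ?d j) = B (min r (\<pi> (Suc i))) \<omega> - B (min r (\<pi> i)) \<omega>"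
      by (rule time_partition_telescope[OF p mem mem, of _ _ "\<lambda>s. B s \<omega>"]) (use i lt in auto)
    finally show "(\<Sum>j\<in>?J. indicator {\<pi> i..<\<pi> (Suc i)} (\<sigma> j) * ?d j) =
        B (min r (\<pi> (Suc i))) \<omega> - B (min r (\<pi> i)) \<omega>" .
  qed
  finally show ?thesis by (simp add: simple_integral_def)
qed

text \<open>
  Replacing the integrand \<open>f\<close> by its values at the left end points changes the squared distance to
  a step function, up to a factor \<open>2\<close>, only by the oscillation of \<open>f\<close>.
\<close>

lemma step_distance_le:
  fixes f :: "real \<Rightarrow> real"
  assumes p: "time_partition t m \<sigma>" and cont: "continuous_on {0..t} f"
    and H: "\<And>j s. j < m \<Longrightarrow> s \<in> {\<sigma> j<..\<sigma> (Suc j)} \<Longrightarrow> H s = h j"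
    and osc: "\<And>j s. j < m \<Longrightarrow> s \<in> {\<sigma> j<..\<sigma> (Suc j)} \<Longrightarrow> (f s - f (\<sigma> j))\<^sup>2 \<le> \<epsilon>"
    and \<epsilon>: "\<epsilon> \<ge> 0"
  shows "ennreal (\<Sum>j<m. (h j - f (\<sigma> j))\<^sup>2 * (\<sigma> (Suc j) - \<sigma> j)) \<le>
    2 * (\<integral>\<^sup>+ s\<in>{0..t}. ennreal ((H s - f s)\<^sup>2) \<partial>lborel) + ennreal (2 * t * \<epsilon>)"
proof -
  let ?I = "\<lambda>j. {\<sigma> j<..\<sigma> (Suc j)}"
  have \<sigma>: "\<sigma> j < \<sigma> (Suc j)" if "j < m" for j using p that by (auto simp: time_partition_def)
  have I_sub: "?I j \<subseteq> {0..t}" if "j < m" for j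
    using time_partition_range[OF p, of j] time_partition_range[OF p, of "Suc j"] that by auto
  have meas: "(\<lambda>s. ennreal ((h j - f s)\<^sup>2) * indicator (?I j) s) \<in> borel_measurable lborel" if "j < m" for j
  proof -
    have "continuous_on (?I j) (\<lambda>s. (h j - f s)\<^sup>2)"
      by (intro continuous_intros continuous_on_subset[OF cont I_sub] that)
    then have "(\<lambda>s. indicator (?I j) s *\<^sub>R (h j - f s)\<^sup>2) \<in> borel_measurable borel"
      by (intro borel_measurable_continuous_on_indicator) auto
    then have "(\<lambda>s. ennreal (indicator (?I j) s *\<^sub>R (h j - f s)\<^sup>2)) \<in> borel_measurable borel"
      by measurable
    also have "(\<lambda>s. ennreal (indicator (?I j) s *\<^sub>R (h j - f s)\<^sup>2)) = (\<lambda>s. ennreal ((h j - f s)\<^sup>2) * indicator (?I j) s)"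
      by (auto simp: indicator_def)
    finally show ?thesis by simp
  qed
  have one: "ennreal ((h j - f (\<sigma> j))\<^sup>2 * (\<sigma> (Suc j) - \<sigma> j)) \<le>
      2 * (\<integral>\<^sup>+ s. ennreal ((h j - f s)\<^sup>2) * indicator (?I j) s \<partial>lborel) + ennreal (2 * \<epsilon> * (\<sigma> (Suc j) - \<sigma> j))"
    if j: "j < m" for j
  proof -
    have "ennreal ((h j - f (\<sigma> j))\<^sup>2 * (\<sigma> (Suc j) - \<sigma> j)) =
        (\<integral>\<^sup>+ s. ennreal ((h j - f (\<sigma> j))\<^sup>2) * indicator (?I j) s \<partial>lborel)"
      using \<sigma>[OF j] by (subst nn_integral_cmult_indicator) (auto simp: ennreal_mult)
    also have "\<dots> \<le> (\<integral>\<^sup>+ s. 2 * (ennreal ((h j - f s)\<^sup>2) * indicator (?I j) s) + ennreal (2 * \<epsilon>) * indicator (?I j) s \<partial>lborel)"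
    proof (rule nn_integral_mono)
      fix s
      show "ennreal ((h j - f (\<sigma> j))\<^sup>2) * indicator (?I j) s \<le>
        2 * (ennreal ((h j - f s)\<^sup>2) * indicator (?I j) s) + ennreal (2 * \<epsilon>) * indicator (?I j) s"
      proof (cases "s \<in> ?I j")
        case True
        have "(h j - f (\<sigma> j))\<^sup>2 = ((h j - f s) + (f s - f (\<sigma> j)))\<^sup>2" by simp
        also have "\<dots> \<le> 2 * (h j - f s)\<^sup>2 + 2 * (f s - f (\<sigma> j))\<^sup>2"
          using sum_squares_bound[of "h j - f s" "f s - f (\<sigma> j)"] by (simp only: power2_sum)
        also have "\<dots> \<le> 2 * (h j - f s)\<^sup>2 + 2 * \<epsilon>" using osc[OF j True] by simp
        finally have "ennreal ((h j - f (\<sigma> j))\<^sup>2) \<le> ennreal (2 * (h j - f s)\<^sup>2 + 2 * \<epsilon>)"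
          by (rule ennreal_leI)
        also have "\<dots> = 2 * ennreal ((h j - f s)\<^sup>2) + ennreal (2 * \<epsilon>)"
          using \<epsilon> by (subst ennreal_plus) (auto simp: ennreal_mult)
        finally show ?thesis using True by simp
      qed simp
    qed
    also have "\<dots> = 2 * (\<integral>\<^sup>+ s. ennreal ((h j - f s)\<^sup>2) * indicator (?I j) s \<partial>lborel) + ennreal (2 * \<epsilon> * (\<sigma> (Suc j) - \<sigma> j))"
      using meas[OF j] \<sigma>[OF j] \<epsilon>
      by (subst nn_integral_add) (auto simp: nn_integral_cmult nn_integral_cmult_indicator ennreal_mult)
    finally show ?thesis .
  qed
  have point: "(\<Sum>j<m. ennreal ((h j - f s)\<^sup>2) * indicator (?I j) s) \<le> ennreal ((H s - f s)\<^sup>2) * indicator {0..t} s" for s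
  proof (cases "\<exists>j<m. s \<in> ?I j")
    case True
    then obtain j where j: "j < m" "s \<in> ?I j" by blast
    have uniq: "l = j" if "l < m" "s \<in> ?I l" for l
    proof (rule ccontr)
      assume "l \<noteq> j"
      then consider "Suc l \<le> j" | "Suc j \<le> l" by linarith
      then show False
      proof cases
        case 1
        then have "\<sigma> (Suc l) \<le> \<sigma> j" using time_partition_le[OF p] j by simp
        then show False using that j by auto
      next
        case 2
        then have "\<sigma> (Suc j) \<le> \<sigma> l" using time_partition_le[OF p] that by simp
        then show False using that j by auto
      qed
    qed
    have "(\<Sum>l<m. ennreal ((h l - f s)\<^sup>2) * indicator (?I l) s) = (\<Sum>l<m. if l = j then ennreal ((h j - f s)\<^sup>2) else 0)"
    proof (intro sum.cong refl)
      fix l assume "l \<in> {..<m}"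
      then show "ennreal ((h l - f s)\<^sup>2) * indicator (?I l) s = (if l = j then ennreal ((h j - f s)\<^sup>2) else 0)"
        using uniq[of l] j(2) by (cases "l = j") (auto simp: indicator_def)
    qed
    also have "\<dots> = ennreal ((H s - f s)\<^sup>2) * indicator {0..t} s"
      using j H[OF j] I_sub[OF j(1)] by auto
    finally show ?thesis by simp
  next
    case False
    then have "(\<Sum>j<m. ennreal ((h j - f s)\<^sup>2) * indicator (?I j) s) = 0"
      by (intro sum.neutral) auto
    then show ?thesis by simp
  qed
  have "ennreal (\<Sum>j<m. (h j - f (\<sigma> j))\<^sup>2 * (\<sigma> (Suc j) - \<sigma> j)) =
      (\<Sum>j<m. ennreal ((h j - f (\<sigma> j))\<^sup>2 * (\<sigma> (Suc j) - \<sigma> j)))"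
    using less_imp_le[OF \<sigma>] by (intro sum_ennreal[symmetric] mult_nonneg_nonneg) auto
  also have "\<dots> \<le> (\<Sum>j<m. 2 * (\<integral>\<^sup>+ s. ennreal ((h j - f s)\<^sup>2) * indicator (?I j) s \<partial>lborel) + ennreal (2 * \<epsilon> * (\<sigma> (Suc j) - \<sigma> j)))"
    by (intro sum_mono one) auto
  also have "\<dots> = 2 * (\<Sum>j<m. \<integral>\<^sup>+ s. ennreal ((h j - f s)\<^sup>2) * indicator (?I j) s \<partial>lborel)
      + (\<Sum>j<m. ennreal (2 * \<epsilon> * (\<sigma> (Suc j) - \<sigma> j)))"
    by (simp add: sum.distrib sum_distrib_left)
  also have "(\<Sum>j<m. \<integral>\<^sup>+ s. ennreal ((h j - f s)\<^sup>2) * indicator (?I j) s \<partial>lborel) =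
      (\<integral>\<^sup>+ s. (\<Sum>j<m. ennreal ((h j - f s)\<^sup>2) * indicator (?I j) s) \<partial>lborel)"
    using meas by (intro nn_integral_sum[symmetric]) auto
  also have "\<dots> \<le> (\<integral>\<^sup>+ s\<in>{0..t}. ennreal ((H s - f s)\<^sup>2) \<partial>lborel)"
    by (intro nn_integral_mono point)
  also have "(\<Sum>j<m. ennreal (2 * \<epsilon> * (\<sigma> (Suc j) - \<sigma> j))) = ennreal (2 * t * \<epsilon>)"
  proof -
    have "(\<Sum>j<m. ennreal (2 * \<epsilon> * (\<sigma> (Suc j) - \<sigma> j))) = ennreal (\<Sum>j<m. 2 * \<epsilon> * (\<sigma> (Suc j) - \<sigma> j))"
      using less_imp_le[OF \<sigma>] \<epsilon> by (intro sum_ennreal mult_nonneg_nonneg) auto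
    also have "(\<Sum>j<m. 2 * \<epsilon> * (\<sigma> (Suc j) - \<sigma> j)) = 2 * \<epsilon> * t"
      using p by (simp add: sum_distrib_left[symmetric] sum_lessThan_telescope time_partition_def)
    finally show ?thesis by (simp add: mult_ac)
  qed
  finally show ?thesis by (auto simp: mult_left_mono add_mono)
qed

section \<open>Ito integrals of continuous processes as limits of left sums\<close>

lemma sq_integrable_second_moment:
  "X \<in> borel_measurable M \<Longrightarrow> integrable M (\<lambda>\<omega>. (X \<omega>)\<^sup>2) \<Longrightarrow>
    second_moment_le M X (\<integral>\<omega>. (X \<omega>)\<^sup>2 \<partial>M)"
  by (simp add: second_moment_le_def)

context brownian
begin

lemma adapted_measurable:
  "continuous_adapted M F T X \<Longrightarrow> s \<in> {0..T} \<Longrightarrow> X s \<in> borel_measurable (F s)"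
  by (simp add: continuous_adapted_def)

lemma adapted_measurable_M:
  "continuous_adapted M F T X \<Longrightarrow> s \<in> {0..T} \<Longrightarrow> X s \<in> borel_measurable M"
  using F_measurable_M[of "X s" s borel] by (simp add: continuous_adapted_def)

lemma W_component_measurable_M: "0 \<le> s \<Longrightarrow> (\<lambda>\<omega>. W s \<omega> $ j) \<in> borel_measurable M"
  using F_measurable_M[OF W_component_measurable] by blast

text \<open>
  The discrete stochastic integral of the left end point values of \<open>D\<close>, up to time \<open>r\<close>; \<open>r\<close> will be a
  point of the partition.
\<close>

definition left_sum ::
  "nat \<Rightarrow> (nat \<Rightarrow> real) \<Rightarrow> (real \<Rightarrow> 'a \<Rightarrow> real) \<Rightarrow> 'n \<Rightarrow> real \<Rightarrow> 'a \<Rightarrow> real" where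
  "left_sum m \<sigma> D j r \<omega> = (\<Sum>i\<in>{i. i < m \<and> \<sigma> i < r}. D (\<sigma> i) \<omega> * dW j (\<sigma> i) (\<sigma> (Suc i)) \<omega>)"

lemma partition_noise:
  assumes "time_partition T m \<sigma>" "l \<le> m"
  shows "martingale_noise M (\<lambda>i. F (\<sigma> i)) (\<lambda>i. dW j (\<sigma> i) (\<sigma> (Suc i))) (\<lambda>i. \<sigma> (Suc i) - \<sigma> i) l"
  by (rule component_noise) (use assms in \<open>auto simp: time_partition_def\<close>)

lemma left_sum_at:
  assumes "time_partition T m \<sigma>" "l \<le> m"
  shows "left_sum m \<sigma> D j (\<sigma> l) =
    martingale_noise.transform (\<lambda>i. dW j (\<sigma> i) (\<sigma> (Suc i))) (\<lambda>i. D (\<sigma> i)) l"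
  using assms
  by (simp add: fun_eq_iff left_sum_def time_partition_below
    martingale_noise.transform_def[OF partition_noise[OF assms]])

lemma left_sum_measurable:
  assumes p: "time_partition T m \<sigma>" and r: "r \<in> \<sigma> ` {..m}"
    and D: "\<And>s. 0 \<le> s \<Longrightarrow> s < r \<Longrightarrow> D s \<in> borel_measurable (F s)"
  shows "left_sum m \<sigma> D j r \<in> borel_measurable M"
proof -
  obtain l where l: "l \<le> m" "r = \<sigma> l" using r by auto
  note noise = partition_noise[OF p l(1), of j]
  have "D (\<sigma> i) \<in> borel_measurable (F (\<sigma> i))" if "i < l" for i
    using D time_partition_range[OF p, of i] time_partition_less[OF p that l(1)] l that by simp
  then have "martingale_noise.transform (\<lambda>i. dW j (\<sigma> i) (\<sigma> (Suc i))) (\<lambda>i. D (\<sigma> i)) l \<in> borel_measurable (F (\<sigma> l))"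
    by (rule martingale_noise.transform_measurable[OF noise]) simp_all
  from martingale_noise.G_measurable_M[OF noise this] show ?thesis
    using left_sum_at[OF p l(1)] l(2) by simp
qed

lemma left_sum_second_moment:
  assumes p: "time_partition T m \<sigma>" and r: "r \<in> \<sigma> ` {..m}"
    and D: "\<And>s. 0 \<le> s \<Longrightarrow> s < r \<Longrightarrow> D s \<in> borel_measurable (F s)"
    and c: "\<And>s. 0 \<le> s \<Longrightarrow> s < r \<Longrightarrow> second_moment_le M (D s) (c s)"
  shows "second_moment_le M (left_sum m \<sigma> D j r) (\<Sum>i | i < m \<and> \<sigma> i < r. c (\<sigma> i) * (\<sigma> (Suc i) - \<sigma> i))"
proof -
  obtain l where l: "l \<le> m" "r = \<sigma> l" using r by auto
  have s: "0 \<le> \<sigma> i" "\<sigma> i < r" if "i < l" for i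
    using time_partition_range[OF p, of i] time_partition_less[OF p that l(1)] l that by simp_all
  show ?thesis
    using martingale_noise.transform_second_moment[OF partition_noise[OF p l(1), of j],
        where \<eta> = "\<lambda>i. D (\<sigma> i)" and c = "\<lambda>i. c (\<sigma> i)" and k = l, OF D[OF s] c[OF s]]
    by (simp add: left_sum_at[OF p l(1)] time_partition_below[OF p l(1)] l(2))
qed

lemma left_sum_maximal_inequality:
  assumes p: "time_partition T m \<sigma>" and a: "a > 0"
    and D: "\<And>s. 0 \<le> s \<Longrightarrow> s < T \<Longrightarrow> D s \<in> borel_measurable (F s)"
    and c: "\<And>s. 0 \<le> s \<Longrightarrow> s < T \<Longrightarrow> second_moment_le M (D s) (c s)"
  shows "prob {\<omega>\<in>space M. \<exists>r\<in>\<sigma> ` {..m}. a \<le> \<bar>left_sum m \<sigma> D j r \<omega>\<bar>} \<le>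
    (\<Sum>i<m. c (\<sigma> i) * (\<sigma> (Suc i) - \<sigma> i)) / a\<^sup>2"
proof -
  have s: "0 \<le> \<sigma> i" "\<sigma> i < T" if "i < m" for i
    using time_partition_range[OF p, of i] time_partition_less[OF p that] p that
    by (simp_all add: time_partition_def)
  have "(\<exists>r\<in>\<sigma> ` {..m}. a \<le> \<bar>left_sum m \<sigma> D j r \<omega>\<bar>) \<longleftrightarrow>
      (\<exists>l\<le>m. a \<le> \<bar>martingale_noise.transform (\<lambda>i. dW j (\<sigma> i) (\<sigma> (Suc i))) (\<lambda>i. D (\<sigma> i)) l \<omega>\<bar>)" for \<omega>
    using left_sum_at[OF p, of _ D j] by auto
  then show ?thesis
    using martingale_noise.transform_maximal_inequality[OF partition_noise[OF p order_refl, of j],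
        where \<eta> = "\<lambda>i. D (\<sigma> i)" and c = "\<lambda>i. c (\<sigma> i)", OF D[OF s] c[OF s] a] by simp
qed

lemma left_sum_domination_inequality:
  assumes p: "time_partition T m \<sigma>" and r: "r \<in> \<sigma> ` {..m}" and a: "a > 0" and \<delta>: "\<delta> \<ge> 0"
    and D: "\<And>s. 0 \<le> s \<Longrightarrow> s < r \<Longrightarrow> D s \<in> borel_measurable (F s)"
    and D2: "\<And>s. 0 \<le> s \<Longrightarrow> s < r \<Longrightarrow> integrable M (\<lambda>\<omega>. (D s \<omega>)\<^sup>2)"
  shows "prob {\<omega>\<in>space M. a \<le> \<bar>left_sum m \<sigma> D j r \<omega>\<bar>} \<le>
    prob {\<omega>\<in>space M. \<delta> < (\<Sum>i | i < m \<and> \<sigma> i < r. (D (\<sigma> i) \<omega>)\<^sup>2 * (\<sigma> (Suc i) - \<sigma> i))} + \<delta> / a\<^sup>2"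
proof -
  obtain l where l: "l \<le> m" "r = \<sigma> l" using r by auto
  have s: "0 \<le> \<sigma> i" "\<sigma> i < r" if "i < l" for i
    using time_partition_range[OF p, of i] time_partition_less[OF p that l(1)] l that by simp_all
  show ?thesis
    using martingale_noise.transform_domination_inequality[OF partition_noise[OF p l(1), of j],
        where \<eta> = "\<lambda>i. D (\<sigma> i)", OF D[OF s] D2[OF s] a \<delta>]
    by (simp add: left_sum_at[OF p l(1)] time_partition_below[OF p l(1)] l(2))
qed

lemma simple_value_measurable:
  assumes "simple_integrand M F T k \<pi> \<xi>" "0 \<le> s"
  shows "simple_value k \<pi> \<xi> s \<in> borel_measurable (F s)"
proof -
  have "(\<lambda>\<omega>. \<xi> i \<omega> * indicator {\<pi> i..<\<pi> (Suc i)} s) \<in> borel_measurable (F s)" if i: "i < k" for i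
  proof (cases "s \<in> {\<pi> i..<\<pi> (Suc i)}")
    case True
    have p: "time_partition T k \<pi>" and \<xi>: "\<xi> i \<in> borel_measurable (F (\<pi> i))"
      using assms(1) i unfolding simple_integrand_def by blast+
    have "0 \<le> \<pi> i" using time_partition_range[OF p, of i] i by simp
    then have "\<xi> i \<in> borel_measurable (F s)"
      using True by (intro F_measurable_mono[OF \<xi>]) simp_all
    then show ?thesis using True by simp
  qed simp
  then show ?thesis unfolding simple_value_def[abs_def] by (intro borel_measurable_sum) auto
qed

lemma simple_value_square_integrable:
  assumes \<xi>: "simple_integrand M F T k \<pi> \<xi>" and s: "0 \<le> s"
  shows "integrable M (\<lambda>\<omega>. (simple_value k \<pi> \<xi> s \<omega>)\<^sup>2)"
proof -
  obtain c where c: "\<And>i \<omega>. i < k \<Longrightarrow> \<omega> \<in> space M \<Longrightarrow> \<bar>\<xi> i \<omega>\<bar> \<le> c i"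
    using \<xi> unfolding simple_integrand_def by metis
  have b: "\<bar>simple_value k \<pi> \<xi> s \<omega>\<bar> \<le> (\<Sum>i<k. c i)" if "\<omega> \<in> space M" for \<omega>
  proof -
    have "\<bar>simple_value k \<pi> \<xi> s \<omega>\<bar> \<le> (\<Sum>i<k. \<bar>\<xi> i \<omega> * indicator {\<pi> i..<\<pi> (Suc i)} s\<bar>)"
      unfolding simple_value_def by (rule sum_abs)
    also have "\<dots> \<le> (\<Sum>i<k. c i)"
    proof (rule sum_mono)
      fix i assume "i \<in> {..<k}"
      then have "\<bar>\<xi> i \<omega>\<bar> \<le> c i" using c that by simp
      then show "\<bar>\<xi> i \<omega> * indicator {\<pi> i..<\<pi> (Suc i)} s\<bar> \<le> c i"
        by (auto simp: indicator_def)
    qed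
    finally show ?thesis .
  qed
  have m[measurable]: "simple_value k \<pi> \<xi> s \<in> borel_measurable M"
    using F_measurable_M[OF simple_value_measurable[OF assms] s] .
  show ?thesis
  proof (rule integrable_const_bound[where B = "(\<Sum>i<k. c i)\<^sup>2"])
    have "(simple_value k \<pi> \<xi> s \<omega>)\<^sup>2 \<le> (\<Sum>i<k. c i)\<^sup>2" if "\<omega> \<in> space M" for \<omega>
      using power_mono[OF b[OF that], of 2] by simp
    then show "AE \<omega> in M. norm ((simple_value k \<pi> \<xi> s \<omega>)\<^sup>2) \<le> (\<Sum>i<k. c i)\<^sup>2" by simp
  qed measurable
qed

text \<open>
  The variance accumulated by the difference between the approximating simple processes and the left
  end point values of \<open>Y\<close>, along common refinements with vanishing mesh.  The \<open>L\<^sup>2\<close> distance of the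
  simple processes from \<open>Y\<close> tends to zero in probability by assumption, and the excess \<open>Z\<close> of the
  accumulated variance over twice this distance tends to zero almost surely, by uniform continuity of
  the paths of \<open>Y\<close>.
\<close>

lemma step_distance_in_prob:
  assumes Y: "continuous_adapted M F T Y"
    and simple: "\<And>n. simple_integrand M F T (k n) (\<pi> n) (\<xi> n)"
    and X: "null_in_prob M
      (\<lambda>n \<omega>. \<integral>\<^sup>+ t\<in>{0..T}. ennreal ((simple_process (k n) (\<pi> n) (\<xi> n) t \<omega> - Y t \<omega>)\<^sup>2) \<partial>lborel)"
    and p: "\<And>n. time_partition T (m n) (\<sigma> n)" and sub: "\<And>n. \<pi> n ` {..k n} \<subseteq> \<sigma> n ` {..m n}"
    and mesh: "\<And>n i. i < m n \<Longrightarrow> \<sigma> n (Suc i) - \<sigma> n i \<le> T / real (Suc n)"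
    and \<delta>: "\<delta> > 0"
  defines "Q \<equiv> \<lambda>n \<omega>. \<Sum>i<m n. (simple_value (k n) (\<pi> n) (\<xi> n) (\<sigma> n i) \<omega> - Y (\<sigma> n i) \<omega>)\<^sup>2 *
    (\<sigma> n (Suc i) - \<sigma> n i)"
  shows "Q n \<in> borel_measurable M" and "(\<lambda>n. prob {\<omega>\<in>space M. \<delta> < Q n \<omega>}) \<longlonglongrightarrow> 0"
proof -
  have range: "\<sigma> n i \<in> {0..T}" if "i \<le> m n" for n i using time_partition_range[OF p that] .
  show QM: "Q n \<in> borel_measurable M" for n
    unfolding Q_def
  proof (intro borel_measurable_sum borel_measurable_times borel_measurable_power borel_measurable_diff)
    fix i assume "i \<in> {..<m n}"
    then have r: "\<sigma> n i \<in> {0..T}" "0 \<le> \<sigma> n i" using range[of i n] by auto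
    show "simple_value (k n) (\<pi> n) (\<xi> n) (\<sigma> n i) \<in> borel_measurable M"
      by (rule F_measurable_M[OF simple_value_measurable[OF simple r(2)] r(2)])
    show "Y (\<sigma> n i) \<in> borel_measurable M" by (rule adapted_measurable_M[OF Y r(1)])
  qed auto
  note QM[measurable]
  define x1 where "x1 n \<omega> =
    (\<integral>\<^sup>+ t\<in>{0..T}. ennreal ((simple_process (k n) (\<pi> n) (\<xi> n) t \<omega> - Y t \<omega>)\<^sup>2) \<partial>lborel)" for n \<omega>
  have x1M[measurable]: "x1 n \<in> borel_measurable M" for n
    using X by (simp add: null_in_prob_def x1_def[abs_def])
  define Z where "Z n \<omega> = (if x1 n \<omega> = \<infinity> then 0 else max 0 (Q n \<omega> - 2 * enn2real (x1 n \<omega>)))" for n \<omega>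
  have ZM[measurable]: "Z n \<in> borel_measurable M" for n
    unfolding Z_def[abs_def] by measurable
  have Z0: "AE \<omega> in M. (\<lambda>n. Z n \<omega>) \<longlonglongrightarrow> 0"
  proof -
    have "AE \<omega> in M. continuous_on {0..T} (\<lambda>t. Y t \<omega>)" using Y by (simp add: continuous_adapted_def)
    then show ?thesis
    proof eventually_elim
      case (elim \<omega>)
      have uc: "uniformly_continuous_on {0..T} (\<lambda>t. Y t \<omega>)"
        using elim by (intro compact_uniformly_continuous) auto
      show ?case
        unfolding tendsto_iff
      proof (intro allI impI)
        fix e :: real assume e: "e > 0"
        \<comment> \<open>the oscillation enters the bound as \<open>2 T \<epsilon>\<close>\<close>
        define \<epsilon> where "\<epsilon> = e / (4 * T)"
        have \<epsilon>: "\<epsilon> > 0" using e T_pos by (simp add: \<epsilon>_def)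
        obtain d where d: "d > 0"
          and osc: "\<And>s r. s \<in> {0..T} \<Longrightarrow> r \<in> {0..T} \<Longrightarrow> dist r s < d \<Longrightarrow> dist (Y r \<omega>) (Y s \<omega>) < sqrt \<epsilon>"
          using uc \<epsilon> unfolding uniformly_continuous_on_def by (metis real_sqrt_gt_0_iff)
        have "(\<lambda>n. T / real (Suc n)) \<longlonglongrightarrow> 0"
          using tendsto_divide_0[OF tendsto_const] filterlim_compose[OF filterlim_real_at_infinity_sequentially filterlim_Suc]
          by blast
        then have "eventually (\<lambda>n. T / real (Suc n) < d) sequentially"
          using d by (rule order_tendstoD)
        then show "eventually (\<lambda>n. dist (Z n \<omega>) 0 < e) sequentially"
        proof eventually_elim
          case (elim n)
          have le: "ennreal (Q n \<omega>) \<le> 2 * x1 n \<omega> + ennreal (2 * T * \<epsilon>)"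
            unfolding Q_def x1_def
          proof (rule step_distance_le[OF p, where f = "\<lambda>t. Y t \<omega>"])
            show "continuous_on {0..T} (\<lambda>t. Y t \<omega>)" by fact
            fix i s assume i: "i < m n" "s \<in> {\<sigma> n i<..\<sigma> n (Suc i)}"
            show "simple_process (k n) (\<pi> n) (\<xi> n) s \<omega> = simple_value (k n) (\<pi> n) (\<xi> n) (\<sigma> n i) \<omega>"
              by (rule simple_process_refine[OF p sub i])
            have "dist s (\<sigma> n i) < d" using mesh[OF i(1)] i(2) elim by (auto simp: dist_real_def)
            then have "dist (Y s \<omega>) (Y (\<sigma> n i) \<omega>) < sqrt \<epsilon>"
              using range[of i n] range[of "Suc i" n] i by (intro osc) auto
            then have "\<bar>Y s \<omega> - Y (\<sigma> n i) \<omega>\<bar> ^ 2 \<le> sqrt \<epsilon> ^ 2"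
              by (intro power_mono) (auto simp: dist_real_def)
            then show "(Y s \<omega> - Y (\<sigma> n i) \<omega>)\<^sup>2 \<le> \<epsilon>" using \<epsilon> by simp
          qed (use \<epsilon> in simp)
          have "Z n \<omega> \<le> 2 * T * \<epsilon>"
          proof (cases "x1 n \<omega> = \<infinity>")
            case False
            then have "x1 n \<omega> = ennreal (enn2real (x1 n \<omega>))" by (simp add: less_top)
            then have "ennreal (Q n \<omega>) \<le> ennreal (2 * enn2real (x1 n \<omega>) + 2 * T * \<epsilon>)"
              using le \<epsilon> T_pos by (simp add: ennreal_mult)
            then have "Q n \<omega> \<le> 2 * enn2real (x1 n \<omega>) + 2 * T * \<epsilon>"
              using \<epsilon> T_pos by (subst (asm) ennreal_le_iff) auto
            then show ?thesis using \<epsilon> T_pos False by (simp add: Z_def)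
          qed (use \<epsilon> T_pos in \<open>simp add: Z_def\<close>)
          also have "\<dots> < e" using e T_pos by (simp add: \<epsilon>_def)
          finally show ?case by (simp add: dist_real_def Z_def)
        qed
      qed
    qed
  qed
  have Z_prob: "conv_in_prob M Z (\<lambda>_. 0)" by (rule conv_in_probI_AE) (use Z0 in auto)
  show "(\<lambda>n. prob {\<omega>\<in>space M. \<delta> < Q n \<omega>}) \<longlonglongrightarrow> 0"
  proof -
    let ?A = "\<lambda>n. {\<omega>\<in>space M. ennreal (\<delta>/4) < x1 n \<omega>}" and ?C = "\<lambda>n. {\<omega>\<in>space M. \<delta>/4 < \<bar>Z n \<omega> - 0\<bar>}"
    have le: "prob {\<omega>\<in>space M. \<delta> < Q n \<omega>} \<le> prob (?A n) + prob (?C n)" for n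
    proof -
      have "prob {\<omega>\<in>space M. \<delta> < Q n \<omega>} \<le> prob (?A n \<union> ?C n)"
      proof (rule finite_measure_mono)
        show "{\<omega>\<in>space M. \<delta> < Q n \<omega>} \<subseteq> ?A n \<union> ?C n"
        proof
          fix \<omega> assume \<omega>: "\<omega> \<in> {\<omega>\<in>space M. \<delta> < Q n \<omega>}"
          have "\<omega> \<in> ?C n" if "\<not> ennreal (\<delta>/4) < x1 n \<omega>"
          proof -
            have "x1 n \<omega> \<le> ennreal (\<delta>/4)" using that by simp
            then have "x1 n \<omega> \<noteq> \<infinity>" by (auto simp: top_unique)
            moreover have "enn2real (x1 n \<omega>) \<le> \<delta>/4"
              using \<delta> \<open>x1 n \<omega> \<le> ennreal (\<delta>/4)\<close> by (intro enn2real_leI) simp_all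
            ultimately show ?thesis using \<omega> \<delta> by (simp add: Z_def)
          qed
          then show "\<omega> \<in> ?A n \<union> ?C n" using \<omega> by blast
        qed
      qed measurable
      also have "\<dots> \<le> prob (?A n) + prob (?C n)" by (rule measure_Un_le) measurable
      finally show ?thesis .
    qed
    have lim0: "(\<lambda>n. prob (?A n) + prob (?C n)) \<longlonglongrightarrow> 0"
    proof (rule tendsto_add_zero)
      show "(\<lambda>n. prob (?A n)) \<longlonglongrightarrow> 0"
        using X \<delta> by (simp add: null_in_prob_def x1_def)
      have "\<delta>/4 > 0" using \<delta> by simp
      then show "(\<lambda>n. prob (?C n)) \<longlonglongrightarrow> 0" using Z_prob unfolding conv_in_prob_def by blast
    qed
    show ?thesis
    proof (rule tendsto_sandwich[OF _ _ tendsto_const lim0])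
      show "eventually (\<lambda>n. prob {\<omega>\<in>space M. \<delta> < Q n \<omega>} \<le> prob (?A n) + prob (?C n)) sequentially"
        by (intro always_eventually allI le)
    qed simp
  qed
qed

text \<open>
  Passing to common refinements does not change the integrals of the simple processes, which converge
  to \<open>J\<close>.  Their difference from the left sums of \<open>Y\<close> is the left sum of \<open>D\<close>, whose accumulated
  variance tends to zero in probability, so that the domination inequality applies.  The set \<open>R\<close> allows
  for the times at which the limit is to be evaluated.
\<close>

lemma ito_left_sums:
  assumes Y: "continuous_adapted M F T Y" and Y2: "\<And>s. s \<in> {0..T} \<Longrightarrow> integrable M (\<lambda>\<omega>. (Y s \<omega>)\<^sup>2)"
    and ito: "has_ito_integral M F T Y (time_extension W (Some j)) J"
    and R: "finite R" "R \<subseteq> {0..T}"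
  shows "\<exists>m \<sigma>. (\<forall>n. time_partition T (m n) (\<sigma> n)) \<and> (\<forall>n. R \<subseteq> \<sigma> n ` {..m n}) \<and>
    (\<forall>r\<in>R. conv_in_prob M (\<lambda>n. left_sum (m n) (\<sigma> n) Y j r) (J r))"
proof -
  let ?B = "time_extension W (Some j)"
  obtain k \<pi> \<xi> where simple: "\<And>n. simple_integrand M F T (k n) (\<pi> n) (\<xi> n)"
    and X1: "null_in_prob M
      (\<lambda>n \<omega>. \<integral>\<^sup>+ t\<in>{0..T}. ennreal ((simple_process (k n) (\<pi> n) (\<xi> n) t \<omega> - Y t \<omega>)\<^sup>2) \<partial>lborel)"
    and X2: "null_in_prob M
      (\<lambda>n \<omega>. \<Squnion>t\<in>{0..T}. ennreal \<bar>simple_integral (k n) (\<pi> n) (\<xi> n) ?B t \<omega> - J t \<omega>\<bar>)"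
    and J: "continuous_adapted M F T J"
    using ito unfolding has_ito_integral_def by blast
  have pp: "time_partition T (k n) (\<pi> n)" for n using simple unfolding simple_integrand_def by blast
  have "\<exists>m \<sigma>. time_partition T m \<sigma> \<and> \<pi> n ` {..k n} \<union> R \<subseteq> \<sigma> ` {..m} \<and>
      (\<forall>i<m. \<sigma> (Suc i) - \<sigma> i \<le> T / real (Suc n))" for n
  proof -
    have "finite (\<pi> n ` {..k n} \<union> R)" "\<pi> n ` {..k n} \<union> R \<subseteq> {0..T}"
      using R time_partition_range[OF pp] by auto
    from fine_time_partition[OF T_pos this, of n] show ?thesis by metis
  qed
  then obtain m \<sigma> where p: "\<And>n. time_partition T (m n) (\<sigma> n)"
    and sub: "\<And>n. \<pi> n ` {..k n} \<union> R \<subseteq> \<sigma> n ` {..m n}"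
    and mesh: "\<And>n i. i < m n \<Longrightarrow> \<sigma> n (Suc i) - \<sigma> n i \<le> T / real (Suc n)"
    by metis
  have sub': "\<pi> n ` {..k n} \<subseteq> \<sigma> n ` {..m n}" "R \<subseteq> \<sigma> n ` {..m n}" for n using sub[of n] by auto
  define V where "V n = simple_value (k n) (\<pi> n) (\<xi> n)" for n
  define D where "D n s \<omega> = V n s \<omega> - Y s \<omega>" for n s \<omega>
  define Q where "Q n \<omega> = (\<Sum>i<m n. (D n (\<sigma> n i) \<omega>)\<^sup>2 * (\<sigma> n (Suc i) - \<sigma> n i))" for n \<omega>
  have QM: "Q n \<in> borel_measurable M" and Q_lim: "\<delta> > 0 \<Longrightarrow> (\<lambda>n. prob {\<omega>\<in>space M. \<delta> < Q n \<omega>}) \<longlonglongrightarrow> 0" for n \<delta>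
  proof -
    note dist = step_distance_in_prob[where k = k and \<pi> = \<pi> and \<xi> = \<xi> and m = m and \<sigma> = \<sigma> and Y = Y,
        OF Y simple X1 p sub'(1) mesh, folded V_def]
    show "Q n \<in> borel_measurable M"
      using dist(1)[OF _ zero_less_one] by (simp add: Q_def[abs_def] D_def)
    show "\<delta> > 0 \<Longrightarrow> (\<lambda>n. prob {\<omega>\<in>space M. \<delta> < Q n \<omega>}) \<longlonglongrightarrow> 0"
      using dist(2) by (simp add: Q_def D_def)
  qed
  have VF: "V n s \<in> borel_measurable (F s)" if "0 \<le> s" for n s
    unfolding V_def by (rule simple_value_measurable[OF simple that])
  have DF: "D n s \<in> borel_measurable (F s)" if "s \<in> {0..T}" for n s
    unfolding D_def[abs_def] using VF adapted_measurable[OF Y that] that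
    by (intro borel_measurable_diff) auto
  have D2: "integrable M (\<lambda>\<omega>. (D n s \<omega>)\<^sup>2)" if s: "s \<in> {0..T}" for n s
  proof -
    have s0: "0 \<le> s" using s by simp
    have "second_moment_le M (V n s) (expectation (\<lambda>\<omega>. (V n s \<omega>)\<^sup>2))"
      using F_measurable_M[OF VF[OF s0] s0] simple_value_square_integrable[OF simple s0]
      by (intro sq_integrable_second_moment) (simp_all add: V_def)
    moreover have "second_moment_le M (Y s) (expectation (\<lambda>\<omega>. (Y s \<omega>)\<^sup>2))"
      using adapted_measurable_M[OF Y s] Y2[OF s] by (rule sq_integrable_second_moment)
    ultimately show ?thesis unfolding D_def by (rule second_moment_leD(2)[OF second_moment_le_diff])
  qed
  have lim: "conv_in_prob M (\<lambda>n. left_sum (m n) (\<sigma> n) Y j r) (J r)" if r: "r \<in> R" for r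
  proof -
    have rT: "r \<in> {0..T}" and r\<sigma>: "r \<in> \<sigma> n ` {..m n}" for n using r R sub'(2) by auto
    define N where "N n = simple_integral (k n) (\<pi> n) (\<xi> n) ?B r" for n
    have N_eq: "N n = left_sum (m n) (\<sigma> n) (V n) j r" for n
      by (simp add: fun_eq_iff N_def simple_integral_refine[OF p pp sub'(1) r\<sigma>] left_sum_def V_def
        time_extension_def)
    have NM[measurable]: "N n \<in> borel_measurable M" for n
      unfolding N_eq by (rule left_sum_measurable[OF p r\<sigma> VF])
    have LM[measurable]: "left_sum (m n) (\<sigma> n) Y j r \<in> borel_measurable M" for n
      by (rule left_sum_measurable[OF p r\<sigma> adapted_measurable[OF Y]]) (use rT in auto)
    have JM[measurable]: "J r \<in> borel_measurable M" by (rule adapted_measurable_M[OF J rT])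
    have diff: "N n \<omega> - left_sum (m n) (\<sigma> n) Y j r \<omega> = left_sum (m n) (\<sigma> n) (D n) j r \<omega>" for n \<omega>
      by (simp add: N_eq left_sum_def D_def sum_subtractf[symmetric] left_diff_distrib)
    have NJ: "conv_in_prob M N (J r)"
    proof (rule conv_in_probI_bound[where b = "\<lambda>\<epsilon> n. prob {\<omega>\<in>space M. ennreal \<epsilon> <
        (\<Squnion>t\<in>{0..T}. ennreal \<bar>simple_integral (k n) (\<pi> n) (\<xi> n) ?B t \<omega> - J t \<omega>\<bar>)}"])
      fix \<epsilon> :: real and n assume \<epsilon>: "\<epsilon> > 0"
      let ?s = "\<lambda>\<omega>. \<Squnion>t\<in>{0..T}. ennreal \<bar>simple_integral (k n) (\<pi> n) (\<xi> n) ?B t \<omega> - J t \<omega>\<bar>"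
      have [measurable]: "?s \<in> borel_measurable M" using X2 by (simp add: null_in_prob_def)
      show "prob {\<omega>\<in>space M. \<epsilon> < \<bar>N n \<omega> - J r \<omega>\<bar>} \<le> prob {\<omega>\<in>space M. ennreal \<epsilon> < ?s \<omega>}"
      proof (rule finite_measure_mono)
        show "{\<omega>\<in>space M. \<epsilon> < \<bar>N n \<omega> - J r \<omega>\<bar>} \<subseteq> {\<omega>\<in>space M. ennreal \<epsilon> < ?s \<omega>}"
        proof clarify
          fix \<omega> assume "\<epsilon> < \<bar>N n \<omega> - J r \<omega>\<bar>"
          then have "ennreal \<epsilon> < ennreal \<bar>N n \<omega> - J r \<omega>\<bar>" using \<epsilon> by (intro ennreal_lessI) auto
          also have "\<dots> \<le> ?s \<omega>" unfolding N_def by (rule SUP_upper[OF rT])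
          finally show "ennreal \<epsilon> < ?s \<omega>" .
        qed
      qed measurable
    next
      fix \<epsilon> :: real assume "\<epsilon> > 0"
      then show "(\<lambda>n. prob {\<omega>\<in>space M. ennreal \<epsilon> <
        (\<Squnion>t\<in>{0..T}. ennreal \<bar>simple_integral (k n) (\<pi> n) (\<xi> n) ?B t \<omega> - J t \<omega>\<bar>)}) \<longlonglongrightarrow> 0"
        using X2 by (simp add: null_in_prob_def)
    qed measurable
    have NL: "conv_in_prob M (\<lambda>n \<omega>. N n \<omega> - left_sum (m n) (\<sigma> n) Y j r \<omega>) (\<lambda>_. 0)"
      unfolding conv_in_prob_def
    proof (intro conjI allI impI)
      fix a :: real assume a: "a > 0"
      have dom: "prob {\<omega>\<in>space M. a < \<bar>N n \<omega> - left_sum (m n) (\<sigma> n) Y j r \<omega> - 0\<bar>} \<le>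
          prob {\<omega>\<in>space M. \<delta> < Q n \<omega>} + \<delta> / a\<^sup>2" if \<delta>: "\<delta> > 0" for n \<delta>
      proof -
        let ?q = "\<lambda>\<omega>. \<Sum>i | i < m n \<and> \<sigma> n i < r. (D n (\<sigma> n i) \<omega>)\<^sup>2 * (\<sigma> n (Suc i) - \<sigma> n i)"
        have "prob {\<omega>\<in>space M. a < \<bar>N n \<omega> - left_sum (m n) (\<sigma> n) Y j r \<omega> - 0\<bar>} \<le>
           prob {\<omega>\<in>space M. a \<le> \<bar>N n \<omega> - left_sum (m n) (\<sigma> n) Y j r \<omega>\<bar>}"
          by (rule finite_measure_mono) auto
        also have "\<dots> \<le> prob {\<omega>\<in>space M. \<delta> < ?q \<omega>} + \<delta> / a\<^sup>2"
          unfolding diff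
          by (rule left_sum_domination_inequality[OF p r\<sigma> a less_imp_le[OF \<delta>] DF D2]) (use rT in auto)
        also have "prob {\<omega>\<in>space M. \<delta> < ?q \<omega>} \<le> prob {\<omega>\<in>space M. \<delta> < Q n \<omega>}"
        proof (rule finite_measure_mono)
          have "?q \<omega> \<le> Q n \<omega>" for \<omega>
            unfolding Q_def
          proof (rule sum_mono2)
            fix i assume "i \<in> {..<m n} - {i. i < m n \<and> \<sigma> n i < r}"
            then have "\<sigma> n i < \<sigma> n (Suc i)" using p[of n] by (auto simp: time_partition_def)
            then show "0 \<le> (D n (\<sigma> n i) \<omega>)\<^sup>2 * (\<sigma> n (Suc i) - \<sigma> n i)" by simp
          qed auto
          then show "{\<omega>\<in>space M. \<delta> < ?q \<omega>} \<subseteq> {\<omega>\<in>space M. \<delta> < Q n \<omega>}"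
            by (auto intro: less_le_trans)
          show "{\<omega>\<in>space M. \<delta> < Q n \<omega>} \<in> sets M" using QM by measurable
        qed
        finally show ?thesis by simp
      qed
      show "(\<lambda>n. prob {\<omega>\<in>space M. a < \<bar>N n \<omega> - left_sum (m n) (\<sigma> n) Y j r \<omega> - 0\<bar>}) \<longlonglongrightarrow> 0"
        (is "?P \<longlonglongrightarrow> 0")
        unfolding tendsto_iff
      proof (intro allI impI)
        fix e :: real assume e: "e > 0"
        define \<delta> where "\<delta> = e * a\<^sup>2 / 2"
        have \<delta>: "\<delta> > 0" using e a by (simp add: \<delta>_def)
        have \<delta>a: "\<delta> / a\<^sup>2 = e / 2" using a by (simp add: \<delta>_def)
        have "eventually (\<lambda>n. prob {\<omega>\<in>space M. \<delta> < Q n \<omega>} < e / 2) sequentially"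
          using order_tendstoD(2)[OF Q_lim[OF \<delta>], of "e / 2"] e by simp
        then show "eventually (\<lambda>n. dist (?P n) 0 < e) sequentially"
        proof eventually_elim
          case (elim n)
          have "0 \<le> ?P n" by simp
          then show ?case using elim dom[OF \<delta>, of n] \<delta>a unfolding dist_real_def by linarith
        qed
      qed
    qed measurable
    show ?thesis using conv_in_prob_diff[OF NJ NL] by simp
  qed
  with p sub'(2) show ?thesis by blast
qed


text \<open>
  The subtracted term is the integral of the constant \<open>\<zeta>\<close> over \<open>[a, b]\<close>, so this is the Ito isometry
  for \<open>Y - \<zeta>\<close>.  With \<open>\<zeta> = 0\<close> it bounds the increments of the integral, with \<open>\<zeta> = Y a\<close> the error of their
  first order expansion.
\<close>

lemma ito_increment_second_moment:
  assumes Y: "continuous_adapted M F T Y" and Y2: "\<And>s. s \<in> {0..T} \<Longrightarrow> integrable M (\<lambda>\<omega>. (Y s \<omega>)\<^sup>2)"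
    and ito: "has_ito_integral M F T Y (time_extension W (Some j)) J"
    and ab: "0 \<le> a" "a \<le> b" "b \<le> T"
    and \<zeta>: "\<zeta> \<in> borel_measurable (F a)"
    and c: "\<And>s. a \<le> s \<Longrightarrow> s \<le> b \<Longrightarrow> second_moment_le M (\<lambda>\<omega>. Y s \<omega> - \<zeta> \<omega>) c"
  shows "second_moment_le M (\<lambda>\<omega>. J b \<omega> - J a \<omega> - \<zeta> \<omega> * dW j a b \<omega>) (c * (b - a))"
proof -
  have abT: "a \<in> {0..T}" "b \<in> {0..T}" using ab by auto
  have fs: "finite {a, b}" "{a, b} \<subseteq> {0..T}" using abT by auto
  obtain m \<sigma> where
    p: "\<And>n. time_partition T (m n) (\<sigma> n)" and sub: "\<And>n. {a, b} \<subseteq> \<sigma> n ` {..m n}"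
    and lim: "\<And>r. r \<in> {a, b} \<Longrightarrow> conv_in_prob M (\<lambda>n. left_sum (m n) (\<sigma> n) Y j r) (J r)"
    using ito_left_sums[OF Y Y2 ito fs] by blast
  have meas: "(\<lambda>\<omega>. \<zeta> \<omega> * dW j a b \<omega>) \<in> borel_measurable M"
    using F_measurable_M[OF \<zeta> ab(1)] ab
    by (intro borel_measurable_times borel_measurable_diff W_component_measurable_M) auto
  define D where "D s \<omega> = (if s < a then 0 else Y s \<omega> - \<zeta> \<omega>)" for s \<omega>
  have eq: "left_sum (m n) (\<sigma> n) D j b \<omega> =
      left_sum (m n) (\<sigma> n) Y j b \<omega> - left_sum (m n) (\<sigma> n) Y j a \<omega> - \<zeta> \<omega> * dW j a b \<omega>"
    and step: "(\<Sum>i | i < m n \<and> \<sigma> n i < b. (if \<sigma> n i < a then 0 else c) * (\<sigma> n (Suc i) - \<sigma> n i)) = c * (b - a)"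
    for n \<omega>
  proof -
    let ?d = "\<lambda>i. dW j (\<sigma> n i) (\<sigma> n (Suc i)) \<omega>" and ?s = "\<sigma> n"
    let ?I = "{i. i < m n \<and> ?s i < b}" and ?A = "{i. i < m n \<and> ?s i < a}"
      and ?B = "{i. i < m n \<and> a \<le> ?s i \<and> ?s i < b}"
    have un: "?I = ?A \<union> ?B" "?A \<inter> ?B = {}" "finite ?A" "finite ?B" using ab by auto
    note tel = time_partition_telescope[OF p, of a n b]
    have split: "(\<Sum>i\<in>?I. g i) = (\<Sum>i\<in>?A. g i) + (\<Sum>i\<in>?B. g i)" for g :: "nat \<Rightarrow> real"
      unfolding un(1) by (rule sum.union_disjoint[OF un(3,4,2)])
    have "left_sum (m n) ?s D j b \<omega> = (\<Sum>i\<in>?B. (Y (?s i) \<omega> - \<zeta> \<omega>) * ?d i)"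
      unfolding left_sum_def split by (simp add: D_def)
    also have "\<dots> = (\<Sum>i\<in>?B. Y (?s i) \<omega> * ?d i) - \<zeta> \<omega> * (\<Sum>i\<in>?B. ?d i)"
      unfolding sum_distrib_left by (simp only: left_diff_distrib sum_subtractf[symmetric])
    also have "(\<Sum>i\<in>?B. ?d i) = dW j a b \<omega>"
      using tel[of "\<lambda>s. W s \<omega> $ j"] sub[of n] ab by simp
    finally show "left_sum (m n) ?s D j b \<omega> =
        left_sum (m n) ?s Y j b \<omega> - left_sum (m n) ?s Y j a \<omega> - \<zeta> \<omega> * dW j a b \<omega>"
      unfolding left_sum_def[of _ _ Y] split by simp
    have "(\<Sum>i\<in>?I. (if ?s i < a then 0 else c) * (?s (Suc i) - ?s i)) = c * (\<Sum>i\<in>?B. ?s (Suc i) - ?s i)"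
      unfolding split sum_distrib_left by simp
    then show "(\<Sum>i\<in>?I. (if ?s i < a then 0 else c) * (?s (Suc i) - ?s i)) = c * (b - a)"
      using tel[of "\<lambda>s. s"] sub[of n] ab by simp
  qed
  have "conv_in_prob M (\<lambda>n. left_sum (m n) (\<sigma> n) D j b) (\<lambda>\<omega>. J b \<omega> - J a \<omega> - \<zeta> \<omega> * dW j a b \<omega>)"
    unfolding eq[abs_def] by (intro conv_in_prob_diff lim conv_in_prob_const meas) auto
  then show ?thesis
  proof (rule conv_in_prob_second_moment)
    fix n
    show "second_moment_le M (left_sum (m n) (\<sigma> n) D j b) (c * (b - a))"
      unfolding step[of n, symmetric]
    proof (rule left_sum_second_moment[OF p])
      show "b \<in> \<sigma> n ` {..m n}" using sub[of n] by simp
      fix s assume s: "0 \<le> s" "s < b"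
      show "D s \<in> borel_measurable (F s)"
      proof (cases "s < a")
        case False
        then have "\<zeta> \<in> borel_measurable (F s)" using F_measurable_mono[OF \<zeta> ab(1)] by simp
        then show ?thesis using False adapted_measurable[OF Y, of s] s ab by (simp add: D_def[abs_def])
      qed (simp add: D_def[abs_def])
      show "second_moment_le M (D s) (if s < a then 0 else c)"
        using c[of s] s second_moment_le_zero[of 0 M] by (simp add: D_def[abs_def])
    qed
  qed
qed


text \<open>
  The Ito isometry for exponential weights.
\<close>

lemma ito_second_moment:
  assumes Y: "continuous_adapted M F T Y" and \<alpha>: "\<alpha> > 0" and c: "c \<ge> 0"
    and Y2: "\<And>s. s \<in> {0..T} \<Longrightarrow> second_moment_le M (Y s) (c * exp (\<alpha> * s))"
    and ito: "has_ito_integral M F T Y (time_extension W (Some j)) J"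
    and t: "t \<in> {0..T}"
  shows "second_moment_le M (J t) (c * exp (\<alpha> * t) / \<alpha>)"
proof -
  note int = second_moment_leD(2)[OF Y2]
  have fs: "finite {t}" "{t} \<subseteq> {0..T}" using t by auto
  obtain m \<sigma> where
    p: "\<And>n. time_partition T (m n) (\<sigma> n)" and sub: "\<And>n. {t} \<subseteq> \<sigma> n ` {..m n}"
    and lim: "\<And>r. r \<in> {t} \<Longrightarrow> conv_in_prob M (\<lambda>n. left_sum (m n) (\<sigma> n) Y j r) (J r)"
    using ito_left_sums[OF Y int ito fs] by blast
  have "conv_in_prob M (\<lambda>n. left_sum (m n) (\<sigma> n) Y j t) (J t)" by (rule lim) simp
  then show ?thesis
  proof (rule conv_in_prob_second_moment)
    fix n
    obtain l where l: "l \<le> m n" "\<sigma> n l = t" using sub[of n] by auto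
    have "t \<in> \<sigma> n ` {..m n}" using sub[of n] by simp
    then have "second_moment_le M (left_sum (m n) (\<sigma> n) Y j t)
       (\<Sum>i | i < m n \<and> \<sigma> n i < t. c * exp (\<alpha> * \<sigma> n i) * (\<sigma> n (Suc i) - \<sigma> n i))"
      by (rule left_sum_second_moment[OF p]) (use t adapted_measurable[OF Y] Y2 in simp_all)
    then show "second_moment_le M (left_sum (m n) (\<sigma> n) Y j t) (c * exp (\<alpha> * t) / \<alpha>)"
      using exp_left_sum_le[OF \<alpha> c, where \<sigma> = "\<sigma> n" and l = l] time_partition_below[OF p l(1)] l(2)
      by (auto intro: second_moment_le_mono)
  qed
qed

text \<open>
  The maximum over a finite set of times passes to the limit in probability at the cost of halving the
  threshold, whence the factor \<open>4\<close>.
\<close>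

lemma ito_maximal_inequality:
  assumes Y: "continuous_adapted M F T Y" and \<alpha>: "\<alpha> > 0" and c: "c \<ge> 0"
    and Y2: "\<And>s. s \<in> {0..T} \<Longrightarrow> second_moment_le M (Y s) (c * exp (\<alpha> * s))"
    and ito: "has_ito_integral M F T Y (time_extension W (Some j)) J"
    and R: "finite R" "R \<subseteq> {0..T}" and x: "x > 0"
  shows "prob {\<omega>\<in>space M. \<exists>r\<in>R. x \<le> \<bar>J r \<omega>\<bar>} \<le> 4 * (c * exp (\<alpha> * T) / \<alpha>) / x\<^sup>2"
proof -
  note int = second_moment_leD(2)[OF Y2]
  obtain m \<sigma> where
    p: "\<And>n. time_partition T (m n) (\<sigma> n)" and sub: "\<And>n. R \<subseteq> \<sigma> n ` {..m n}"
    and lim: "\<And>r. r \<in> R \<Longrightarrow> conv_in_prob M (\<lambda>n. left_sum (m n) (\<sigma> n) Y j r) (J r)"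
    using ito_left_sums[OF Y int ito R] by blast
  have LM[measurable]: "left_sum (m n) (\<sigma> n) Y j r \<in> borel_measurable M" if "r \<in> R" for n r
    using lim[OF that] by (simp add: conv_in_prob_def)
  have JM[measurable]: "J r \<in> borel_measurable M" if "r \<in> R" for r
    using lim[OF that] by (simp add: conv_in_prob_def)
  let ?E = "\<lambda>n r. {\<omega>\<in>space M. x/2 < \<bar>left_sum (m n) (\<sigma> n) Y j r \<omega> - J r \<omega>\<bar>}"
  let ?b = "4 * (c * exp (\<alpha> * T) / \<alpha>) / x\<^sup>2"
  have le: "prob {\<omega>\<in>space M. \<exists>r\<in>R. x \<le> \<bar>J r \<omega>\<bar>} \<le> ?b + (\<Sum>r\<in>R. prob (?E n r))" for n
  proof -
    let ?A = "{\<omega>\<in>space M. \<exists>r\<in>\<sigma> n ` {..m n}. x/2 \<le> \<bar>left_sum (m n) (\<sigma> n) Y j r \<omega>\<bar>}"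
    have "prob ?A \<le> (\<Sum>i<m n. c * exp (\<alpha> * \<sigma> n i) * (\<sigma> n (Suc i) - \<sigma> n i)) / (x/2)\<^sup>2"
      by (rule left_sum_maximal_inequality[OF p]) (use x adapted_measurable[OF Y] Y2 in simp_all)
    also have "\<dots> \<le> (c * exp (\<alpha> * T) / \<alpha>) / (x/2)\<^sup>2"
      using exp_left_sum_le[OF \<alpha> c, where \<sigma> = "\<sigma> n" and l = "m n"] p[of n]
      by (intro divide_right_mono) (simp_all add: time_partition_def)
    also have "\<dots> = ?b" by (simp add: power_divide)
    finally have A: "prob ?A \<le> ?b" .
    have meas_A: "?A \<in> sets M"
    proof -
      have "?A = (\<Union>r\<in>\<sigma> n ` {..m n}. {\<omega>\<in>space M. x/2 \<le> \<bar>left_sum (m n) (\<sigma> n) Y j r \<omega>\<bar>})" by auto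
      also have "\<dots> \<in> sets M"
      proof (rule sets.finite_UN)
        fix r assume r: "r \<in> \<sigma> n ` {..m n}"
        then have "r \<le> T" using time_partition_range[OF p] by auto
        then have [measurable]: "left_sum (m n) (\<sigma> n) Y j r \<in> borel_measurable M"
          by (intro left_sum_measurable[OF p r] adapted_measurable[OF Y]) simp
        show "{\<omega>\<in>space M. x/2 \<le> \<bar>left_sum (m n) (\<sigma> n) Y j r \<omega>\<bar>} \<in> sets M" by measurable
      qed simp
      finally show ?thesis .
    qed
    have meas_E: "?E n r \<in> sets M" if "r \<in> R" for r using LM[OF that, of n] JM[OF that] by measurable
    have meas_UE: "(\<Union>r\<in>R. ?E n r) \<in> sets M" by (rule sets.finite_UN[OF R(1) meas_E])
    have "prob {\<omega>\<in>space M. \<exists>r\<in>R. x \<le> \<bar>J r \<omega>\<bar>} \<le> prob (?A \<union> (\<Union>r\<in>R. ?E n r))"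
    proof (rule finite_measure_mono)
      show "{\<omega>\<in>space M. \<exists>r\<in>R. x \<le> \<bar>J r \<omega>\<bar>} \<subseteq> ?A \<union> (\<Union>r\<in>R. ?E n r)"
      proof
        fix \<omega> assume "\<omega> \<in> {\<omega>\<in>space M. \<exists>r\<in>R. x \<le> \<bar>J r \<omega>\<bar>}"
        then obtain r where \<omega>: "\<omega> \<in> space M" "r \<in> R" "x \<le> \<bar>J r \<omega>\<bar>" by auto
        have "x/2 \<le> \<bar>left_sum (m n) (\<sigma> n) Y j r \<omega>\<bar> \<or> x/2 < \<bar>left_sum (m n) (\<sigma> n) Y j r \<omega> - J r \<omega>\<bar>"
          using \<omega>(3) by linarith
        then show "\<omega> \<in> ?A \<union> (\<Union>r\<in>R. ?E n r)"
        proof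
          assume "x/2 \<le> \<bar>left_sum (m n) (\<sigma> n) Y j r \<omega>\<bar>"
          then show ?thesis using \<omega>(1,2) sub[of n] by blast
        next
          assume "x/2 < \<bar>left_sum (m n) (\<sigma> n) Y j r \<omega> - J r \<omega>\<bar>"
          then show ?thesis using \<omega> by blast
        qed
      qed
      show "?A \<union> (\<Union>r\<in>R. ?E n r) \<in> sets M"
        by (rule sets.Un[OF meas_A meas_UE])
    qed
    also have "\<dots> \<le> prob ?A + prob (\<Union>r\<in>R. ?E n r)"
      by (rule measure_Un_le[OF meas_A meas_UE])
    also have "prob (\<Union>r\<in>R. ?E n r) \<le> (\<Sum>r\<in>R. prob (?E n r))"
      by (rule finite_measure_subadditive_finite[OF R(1)]) (use meas_E in blast)
    finally show ?thesis using A by simp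
  qed
  have lim_b: "(\<lambda>n. ?b + (\<Sum>r\<in>R. prob (?E n r))) \<longlonglongrightarrow> ?b + (\<Sum>r\<in>R. 0)"
  proof (intro tendsto_add tendsto_const tendsto_sum)
    fix r assume "r \<in> R"
    then have "conv_in_prob M (\<lambda>n. left_sum (m n) (\<sigma> n) Y j r) (J r)" by (rule lim)
    moreover have "x/2 > 0" using x by simp
    ultimately show "(\<lambda>n. prob (?E n r)) \<longlonglongrightarrow> 0" unfolding conv_in_prob_def by blast
  qed
  have "prob {\<omega>\<in>space M. \<exists>r\<in>R. x \<le> \<bar>J r \<omega>\<bar>} \<le> ?b + (\<Sum>r\<in>R. 0)"
    using le by (intro LIMSEQ_le_const[OF lim_b]) blast
  then show ?thesis by simp
qed

end

section \<open>Uniform grids and time integrals\<close>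

definition grid :: "real \<Rightarrow> real \<Rightarrow> nat \<Rightarrow> nat \<Rightarrow> real" where
  "grid a b n i = a + (b - a) * real i / real (Suc n)"

lemma grid_0 [simp]: "grid a b n 0 = a"
  by (simp add: grid_def)

lemma grid_Suc_n [simp]: "grid a b n (Suc n) = b"
  by (simp add: grid_def)

lemma grid_step: "grid a b n (Suc i) - grid a b n i = (b - a) / real (Suc n)"
  unfolding grid_def by (simp add: diff_divide_distrib[symmetric] right_diff_distrib[symmetric]
    del: of_nat_Suc)

lemma grid_less: "a < b \<Longrightarrow> grid a b n i < grid a b n (Suc i)"
proof -
  assume "a < b"
  then have "0 < (b - a) / real (Suc n)" by simp
  then show ?thesis unfolding grid_step[of a b n i, symmetric] by simp
qed

lemma grid_mono: "a \<le> b \<Longrightarrow> i \<le> j \<Longrightarrow> grid a b n i \<le> grid a b n j"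
  unfolding grid_def by (intro add_left_mono divide_right_mono mult_left_mono) auto

lemma grid_range: "a \<le> b \<Longrightarrow> i \<le> Suc n \<Longrightarrow> grid a b n i \<in> {a..b}"
  using grid_mono[of a b 0 i n] grid_mono[of a b i "Suc n" n] by simp

lemma mesh_tendsto_0: "(\<lambda>n. c / real (Suc n)) \<longlonglongrightarrow> 0"
  using LIMSEQ_Suc[OF lim_const_over_n[of c]] by simp

lemma left_riemann_sums:
  fixes f :: "real \<Rightarrow> real"
  assumes f: "continuous_on {a..b} f" and ab: "a \<le> b"
  shows "(\<lambda>n. \<Sum>i<Suc n. f (grid a b n i) * ((b - a) / real (Suc n))) \<longlonglongrightarrow> (LINT s:{a..b}|lborel. f s)"
proof -
  have LI: "(LINT s:{a..b}|lborel. f s) = integral {a..b} f"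
    by (rule set_borel_integral_eq_integral(2)[OF borel_integrable_atLeastAtMost'[OF f]])
  have cont: "continuous_on {x..y} f" if "a \<le> x" "y \<le> b" for x y
    by (rule continuous_on_subset[OF f]) (use that in auto)
  have split: "integral {a..grid a b n l} f = (\<Sum>i<l. integral {grid a b n i..grid a b n (Suc i)} f)"
    if "l \<le> Suc n" for n l
    using that
  proof (induction l)
    case (Suc l)
    have r: "a \<le> grid a b n l" "grid a b n l \<le> grid a b n (Suc l)" "grid a b n (Suc l) \<le> b"
      using grid_range[OF ab, of l n] grid_range[OF ab, of "Suc l" n] grid_mono[OF ab, of l "Suc l" n] Suc.prems
      by auto
    have "integral {a..grid a b n l} f + integral {grid a b n l..grid a b n (Suc l)} f = integral {a..grid a b n (Suc l)} f"
      using r by (intro Henstock_Kurzweil_Integration.integral_combine integrable_continuous_real cont) auto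
    then show ?case using Suc by simp
  qed simp
  have uc: "uniformly_continuous_on {a..b} f" by (rule compact_uniformly_continuous[OF f]) simp
  show ?thesis
    unfolding LI tendsto_iff
  proof (intro allI impI)
    fix e :: real assume e: "e > 0"
    define \<epsilon> where "\<epsilon> = e / 2 / (b - a + 1)"
    have \<epsilon>: "\<epsilon> > 0" using e ab by (simp add: \<epsilon>_def)
    obtain d where d: "d > 0"
      and osc: "\<And>s r. s \<in> {a..b} \<Longrightarrow> r \<in> {a..b} \<Longrightarrow> dist r s < d \<Longrightarrow> dist (f r) (f s) < \<epsilon>"
      using uc \<epsilon> unfolding uniformly_continuous_on_def by metis
    have "eventually (\<lambda>n. (b - a) / real (Suc n) < d) sequentially"
      by (rule order_tendstoD(2)[OF mesh_tendsto_0 d])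
    then show "eventually (\<lambda>n. dist (\<Sum>i<Suc n. f (grid a b n i) * ((b - a) / real (Suc n))) (integral {a..b} f) < e) sequentially"
    proof eventually_elim
      case (elim n)
      let ?g = "grid a b n" and ?\<Delta> = "(b - a) / real (Suc n)"
      have one: "\<bar>integral {?g i..?g (Suc i)} f - f (?g i) * ?\<Delta>\<bar> \<le> \<epsilon> * ?\<Delta>" if i: "i < Suc n" for i
      proof -
        have r: "?g i \<in> {a..b}" "?g (Suc i) \<in> {a..b}" "?g i \<le> ?g (Suc i)"
          using grid_range[OF ab, of i n] grid_range[OF ab, of "Suc i" n] grid_mono[OF ab, of i "Suc i" n] i by auto
        have c: "continuous_on {?g i..?g (Suc i)} f" using r by (intro cont) auto
        have "integral {?g i..?g (Suc i)} (\<lambda>s. f s - f (?g i)) = integral {?g i..?g (Suc i)} f - f (?g i) * ?\<Delta>"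
          using r grid_step[of a b n i]
          by (subst Henstock_Kurzweil_Integration.integral_diff) (auto intro!: integrable_continuous_real c)
        moreover have "norm (integral {?g i..?g (Suc i)} (\<lambda>s. f s - f (?g i))) \<le> \<epsilon> * (?g (Suc i) - ?g i)"
        proof (rule integral_bound[OF r(3)])
          show "continuous_on {?g i..?g (Suc i)} (\<lambda>s. f s - f (?g i))" by (intro continuous_intros c)
          fix s assume s: "s \<in> {?g i..?g (Suc i)}"
          then have "dist s (?g i) < d" using elim grid_step[of a b n i] by (auto simp: dist_real_def)
          then have "dist (f s) (f (?g i)) < \<epsilon>" using r s by (intro osc) auto
          then show "norm (f s - f (?g i)) \<le> \<epsilon>" by (simp add: dist_norm)
        qed
        ultimately show ?thesis using grid_step[of a b n i] by simp
      qed
      have "\<bar>integral {a..b} f - (\<Sum>i<Suc n. f (?g i) * ?\<Delta>)\<bar> =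
          \<bar>\<Sum>i<Suc n. (integral {?g i..?g (Suc i)} f - f (?g i) * ?\<Delta>)\<bar>"
        using split[of "Suc n" n] by (simp only: sum_subtractf grid_Suc_n order_refl simp_thms)
      also have "\<dots> \<le> (\<Sum>i<Suc n. \<epsilon> * ?\<Delta>)"
        by (rule order_trans[OF sum_abs]) (intro sum_mono one, simp)
      also have "\<dots> = \<epsilon> * (b - a)" by simp
      also have "\<dots> < e"
      proof -
        have "\<epsilon> * (b - a) \<le> \<epsilon> * (b - a + 1)" using \<epsilon> by (intro mult_left_mono) auto
        also have "\<dots> = e / 2"
        proof -
          have "b - a + 1 \<noteq> 0" using ab by simp
          then have "x / (b - a + 1) * (b - a + 1) = x" for x by simp
          then show ?thesis unfolding \<epsilon>_def .
        qed
        finally show ?thesis using e by simp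
      qed
      finally show ?case by (simp only: dist_real_def abs_minus_commute)
    qed
  qed
qed

context brownian
begin

text \<open>
  Working with Riemann sums avoids integrating over time and over the sample space simultaneously: the
  processes are measurable at each fixed time, and joint measurability is never at stake.  The
  inequality is that of Cauchy and Schwarz, \<open>(\<integral> Y)\<^sup>2 \<le> (b - a) \<integral> Y\<^sup>2\<close>.
\<close>

lemma time_integral_second_moment:
  assumes cont: "AE \<omega> in M. continuous_on {a..b} (\<lambda>s. Y s \<omega>)" and ab: "a \<le> b"
    and Y: "\<And>s. s \<in> {a..b} \<Longrightarrow> second_moment_le M (Y s) (h s)"
    and X: "X \<in> borel_measurable M" "AE \<omega> in M. X \<omega> = (LINT s:{a..b}|lborel. Y s \<omega>)"
    and H: "\<And>n. (\<Sum>i<Suc n. h (grid a b n i) * ((b - a) / real (Suc n))) \<le> H"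
  shows "second_moment_le M X ((b - a) * H)"
proof -
  define S where "S n \<omega> = (\<Sum>i<Suc n. Y (grid a b n i) \<omega> * ((b - a) / real (Suc n)))" for n \<omega>
  have Yg: "second_moment_le M (Y (grid a b n i)) (h (grid a b n i))" if "i < Suc n" for n i
    using Y grid_range[OF ab, of i n] that by simp
  have SM: "S n \<in> borel_measurable M" for n
    unfolding S_def[abs_def] using second_moment_leD(1)[OF Yg]
    by (intro borel_measurable_sum borel_measurable_times) auto
  have "AE \<omega> in M. (\<lambda>n. S n \<omega>) \<longlonglongrightarrow> X \<omega>"
    using cont X(2)
  proof eventually_elim
    case (elim \<omega>)
    show ?case unfolding S_def elim(2) by (rule left_riemann_sums[OF elim(1) ab])
  qed
  then have "conv_in_prob M S X" by (rule conv_in_probI_AE[OF SM X(1)])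
  then show ?thesis
  proof (rule conv_in_prob_second_moment)
    fix n
    let ?\<Delta> = "(b - a) / real (Suc n)"
    have \<Delta>: "0 \<le> ?\<Delta>" using ab by simp
    have int: "integrable M (\<lambda>\<omega>. (Y (grid a b n i) \<omega>)\<^sup>2 * ?\<Delta>)" if "i < Suc n" for i
      by (rule Bochner_Integration.integrable_mult_left) (rule second_moment_leD(2)[OF Yg[OF that]])
    show "second_moment_le M (S n) ((b - a) * H)"
    proof (rule second_moment_le_bound[OF SM])
      show "integrable M (\<lambda>\<omega>. (b - a) * (\<Sum>i<Suc n. (Y (grid a b n i) \<omega>)\<^sup>2 * ?\<Delta>))"
        by (rule Bochner_Integration.integrable_mult_right, rule Bochner_Integration.integrable_sum)
          (use int in blast)
      have "expectation (\<lambda>\<omega>. (b - a) * (\<Sum>i<Suc n. (Y (grid a b n i) \<omega>)\<^sup>2 * ?\<Delta>)) =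
          (b - a) * (\<Sum>i<Suc n. expectation (\<lambda>\<omega>. (Y (grid a b n i) \<omega>)\<^sup>2 * ?\<Delta>))"
      proof (subst Bochner_Integration.integral_mult_right_zero, subst Bochner_Integration.integral_sum)
        fix i assume "i \<in> {..<Suc n}"
        then show "integrable M (\<lambda>\<omega>. (Y (grid a b n i) \<omega>)\<^sup>2 * ?\<Delta>)" using int by blast
      qed (rule refl)
      also have "\<dots> \<le> (b - a) * (\<Sum>i<Suc n. h (grid a b n i) * ?\<Delta>)"
      proof (intro mult_left_mono sum_mono)
        fix i assume "i \<in> {..<Suc n}"
        then have "expectation (\<lambda>\<omega>. (Y (grid a b n i) \<omega>)\<^sup>2) \<le> h (grid a b n i)"
          using second_moment_leD(3)[OF Yg[of i n]] by blast
        then have "expectation (\<lambda>\<omega>. (Y (grid a b n i) \<omega>)\<^sup>2) * ?\<Delta> \<le> h (grid a b n i) * ?\<Delta>"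
          using \<Delta> by (rule mult_right_mono)
        then show "expectation (\<lambda>\<omega>. (Y (grid a b n i) \<omega>)\<^sup>2 * ?\<Delta>) \<le> h (grid a b n i) * ?\<Delta>"
          by (subst Bochner_Integration.integral_mult_left_zero)
      qed (use ab in simp)
      also have "\<dots> \<le> (b - a) * H" using H ab by (intro mult_left_mono) auto
      finally show "expectation (\<lambda>\<omega>. (b - a) * (\<Sum>i<Suc n. (Y (grid a b n i) \<omega>)\<^sup>2 * ?\<Delta>)) \<le> (b - a) * H" .
      have "(S n \<omega>)\<^sup>2 \<le> (b - a) * (\<Sum>i<Suc n. (Y (grid a b n i) \<omega>)\<^sup>2 * ?\<Delta>)" for \<omega>
      proof -
        have "(S n \<omega>)\<^sup>2 = ?\<Delta>\<^sup>2 * (\<Sum>i<Suc n. Y (grid a b n i) \<omega>)\<^sup>2"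
          unfolding S_def sum_distrib_right[symmetric] power_mult_distrib by (rule mult.commute)
        also have "\<dots> \<le> ?\<Delta>\<^sup>2 * ((\<Sum>i<Suc n. (Y (grid a b n i) \<omega>)\<^sup>2) * real (Suc n))"
          using sum_squared_le_sum_of_squares[of "\<lambda>i. Y (grid a b n i) \<omega>" "{..<Suc n}"]
          by (intro mult_left_mono) auto
        also have "\<dots> = (?\<Delta> * real (Suc n)) * ((\<Sum>i<Suc n. (Y (grid a b n i) \<omega>)\<^sup>2) * ?\<Delta>)"
          by (simp only: power2_eq_square mult_ac)
        also have "?\<Delta> * real (Suc n) = b - a" by simp
        finally show ?thesis by (simp only: sum_distrib_right)
      qed
      then show "AE \<omega> in M. (S n \<omega>)\<^sup>2 \<le> (b - a) * (\<Sum>i<Suc n. (Y (grid a b n i) \<omega>)\<^sup>2 * ?\<Delta>)" by simp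
    qed
  qed
qed

lemma time_integral_second_moment_exp:
  assumes cont: "AE \<omega> in M. continuous_on {0..t} (\<lambda>s. Y s \<omega>)" and t: "0 \<le> t"
    and \<alpha>: "\<alpha> > 0" and c: "c \<ge> 0"
    and Y: "\<And>s. s \<in> {0..t} \<Longrightarrow> second_moment_le M (Y s) (c * exp (\<alpha> * s))"
    and X: "X \<in> borel_measurable M" "AE \<omega> in M. X \<omega> = (LINT s:{0..t}|lborel. Y s \<omega>)"
  shows "second_moment_le M X (t * (c * exp (\<alpha> * t) / \<alpha>))"
proof -
  have "second_moment_le M X ((t - 0) * (c * exp (\<alpha> * t) / \<alpha>))"
  proof (rule time_integral_second_moment[OF cont t Y X])
    show "(\<Sum>i<Suc n. c * exp (\<alpha> * grid 0 t n i) * ((t - 0) / real (Suc n))) \<le> c * exp (\<alpha> * t) / \<alpha>" for n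
      using exp_left_sum_le[OF \<alpha> c, where \<sigma> = "grid 0 t n" and l = "Suc n"] by (simp only: grid_step grid_Suc_n)
  qed
  then show ?thesis by simp
qed

lemma time_integral_increment_second_moment:
  assumes Y: "continuous_adapted M F T Y" and c: "\<And>s. s \<in> {0..T} \<Longrightarrow> second_moment_le M (Y s) c"
    and I: "has_time_integral M F T Y I" and ab: "0 \<le> a" "a \<le> b" "b \<le> T"
  shows "second_moment_le M (\<lambda>\<omega>. I b \<omega> - I a \<omega>) (c * (b - a)\<^sup>2)"
proof -
  have cont: "AE \<omega> in M. continuous_on {0..T} (\<lambda>t. Y t \<omega>)" using Y by (simp add: continuous_adapted_def)
  have "second_moment_le M (\<lambda>\<omega>. I b \<omega> - I a \<omega>) ((b - a) * (c * (b - a)))"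
  proof (rule time_integral_second_moment[where Y = Y and h = "\<lambda>_. c"])
    show "AE \<omega> in M. continuous_on {a..b} (\<lambda>s. Y s \<omega>)"
      using cont by eventually_elim (use ab in \<open>auto elim: continuous_on_subset\<close>)
    have IA: "continuous_adapted M F T I" using I by (simp add: has_time_integral_def)
    show "(\<lambda>\<omega>. I b \<omega> - I a \<omega>) \<in> borel_measurable M"
      using adapted_measurable_M[OF IA, of a] adapted_measurable_M[OF IA, of b] ab by auto
    have "AE \<omega> in M. \<forall>t\<in>{0..T}. I t \<omega> = (LINT s:{0..t}|lborel. Y s \<omega>)"
      using I by (simp add: has_time_integral_def)
    then show "AE \<omega> in M. I b \<omega> - I a \<omega> = (LINT s:{a..b}|lborel. Y s \<omega>)"
      using cont
    proof eventually_elim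
      case (elim \<omega>)
      have eq: "(LINT s:{x..y}|lborel. Y s \<omega>) = integral {x..y} (\<lambda>s. Y s \<omega>)" if "0 \<le> x" "y \<le> T" for x y
        by (rule set_borel_integral_eq_integral(2)[OF borel_integrable_atLeastAtMost'])
          (rule continuous_on_subset[OF elim(2)], use that in auto)
      have "integral {0..a} (\<lambda>s. Y s \<omega>) + integral {a..b} (\<lambda>s. Y s \<omega>) = integral {0..b} (\<lambda>s. Y s \<omega>)"
        using ab by (intro Henstock_Kurzweil_Integration.integral_combine integrable_continuous_real
          continuous_on_subset[OF elim(2)]) auto
      then show ?case using elim(1) ab eq[of 0 a] eq[of 0 b] eq[of a b] by simp
    qed
    show "second_moment_le M (Y s) c" if "s \<in> {a..b}" for s using c that ab by simp
    show "(\<Sum>i<Suc n. c * ((b - a) / real (Suc n))) \<le> c * (b - a)" for n by simp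
  qed (rule ab)
  then show ?thesis by (simp add: power2_eq_square mult_ac)
qed

text \<open>
  \<open>V = \<integral> |Y|\<close> over \<open>[0, T]\<close> dominates all the integrals over \<open>[0, t]\<close>; as a limit of Riemann sums it is
  measurable.
\<close>

lemma time_integral_dominated:
  assumes Y: "continuous_adapted M F T Y" and \<alpha>: "\<alpha> > 0" and c: "c \<ge> 0"
    and Y2: "\<And>s. s \<in> {0..T} \<Longrightarrow> second_moment_le M (Y s) (c * exp (\<alpha> * s))"
  obtains V where "second_moment_le M V (T * (c * exp (\<alpha> * T) / \<alpha>))"
    "AE \<omega> in M. \<forall>t\<in>{0..T}. \<bar>LINT s:{0..t}|lborel. Y s \<omega>\<bar> \<le> \<bar>V \<omega>\<bar>"
proof -
  have cont: "AE \<omega> in M. continuous_on {0..T} (\<lambda>t. Y t \<omega>)" using Y by (simp add: continuous_adapted_def)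
  define S where "S n \<omega> = (\<Sum>i<Suc n. \<bar>Y (grid 0 T n i) \<omega>\<bar> * ((T - 0) / real (Suc n)))" for n \<omega>
  have T0: "0 \<le> T" using T_pos by simp
  have YgM: "Y (grid 0 T n i) \<in> borel_measurable M" if "i < Suc n" for n i
    using adapted_measurable_M[OF Y grid_range[OF T0, of i n]] that by simp
  have SM: "S n \<in> borel_measurable M" for n
    unfolding S_def[abs_def] using YgM
    by (intro borel_measurable_sum borel_measurable_times borel_measurable_abs) auto
  define V where "V \<omega> = lim (\<lambda>n. S n \<omega>)" for \<omega>
  have VM: "V \<in> borel_measurable M"
    unfolding V_def[abs_def] using SM by (rule borel_measurable_lim_metric)
  have abs_cont: "AE \<omega> in M. continuous_on {0..T} (\<lambda>t. \<bar>Y t \<omega>\<bar>)"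
    using cont by eventually_elim (intro continuous_intros)
  have V_eq: "AE \<omega> in M. V \<omega> = (LINT s:{0..T}|lborel. \<bar>Y s \<omega>\<bar>)"
    using abs_cont
  proof eventually_elim
    case (elim \<omega>)
    show ?case unfolding V_def S_def by (rule limI[OF left_riemann_sums[OF elim T0]])
  qed
  have abs2: "second_moment_le M (\<lambda>\<omega>. \<bar>Y s \<omega>\<bar>) (c * exp (\<alpha> * s))" if "s \<in> {0..T}" for s
    using Y2[OF that] borel_measurable_abs[OF second_moment_leD(1)[OF Y2[OF that]]]
    by (simp add: second_moment_le_def)
  have "second_moment_le M V (T * (c * exp (\<alpha> * T) / \<alpha>))"
    by (rule time_integral_second_moment_exp[OF abs_cont T0 \<alpha> c abs2 VM V_eq])
  moreover have "AE \<omega> in M. \<forall>t\<in>{0..T}. \<bar>LINT s:{0..t}|lborel. Y s \<omega>\<bar> \<le> \<bar>V \<omega>\<bar>"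
    using cont V_eq
  proof eventually_elim
    case (elim \<omega>)
    show ?case
    proof
      fix t assume t: "t \<in> {0..T}"
      have i1: "set_integrable lborel {0..t} (\<lambda>s. Y s \<omega>)"
        by (rule borel_integrable_atLeastAtMost', rule continuous_on_subset[OF elim(1)]) (use t in auto)
      have i2: "set_integrable lborel {0..T} (\<lambda>s. \<bar>Y s \<omega>\<bar>)"
        by (intro borel_integrable_atLeastAtMost' continuous_intros elim(1))
      have "\<bar>LINT s:{0..t}|lborel. Y s \<omega>\<bar> \<le> (LINT s:{0..T}|lborel. \<bar>Y s \<omega>\<bar>)"
        unfolding set_lebesgue_integral_def
      proof (rule order_trans[OF integral_abs_bound], rule integral_mono)
        show "integrable lborel (\<lambda>s. \<bar>indicator {0..t} s *\<^sub>R Y s \<omega>\<bar>)"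
          using i1 unfolding set_integrable_def by (rule integrable_abs)
        show "integrable lborel (\<lambda>s. indicator {0..T} s *\<^sub>R \<bar>Y s \<omega>\<bar>)"
          using i2 unfolding set_integrable_def .
      qed (use t in \<open>auto simp: indicator_def\<close>)
      then show "\<bar>LINT s:{0..t}|lborel. Y s \<omega>\<bar> \<le> \<bar>V \<omega>\<bar>" using elim(2) by simp
    qed
  qed
  ultimately show thesis by (rule that)
qed

end

section \<open>Quadratic covariations\<close>

lemma dense_countable_times:
  assumes "T > (0 :: real)"
  obtains D where "countable D" "D \<subseteq> {0<..<T}" "closure D = {0..T}"
proof -
  obtain E :: "real set" where E: "countable E" "\<And>X. open X \<Longrightarrow> X \<noteq> {} \<Longrightarrow> \<exists>d\<in>E. d \<in> X"
    by (rule countable_dense_setE) blast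
  have "x \<in> closure E" for x
  proof (rule ccontr)
    assume "x \<notin> closure E"
    then have "\<exists>d\<in>E. d \<in> - closure E" by (intro E(2)) auto
    then show False using closure_subset by blast
  qed
  then have "closure ({0<..<T} \<inter> E) = closure {0<..<T}"
    by (intro closure_open_Int_superset) auto
  also have "\<dots> = {0..T}" using assms by simp
  finally show thesis using E(1) by (intro that[of "{0<..<T} \<inter> E"]) auto
qed

context prob_space
begin

text \<open>
  Products of increments of orders \<open>\<Delta>\<close> and \<open>\<Delta>\<^bsup>1/2\<^esup>\<close> sum up to order \<open>\<Delta>\<^bsup>1/2\<^esup>\<close>.
\<close>

lemma grid_product_vanishes:
  fixes U V :: "nat \<Rightarrow> nat \<Rightarrow> 'a \<Rightarrow> real"
  assumes t: "t > 0"
    and U: "\<And>n i. i < Suc n \<Longrightarrow> second_moment_le M (U n i) (K * (t / real (Suc n))\<^sup>2)"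
    and V: "\<And>n i. i < Suc n \<Longrightarrow> second_moment_le M (V n i) (L * (t / real (Suc n)))"
  shows "conv_in_prob M (\<lambda>n \<omega>. \<Sum>i<Suc n. U n i \<omega> * V n i \<omega>) (\<lambda>_. 0)"
proof (rule conv_in_probI_L1[where a = "\<lambda>n. (K + L) / 2 * t * sqrt (t / real (Suc n))"])
  have int1: "integrable M (\<lambda>\<omega>. U n i \<omega> * V n i \<omega>)" if "i < Suc n" for n i
    using second_moment_leD[OF U[OF that]] second_moment_leD[OF V[OF that]]
    by (intro integrable_mult_second_moment) auto
  have int: "integrable M (\<lambda>\<omega>. \<Sum>i<Suc n. U n i \<omega> * V n i \<omega>)" for n
    by (rule Bochner_Integration.integrable_sum) (use int1 in blast)
  show "(\<lambda>\<omega>. \<Sum>i<Suc n. U n i \<omega> * V n i \<omega>) \<in> borel_measurable M" for n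
    using int by (rule borel_measurable_integrable)
  show "integrable M (\<lambda>\<omega>. (\<Sum>i<Suc n. U n i \<omega> * V n i \<omega>) - 0)" for n using int[of n] by simp
  have "(\<lambda>n. (K + L) / 2 * t * sqrt (t / real (Suc n))) \<longlonglongrightarrow> (K + L) / 2 * t * sqrt 0"
    by (intro tendsto_mult tendsto_const tendsto_real_sqrt mesh_tendsto_0)
  then show "(\<lambda>n. (K + L) / 2 * t * sqrt (t / real (Suc n))) \<longlonglongrightarrow> 0" by simp
  fix n
  define \<Delta> where "\<Delta> = t / real (Suc n)"
  have \<Delta>: "\<Delta> > 0" using t by (simp add: \<Delta>_def)
  define h where "h = sqrt \<Delta>"
  have h: "h > 0" "\<Delta> = h * h" using \<Delta> by (simp_all add: h_def)
  have one: "expectation (\<lambda>\<omega>. \<bar>U n i \<omega> * V n i \<omega>\<bar>) \<le> (K + L) / 2 * \<Delta> * h" if i: "i < Suc n" for i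
  proof -
    note U1 = U[OF i, folded \<Delta>_def] and V1 = V[OF i, folded \<Delta>_def]
    \<comment> \<open>the weights \<open>1 / h\<close> and \<open>h\<close> balance the second moments of order \<open>h\<^sup>4\<close> and \<open>h\<^sup>2\<close>\<close>
    have le: "\<bar>x * y\<bar> \<le> x\<^sup>2 / (2 * h) + h / 2 * y\<^sup>2" for x y :: real
    proof -
      have "2 * (\<bar>x\<bar> * (h * \<bar>y\<bar>)) \<le> x\<^sup>2 + (h * y)\<^sup>2"
        using sum_squares_bound[of "\<bar>x\<bar>" "h * \<bar>y\<bar>"] by (simp add: power_mult_distrib)
      then have "2 * (\<bar>x\<bar> * (h * \<bar>y\<bar>)) / (2 * h) \<le> (x\<^sup>2 + (h * y)\<^sup>2) / (2 * h)"
        using h by (intro divide_right_mono) auto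
      then show ?thesis using h
        by (simp add: abs_mult add_divide_distrib power2_eq_square[of "h * y"] power2_eq_square[of y] mult_ac)
    qed
    have i1: "integrable M (\<lambda>\<omega>. (U n i \<omega>)\<^sup>2 / (2 * h))"
      by (rule Bochner_Integration.integrable_divide) (use second_moment_leD(2)[OF U1] in simp)
    have i2: "integrable M (\<lambda>\<omega>. h / 2 * (V n i \<omega>)\<^sup>2)"
      by (rule Bochner_Integration.integrable_mult_right) (use second_moment_leD(2)[OF V1] in simp)
    have "expectation (\<lambda>\<omega>. \<bar>U n i \<omega> * V n i \<omega>\<bar>) \<le> expectation (\<lambda>\<omega>. (U n i \<omega>)\<^sup>2 / (2 * h) + h / 2 * (V n i \<omega>)\<^sup>2)"
      by (intro integral_mono integrable_abs int1 i Bochner_Integration.integrable_add i1 i2 le)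
    also have "\<dots> = expectation (\<lambda>\<omega>. (U n i \<omega>)\<^sup>2) / (2 * h) + h / 2 * expectation (\<lambda>\<omega>. (V n i \<omega>)\<^sup>2)"
      unfolding Bochner_Integration.integral_add[OF i1 i2] by simp
    also have "\<dots> \<le> K * \<Delta>\<^sup>2 / (2 * h) + h / 2 * (L * \<Delta>)"
      using second_moment_leD(3)[OF U1] second_moment_leD(3)[OF V1] h
      by (intro add_mono divide_right_mono mult_left_mono) auto
    also have "\<dots> = (K + L) / 2 * \<Delta> * h"
      using h(1) unfolding h(2) by (simp add: power2_eq_square field_simps)
    finally show ?thesis .
  qed
  have "expectation (\<lambda>\<omega>. \<bar>(\<Sum>i<Suc n. U n i \<omega> * V n i \<omega>) - 0\<bar>) \<le>
      expectation (\<lambda>\<omega>. \<Sum>i<Suc n. \<bar>U n i \<omega> * V n i \<omega>\<bar>)"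
  proof (rule integral_mono)
    show "integrable M (\<lambda>\<omega>. \<bar>(\<Sum>i<Suc n. U n i \<omega> * V n i \<omega>) - 0\<bar>)" using integrable_abs[OF int[of n]] by simp
    show "integrable M (\<lambda>\<omega>. \<Sum>i<Suc n. \<bar>U n i \<omega> * V n i \<omega>\<bar>)"
      by (rule Bochner_Integration.integrable_sum, rule integrable_abs) (use int1 in blast)
    show "\<bar>(\<Sum>i<Suc n. U n i \<omega> * V n i \<omega>) - 0\<bar> \<le> (\<Sum>i<Suc n. \<bar>U n i \<omega> * V n i \<omega>\<bar>)" for \<omega>
      unfolding diff_0_right by (rule sum_abs)
  qed
  also have "\<dots> = (\<Sum>i<Suc n. expectation (\<lambda>\<omega>. \<bar>U n i \<omega> * V n i \<omega>\<bar>))"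
    by (rule Bochner_Integration.integral_sum, rule integrable_abs) (use int1 in blast)
  also have "\<dots> \<le> (\<Sum>i<Suc n. (K + L) / 2 * \<Delta> * h)" by (intro sum_mono one) simp
  also have "\<dots> = (K + L) / 2 * (real (Suc n) * \<Delta>) * h" by (simp only: sum_constant card_lessThan mult_ac)
  also have "real (Suc n) * \<Delta> = t" by (simp add: \<Delta>_def del: of_nat_Suc)
  finally show "expectation (\<lambda>\<omega>. \<bar>(\<Sum>i<Suc n. U n i \<omega> * V n i \<omega>) - 0\<bar>) \<le> (K + L) / 2 * t * sqrt (t / real (Suc n))"
    by (simp only: h_def \<Delta>_def)
qed simp

end

context brownian
begin

text \<open>
  The limits defining integrals and brackets hold for each fixed time outside a null set that depends
  on the time; continuity makes the null set uniform.
\<close>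

lemma AE_eq_everywhere:
  assumes A: "AE \<omega> in M. continuous_on {0..T} (\<lambda>t. A t \<omega>)" and B: "AE \<omega> in M. continuous_on {0..T} (\<lambda>t. B t \<omega>)"
    and eq: "\<And>t. 0 < t \<Longrightarrow> t < T \<Longrightarrow> AE \<omega> in M. A t \<omega> = (B t \<omega> :: real)"
  shows "AE \<omega> in M. \<forall>t\<in>{0..T}. A t \<omega> = B t \<omega>"
proof -
  obtain D where D: "countable D" "D \<subseteq> {0<..<T}" "closure D = {0..T}"
    by (rule dense_countable_times[OF T_pos])
  have "AE \<omega> in M. \<forall>t\<in>D. A t \<omega> = B t \<omega>"
    by (rule AE_ball_countable[THEN iffD2, OF D(1)]) (use eq D(2) in auto)
  then show ?thesis using A B
  proof eventually_elim
    case (elim \<omega>)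
    have c: "continuous_on (closure D) (\<lambda>t. A t \<omega> - B t \<omega>)"
      unfolding D(3) by (intro continuous_intros elim)
    show ?case
    proof
      fix t assume "t \<in> {0..T}"
      then have "t \<in> closure D" unfolding D(3) .
      moreover have "A s \<omega> - B s \<omega> = 0" if "s \<in> D" for s using elim(1) that by simp
      ultimately have "A t \<omega> - B t \<omega> = 0"
        by (rule continuous_constant_on_closure[OF c, rotated])
      then show "A t \<omega> = B t \<omega>" by simp
    qed
  qed
qed

lemma quadratic_covariation_grid:
  assumes A: "has_quadratic_covariation M F T X Z A" and t: "0 < t" "t \<le> T"
    and X: "\<And>s. s \<in> {0..T} \<Longrightarrow> X s \<in> borel_measurable M" and Z: "\<And>s. s \<in> {0..T} \<Longrightarrow> Z s \<in> borel_measurable M"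
  shows "conv_in_prob M (\<lambda>n \<omega>. \<Sum>i<Suc n. (X (grid 0 t n (Suc i)) \<omega> - X (grid 0 t n i) \<omega>) *
     (Z (grid 0 t n (Suc i)) \<omega> - Z (grid 0 t n i) \<omega>)) (A t)"
proof -
  have t0: "0 \<le> t" using t by simp
  have lt: "grid 0 t n i < grid 0 t n (Suc i)" for n i by (rule grid_less[OF t(1)])
  have van: "vanishing_partitions t (\<lambda>n. Suc n) (\<lambda>n. grid 0 t n)"
    unfolding vanishing_partitions_def time_partition_def
  proof (intro conjI allI impI)
    fix \<delta> :: real assume "\<delta> > 0"
    then have "eventually (\<lambda>n. t / real (Suc n) < \<delta>) sequentially"
      by (rule order_tendstoD(2)[OF mesh_tendsto_0])
    then show "eventually (\<lambda>n. \<forall>i<Suc n. grid 0 t n (Suc i) - grid 0 t n i < \<delta>) sequentially"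
      by eventually_elim (simp only: grid_step diff_0_right simp_thms)
  qed (simp_all add: lt)
  have tT: "t \<in> {0..T}" using t by simp
  have null: "null_in_prob M (\<lambda>n \<omega>. ennreal \<bar>(\<Sum>i<Suc n. (X (grid 0 t n (Suc i)) \<omega> - X (grid 0 t n i) \<omega>) *
     (Z (grid 0 t n (Suc i)) \<omega> - Z (grid 0 t n i) \<omega>)) - A t \<omega>\<bar>)"
    using A tT van unfolding has_quadratic_covariation_def by blast
  have mem: "grid 0 t n i \<in> {0..T}" if "i \<le> Suc n" for n i
    using grid_range[OF t0 that] t by auto
  show ?thesis
    unfolding conv_in_prob_def
  proof (intro conjI allI impI)
    show "(\<lambda>\<omega>. \<Sum>i<Suc n. (X (grid 0 t n (Suc i)) \<omega> - X (grid 0 t n i) \<omega>) *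
     (Z (grid 0 t n (Suc i)) \<omega> - Z (grid 0 t n i) \<omega>)) \<in> borel_measurable M" for n
      by (intro borel_measurable_sum borel_measurable_times borel_measurable_diff X Z mem) auto
    show "A t \<in> borel_measurable M"
      using A tT adapted_measurable_M[of A t] by (simp add: has_quadratic_covariation_def)
    fix \<epsilon> :: real assume \<epsilon>: "\<epsilon> > 0"
    then show "(\<lambda>n. prob {\<omega>\<in>space M. \<epsilon> < \<bar>(\<Sum>i<Suc n. (X (grid 0 t n (Suc i)) \<omega> - X (grid 0 t n i) \<omega>) *
     (Z (grid 0 t n (Suc i)) \<omega> - Z (grid 0 t n i) \<omega>)) - A t \<omega>\<bar>}) \<longlonglongrightarrow> 0"
      using null unfolding null_in_prob_def
      by (simp add: ennreal_less_iff)
  qed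
qed

lemma quadratic_covariation_zero:
  assumes A: "has_quadratic_covariation M F T X Z A \<or> has_quadratic_covariation M F T Z X A"
    and X: "\<And>s. s \<in> {0..T} \<Longrightarrow> X s \<in> borel_measurable M" and Z: "\<And>s. s \<in> {0..T} \<Longrightarrow> Z s \<in> borel_measurable M"
    and X2: "\<And>a b. 0 \<le> a \<Longrightarrow> a < b \<Longrightarrow> b \<le> T \<Longrightarrow> second_moment_le M (\<lambda>\<omega>. X b \<omega> - X a \<omega>) (K * (b - a)\<^sup>2)"
    and Z2: "\<And>a b. 0 \<le> a \<Longrightarrow> a < b \<Longrightarrow> b \<le> T \<Longrightarrow> second_moment_le M (\<lambda>\<omega>. Z b \<omega> - Z a \<omega>) (L * (b - a))"
  shows "AE \<omega> in M. \<forall>t\<in>{0..T}. A t \<omega> = 0"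
proof (rule AE_eq_everywhere)
  show "AE \<omega> in M. continuous_on {0..T} (\<lambda>t. A t \<omega>)"
    using A by (auto simp: has_quadratic_covariation_def continuous_adapted_def)
  fix t assume t: "0 < t" "t < T"
  then have t0: "0 \<le> t" "t \<le> T" by auto
  let ?g = "grid 0 t"
  have g: "0 \<le> ?g n i" "?g n i < ?g n (Suc i)" "?g n (Suc i) \<le> T" if "i < Suc n" for n i
  proof -
    show "?g n i < ?g n (Suc i)" by (rule grid_less[OF t(1)])
    show "0 \<le> ?g n i" "?g n (Suc i) \<le> T"
      using grid_range[OF t0(1), of i n] grid_range[OF t0(1), of "Suc i" n] that t by auto
  qed
  have "conv_in_prob M (\<lambda>n \<omega>. \<Sum>i<Suc n. (X (?g n (Suc i)) \<omega> - X (?g n i) \<omega>) * (Z (?g n (Suc i)) \<omega> - Z (?g n i) \<omega>)) (\<lambda>_. 0)"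
  proof (rule grid_product_vanishes[OF t(1)])
    fix n i assume i: "i < Suc n"
    show "second_moment_le M (\<lambda>\<omega>. X (?g n (Suc i)) \<omega> - X (?g n i) \<omega>) (K * (t / real (Suc n))\<^sup>2)"
      using X2[OF g[OF i]] by (simp only: grid_step diff_0_right)
    show "second_moment_le M (\<lambda>\<omega>. Z (?g n (Suc i)) \<omega> - Z (?g n i) \<omega>) (L * (t / real (Suc n)))"
      using Z2[OF g[OF i]] by (simp only: grid_step diff_0_right)
  qed
  moreover have "conv_in_prob M (\<lambda>n \<omega>. \<Sum>i<Suc n. (X (?g n (Suc i)) \<omega> - X (?g n i) \<omega>) * (Z (?g n (Suc i)) \<omega> - Z (?g n i) \<omega>)) (A t)"
    using A
  proof
    assume "has_quadratic_covariation M F T X Z A"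
    then show ?thesis by (rule quadratic_covariation_grid[OF _ t(1) t0(2) X Z])
  next
    assume "has_quadratic_covariation M F T Z X A"
    then have "conv_in_prob M (\<lambda>n \<omega>. \<Sum>i<Suc n. (Z (?g n (Suc i)) \<omega> - Z (?g n i) \<omega>) * (X (?g n (Suc i)) \<omega> - X (?g n i) \<omega>)) (A t)"
      by (rule quadratic_covariation_grid[OF _ t(1) t0(2) Z X])
    then show ?thesis by (simp only: mult.commute)
  qed
  ultimately show "AE \<omega> in M. A t \<omega> = 0" using conv_in_prob_unique by blast
qed simp

text \<open>
  A process with the first order expansion \<open>dX = Y dW\<^sup>j + O(dt)\<close> in the sense of second moments
  has \<open>d[X, W\<^sup>l] = Y d[W\<^sup>j, W\<^sup>l]\<close>: the error of the expansion does not contribute (\<open>E1\<close>), the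
  compensated products of increments form a discrete stochastic integral whose variance vanishes with
  the mesh (\<open>E2\<close>), and what is left is a Riemann sum of \<open>Y\<close>.
\<close>

lemma quadratic_covariation_brownian:
  fixes j l :: 'n
  assumes A: "has_quadratic_covariation M F T X (time_extension W (Some l)) A"
    and X: "\<And>s. s \<in> {0..T} \<Longrightarrow> X s \<in> borel_measurable M"
    and Y: "continuous_adapted M F T Y" and Y2: "\<And>s. s \<in> {0..T} \<Longrightarrow> second_moment_le M (Y s) c"
    and X2: "\<And>a b. 0 \<le> a \<Longrightarrow> a < b \<Longrightarrow> b \<le> T \<Longrightarrow>
      second_moment_le M (\<lambda>\<omega>. X b \<omega> - X a \<omega> - Y a \<omega> * dW j a b \<omega>) (K * (b - a)\<^sup>2)"
  shows "AE \<omega> in M. \<forall>t\<in>{0..T}. A t \<omega> = of_bool (j = l) * (LINT s:{0..t}|lborel. Y s \<omega>)"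
proof (rule AE_eq_everywhere)
  show "AE \<omega> in M. continuous_on {0..T} (\<lambda>t. A t \<omega>)"
    using A by (auto simp: has_quadratic_covariation_def continuous_adapted_def)
  have Ycont: "AE \<omega> in M. continuous_on {0..T} (\<lambda>t. Y t \<omega>)" using Y by (simp add: continuous_adapted_def)
  have LI: "(LINT s:{0..t}|lborel. Y s \<omega>) = integral {0..t} (\<lambda>s. Y s \<omega>)"
    if "continuous_on {0..T} (\<lambda>t. Y t \<omega>)" "t \<le> T" for \<omega> t
    by (rule set_borel_integral_eq_integral(2)[OF borel_integrable_atLeastAtMost'])
      (rule continuous_on_subset[OF that(1)], use that(2) in auto)
  show "AE \<omega> in M. continuous_on {0..T} (\<lambda>t. of_bool (j = l) * (LINT s:{0..t}|lborel. Y s \<omega>))"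
    using Ycont
  proof eventually_elim
    case (elim \<omega>)
    have "continuous_on {0..T} (\<lambda>t. integral {0..t} (\<lambda>s. Y s \<omega>))"
      by (rule indefinite_integral_continuous_1[OF integrable_continuous_real[OF elim]])
    then have "continuous_on {0..T} (\<lambda>t. LINT s:{0..t}|lborel. Y s \<omega>)"
      by (rule continuous_on_eq) (use LI[OF elim] in auto)
    then show ?case by (intro continuous_intros)
  qed
  fix t assume t: "0 < t" "t < T"
  then have t0: "0 \<le> t" "t \<le> T" by auto
  let ?g = "grid 0 t"
  let ?W = "\<lambda>k n i \<omega>. dW k (?g n i) (?g n (Suc i)) \<omega>"
  let ?\<Delta> = "\<lambda>n. t / real (Suc n)"
  have g: "0 \<le> ?g n i" "?g n i < ?g n (Suc i)" "?g n (Suc i) \<le> T" if "i < Suc n" for n i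
  proof -
    show "?g n i < ?g n (Suc i)" by (rule grid_less[OF t(1)])
    show "0 \<le> ?g n i" "?g n (Suc i) \<le> T"
      using grid_range[OF t0(1), of i n] grid_range[OF t0(1), of "Suc i" n] that t by auto
  qed
  have gT: "?g n i \<in> {0..T}" if "i < Suc n" for n i
    using g[OF that] by auto
  have WM: "time_extension W (Some l) s \<in> borel_measurable M" if "s \<in> {0..T}" for s
    using W_component_measurable_M[of s l] that by (simp add: time_extension_def[abs_def])
  have Q: "conv_in_prob M (\<lambda>n \<omega>. \<Sum>i<Suc n. (X (?g n (Suc i)) \<omega> - X (?g n i) \<omega>) * ?W l n i \<omega>) (A t)"
    using quadratic_covariation_grid[OF A t(1) t0(2) X WM] by (simp only: time_extension_def option.case)
  have E1: "conv_in_prob M (\<lambda>n \<omega>. \<Sum>i<Suc n. (X (?g n (Suc i)) \<omega> - X (?g n i) \<omega> - Y (?g n i) \<omega> * ?W j n i \<omega>) * ?W l n i \<omega>) (\<lambda>_. 0)"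
  proof (rule grid_product_vanishes[OF t(1), where K = K and L = 1])
    fix n i assume i: "i < Suc n"
    show "second_moment_le M (\<lambda>\<omega>. X (?g n (Suc i)) \<omega> - X (?g n i) \<omega> - Y (?g n i) \<omega> * ?W j n i \<omega>) (K * (?\<Delta> n)\<^sup>2)"
      using X2[OF g[OF i]] by (simp only: grid_step diff_0_right)
    show "second_moment_le M (?W l n i) (1 * ?\<Delta> n)"
      using increment_moments(1)[OF g(1,2)[OF i], of l] by (simp only: grid_step diff_0_right mult_1)
  qed
  have E2: "conv_in_prob M (\<lambda>n \<omega>. \<Sum>i<Suc n. Y (?g n i) \<omega> * (?W j n i \<omega> * ?W l n i \<omega> - of_bool (j = l) * ?\<Delta> n)) (\<lambda>_. 0)"
  proof (rule conv_in_probI_L2)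
    fix n
    let ?Z = "\<lambda>i \<omega>. ?W j n i \<omega> * ?W l n i \<omega> - of_bool (j = l) * (?g n (Suc i) - ?g n i)"
    have noise: "martingale_noise M (\<lambda>i. F (?g n i)) ?Z (\<lambda>i. 2 * (?g n (Suc i) - ?g n i)\<^sup>2) (Suc n)"
      by (rule product_noise) (use g in auto)
    have "second_moment_le M (martingale_noise.transform ?Z (\<lambda>i. Y (?g n i)) (Suc n))
        (\<Sum>i<Suc n. c * (2 * (?g n (Suc i) - ?g n i)\<^sup>2))"
    proof (rule martingale_noise.transform_second_moment[OF noise])
      fix i assume i: "i < Suc n"
      show "Y (?g n i) \<in> borel_measurable (F (?g n i))" by (rule adapted_measurable[OF Y gT[OF i]])
      show "second_moment_le M (Y (?g n i)) c" by (rule Y2[OF gT[OF i]])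
    qed simp
    also have "(\<Sum>i<Suc n. c * (2 * (?g n (Suc i) - ?g n i)\<^sup>2)) = 2 * c * t * ?\<Delta> n"
      unfolding grid_step by (simp add: power2_eq_square)
    also have "martingale_noise.transform ?Z (\<lambda>i. Y (?g n i)) (Suc n) =
        (\<lambda>\<omega>. \<Sum>i<Suc n. Y (?g n i) \<omega> * (?W j n i \<omega> * ?W l n i \<omega> - of_bool (j = l) * ?\<Delta> n))"
      unfolding martingale_noise.transform_def[OF noise, abs_def] unfolding grid_step diff_0_right ..
    finally show "second_moment_le M (\<lambda>\<omega>. \<Sum>i<Suc n. Y (?g n i) \<omega> * (?W j n i \<omega> * ?W l n i \<omega> - of_bool (j = l) * ?\<Delta> n))
        (2 * c * t * ?\<Delta> n)" .
  next
    show "(\<lambda>n. 2 * c * t * ?\<Delta> n) \<longlonglongrightarrow> 0" by (rule tendsto_mult_right_zero[OF mesh_tendsto_0])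
  qed
  let ?I = "\<lambda>\<omega>. lim (\<lambda>n. \<Sum>i<Suc n. Y (?g n i) \<omega> * ?\<Delta> n)"
  have RM: "(\<lambda>\<omega>. \<Sum>i<Suc n. Y (?g n i) \<omega> * ?\<Delta> n) \<in> borel_measurable M" for n
    using adapted_measurable_M[OF Y gT] by (intro borel_measurable_sum borel_measurable_times) auto
  have IM: "?I \<in> borel_measurable M" by (rule borel_measurable_lim_metric[OF RM])
  have lim: "AE \<omega> in M. (\<lambda>n. \<Sum>i<Suc n. Y (?g n i) \<omega> * ?\<Delta> n) \<longlonglongrightarrow> (LINT s:{0..t}|lborel. Y s \<omega>)"
    using Ycont
  proof eventually_elim
    case (elim \<omega>)
    have "continuous_on {0..t} (\<lambda>s. Y s \<omega>)" by (rule continuous_on_subset[OF elim]) (use t in auto)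
    from left_riemann_sums[OF this t0(1)] show ?case by (simp only: diff_0_right)
  qed
  have I_eq: "AE \<omega> in M. ?I \<omega> = (LINT s:{0..t}|lborel. Y s \<omega>)"
    using lim by eventually_elim (rule limI)
  have "AE \<omega> in M. (\<lambda>n. \<Sum>i<Suc n. Y (?g n i) \<omega> * ?\<Delta> n) \<longlonglongrightarrow> ?I \<omega>"
    using lim I_eq by eventually_elim simp
  then have R: "conv_in_prob M (\<lambda>n \<omega>. \<Sum>i<Suc n. Y (?g n i) \<omega> * ?\<Delta> n) ?I"
    by (rule conv_in_probI_AE[OF RM IM])
  have sum_eq: "(\<Sum>i<Suc n. (X (?g n (Suc i)) \<omega> - X (?g n i) \<omega> - Y (?g n i) \<omega> * ?W j n i \<omega>) * ?W l n i \<omega>) +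
      (\<Sum>i<Suc n. Y (?g n i) \<omega> * (?W j n i \<omega> * ?W l n i \<omega> - of_bool (j = l) * ?\<Delta> n)) +
      of_bool (j = l) * (\<Sum>i<Suc n. Y (?g n i) \<omega> * ?\<Delta> n) =
      (\<Sum>i<Suc n. (X (?g n (Suc i)) \<omega> - X (?g n i) \<omega>) * ?W l n i \<omega>)" for n \<omega>
  proof -
    have alg: "(x - y * w) * z + y * (w * z - e * d) + e * (y * d) = x * z" for x y w z e d :: real
      by (simp add: algebra_simps)
    show ?thesis unfolding sum_distrib_left sum.distrib[symmetric] alg ..
  qed
  have "conv_in_prob M (\<lambda>n \<omega>. \<Sum>i<Suc n. (X (?g n (Suc i)) \<omega> - X (?g n i) \<omega>) * ?W l n i \<omega>)
      (\<lambda>\<omega>. 0 + 0 + of_bool (j = l) * ?I \<omega>)"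
    using conv_in_prob_add[OF conv_in_prob_add[OF E1 E2] conv_in_prob_cmult[OF R, of "of_bool (j = l)"]]
    by (simp only: sum_eq)
  from conv_in_prob_unique[OF Q this] I_eq
  show "AE \<omega> in M. A t \<omega> = of_bool (j = l) * (LINT s:{0..t}|lborel. Y s \<omega>)"
    by eventually_elim simp
qed

end

section \<open>Second moments of the signature\<close>

locale signature = brownian M F T W for M :: "'a measure" and F and T and W :: "real \<Rightarrow> 'a \<Rightarrow> real ^ ('n::finite)" +
  fixes S :: "'n word \<Rightarrow> real \<Rightarrow> 'a \<Rightarrow> real"
  assumes sig: "is_signature M F T W S"
begin

lemma S_adapted: "continuous_adapted M F T (S v)"
  using sig by (simp add: is_signature_def)

lemma S_measurable: "t \<in> {0..T} \<Longrightarrow> S v t \<in> borel_measurable M"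
  by (rule adapted_measurable_M[OF S_adapted])

lemma S_continuous: "AE \<omega> in M. continuous_on {0..T} (\<lambda>t. S v t \<omega>)"
  using S_adapted by (simp add: continuous_adapted_def)

lemma S_Nil: "AE \<omega> in M. \<forall>t\<in>{0..T}. S [] t \<omega> = 1"
  using sig by (simp add: is_signature_def)

lemma time_extension_measurable: "t \<in> {0..T} \<Longrightarrow> time_extension W i t \<in> borel_measurable M"
  using W_component_measurable_M[of t] by (cases i) (simp_all add: time_extension_def[abs_def])

lemma time_extension_increment:
  assumes "0 \<le> a" "a < b" "b \<le> T"
  shows "second_moment_le M (\<lambda>\<omega>. time_extension W i b \<omega> - time_extension W i a \<omega>) ((1 + T) * (b - a))"
proof (cases i)
  case None
  have "(b - a)\<^sup>2 \<le> (1 + T) * (b - a)"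
    unfolding power2_eq_square using assms by (intro mult_right_mono) auto
  then show ?thesis
    using None by (simp add: time_extension_def second_moment_le_def prob_space)
next
  case (Some j)
  have "(b - a) \<le> (1 + T) * (b - a)" using assms by simp
  then show ?thesis
    using increment_moments(1)[OF assms(1,2), of j] Some
    by (auto simp: time_extension_def intro: second_moment_le_mono)
qed

text \<open>
  The bracket of \<open>S v\<close> with the coordinate \<open>i\<close> of the time extension, as \<open>bracket_formula\<close> will assert.
\<close>

definition bracket :: "'n word \<Rightarrow> 'n option \<Rightarrow> real \<Rightarrow> 'a \<Rightarrow> real" where
  "bracket v i t \<omega> =
     (if v \<noteq> [] \<and> last v = i \<and> i \<noteq> None then LINT s:{0..t}|lborel. S (butlast v) s \<omega> else 0)"

definition weighted_moments :: "real \<Rightarrow> real \<Rightarrow> 'n word \<Rightarrow> bool" where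
  "weighted_moments \<rho> \<alpha> v \<longleftrightarrow> (\<forall>t\<in>{0..T}. second_moment_le M (S v t) (\<rho> ^ length v * exp (\<alpha> * t)))"

text \<open>
  Increments of Brownian order \<open>(b - a)\<^bsup>1/2\<^esup>\<close>, hence Lipschitz second moments.
\<close>

definition lipschitz_moments :: "'n word \<Rightarrow> bool" where
  "lipschitz_moments v \<longleftrightarrow> (\<exists>K\<ge>0. \<forall>a b. 0 \<le> a \<and> a < b \<and> b \<le> T \<longrightarrow>
     second_moment_le M (\<lambda>\<omega>. S v b \<omega> - S v a \<omega>) (K * (b - a)))"

definition bracket_formula :: "'n word \<Rightarrow> bool" where
  "bracket_formula v \<longleftrightarrow> (\<forall>i A. has_quadratic_covariation M F T (S v) (time_extension W i) A \<longrightarrow>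
     (AE \<omega> in M. \<forall>t\<in>{0..T}. A t \<omega> = bracket v i t \<omega>))"

lemma weighted_momentsD:
  "weighted_moments \<rho> \<alpha> v \<Longrightarrow> t \<in> {0..T} \<Longrightarrow> second_moment_le M (S v t) (\<rho> ^ length v * exp (\<alpha> * t))"
  by (simp add: weighted_moments_def)

lemma weighted_moments_const:
  assumes "weighted_moments \<rho> \<alpha> v" "0 < \<rho>" "\<rho> \<le> 1" "0 < \<alpha>" "t \<in> {0..T}"
  shows "second_moment_le M (S v t) (exp (\<alpha> * T))"
proof (rule second_moment_le_mono[OF weighted_momentsD[OF assms(1,5)]])
  have "\<rho> ^ length v * exp (\<alpha> * t) \<le> 1 * exp (\<alpha> * T)"
    using assms by (intro mult_mono power_le_one) auto
  then show "\<rho> ^ length v * exp (\<alpha> * t) \<le> exp (\<alpha> * T)" by simp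
qed

text \<open>
  The properties that the finite variation part of a Stratonovich integral shares with a time integral
  of a process whose second moments are bounded by \<open>c exp (\<alpha> t)\<close>: exponential moment bounds,
  increments of order \<open>b - a\<close> and a square integrable dominating variable.
\<close>

definition regular_part :: "real \<Rightarrow> real \<Rightarrow> (real \<Rightarrow> 'a \<Rightarrow> real) \<Rightarrow> bool" where
  "regular_part c \<alpha> A \<longleftrightarrow> continuous_adapted M F T A \<and>
     (\<forall>t\<in>{0..T}. second_moment_le M (A t) (T * (c * exp (\<alpha> * t) / \<alpha>))) \<and>
     (\<exists>K\<ge>0. \<forall>a b. 0 \<le> a \<and> a < b \<and> b \<le> T \<longrightarrow> second_moment_le M (\<lambda>\<omega>. A b \<omega> - A a \<omega>) (K * (b - a)\<^sup>2)) \<and>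
     (\<exists>V. second_moment_le M V (T * (c * exp (\<alpha> * T) / \<alpha>)) \<and>
        (AE \<omega> in M. \<forall>t\<in>{0..T}. \<bar>A t \<omega>\<bar> \<le> \<bar>V \<omega>\<bar>))"

lemma regular_part_time_integral:
  assumes m: "weighted_moments \<rho> \<alpha> u" and \<rho>: "0 < \<rho>" "\<rho> \<le> 1" and \<alpha>: "0 < \<alpha>"
    and A: "has_time_integral M F T (S u) A"
  shows "regular_part (\<rho> ^ length u) \<alpha> A"
  unfolding regular_part_def
proof (intro conjI ballI)
  have A_eq: "AE \<omega> in M. \<forall>t\<in>{0..T}. A t \<omega> = (LINT s:{0..t}|lborel. S u s \<omega>)"
    using A by (simp add: has_time_integral_def)
  show AA: "continuous_adapted M F T A" using A by (simp add: has_time_integral_def)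
  have c: "0 \<le> \<rho> ^ length u" using \<rho> by simp
  show "second_moment_le M (A t) (T * (\<rho> ^ length u * exp (\<alpha> * t) / \<alpha>))" if t: "t \<in> {0..T}" for t
  proof -
    have "second_moment_le M (A t) (t * (\<rho> ^ length u * exp (\<alpha> * t) / \<alpha>))"
    proof (rule time_integral_second_moment_exp[OF _ _ \<alpha> c])
      show "AE \<omega> in M. continuous_on {0..t} (\<lambda>s. S u s \<omega>)"
        using S_continuous[of u] by eventually_elim (use t in \<open>auto elim: continuous_on_subset\<close>)
      show "second_moment_le M (S u s) (\<rho> ^ length u * exp (\<alpha> * s))" if "s \<in> {0..t}" for s
        using weighted_momentsD[OF m] that t by simp
      show "AE \<omega> in M. A t \<omega> = (LINT s:{0..t}|lborel. S u s \<omega>)"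
        using A_eq by eventually_elim (use t in blast)
    qed (use adapted_measurable_M[OF AA t] t in auto)
    then show ?thesis
      by (rule second_moment_le_mono) (use t \<alpha> \<rho> in \<open>intro mult_right_mono, auto\<close>)
  qed
  show "\<exists>K\<ge>0. \<forall>a b. 0 \<le> a \<and> a < b \<and> b \<le> T \<longrightarrow> second_moment_le M (\<lambda>\<omega>. A b \<omega> - A a \<omega>) (K * (b - a)\<^sup>2)"
  proof (intro exI[of _ "exp (\<alpha> * T)"] conjI allI impI)
    fix a b assume ab: "0 \<le> a \<and> a < b \<and> b \<le> T"
    show "second_moment_le M (\<lambda>\<omega>. A b \<omega> - A a \<omega>) (exp (\<alpha> * T) * (b - a)\<^sup>2)"
      by (rule time_integral_increment_second_moment[OF S_adapted weighted_moments_const[OF m \<rho> \<alpha>] A])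
        (use ab in auto)
  qed simp
  obtain V where V: "second_moment_le M V (T * (\<rho> ^ length u * exp (\<alpha> * T) / \<alpha>))"
    "AE \<omega> in M. \<forall>t\<in>{0..T}. \<bar>LINT s:{0..t}|lborel. S u s \<omega>\<bar> \<le> \<bar>V \<omega>\<bar>"
    using time_integral_dominated[OF S_adapted \<alpha> c weighted_momentsD[OF m]] by blast
  have "AE \<omega> in M. \<forall>t\<in>{0..T}. \<bar>A t \<omega>\<bar> \<le> \<bar>V \<omega>\<bar>"
    using V(2) A_eq by eventually_elim simp
  with V(1) show "\<exists>V. second_moment_le M V (T * (\<rho> ^ length u * exp (\<alpha> * T) / \<alpha>)) \<and>
        (AE \<omega> in M. \<forall>t\<in>{0..T}. \<bar>A t \<omega>\<bar> \<le> \<bar>V \<omega>\<bar>)" by blast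
qed

lemma regular_part_zero:
  assumes c: "0 \<le> c" and \<alpha>: "0 < \<alpha>" and A: "continuous_adapted M F T A" "AE \<omega> in M. \<forall>t\<in>{0..T}. A t \<omega> = 0"
  shows "regular_part c \<alpha> A"
  unfolding regular_part_def
proof (intro conjI ballI)
  have T0: "0 \<le> T" using T_pos by simp
  have z: "second_moment_le M X k" if "X \<in> borel_measurable M" "AE \<omega> in M. X \<omega> = 0" "0 \<le> k" for X k
    by (rule second_moment_le_cong_AE[OF second_moment_le_zero[OF that(3)] that(1,2)])
  show "second_moment_le M (A t) (T * (c * exp (\<alpha> * t) / \<alpha>))" if t: "t \<in> {0..T}" for t
  proof (rule z[OF adapted_measurable_M[OF A(1) t]])
    show "AE \<omega> in M. A t \<omega> = 0" using A(2) by eventually_elim (use t in blast)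
  qed (use T0 c \<alpha> in simp)
  show "\<exists>K\<ge>0. \<forall>a b. 0 \<le> a \<and> a < b \<and> b \<le> T \<longrightarrow> second_moment_le M (\<lambda>\<omega>. A b \<omega> - A a \<omega>) (K * (b - a)\<^sup>2)"
  proof (intro exI[of _ 0] conjI allI impI)
    fix a b assume ab: "0 \<le> a \<and> a < b \<and> b \<le> T"
    then have mem: "a \<in> {0..T}" "b \<in> {0..T}" by auto
    show "second_moment_le M (\<lambda>\<omega>. A b \<omega> - A a \<omega>) (0 * (b - a)\<^sup>2)"
    proof (rule z)
      show "(\<lambda>\<omega>. A b \<omega> - A a \<omega>) \<in> borel_measurable M"
        using adapted_measurable_M[OF A(1)] mem by (intro borel_measurable_diff) auto
      show "AE \<omega> in M. A b \<omega> - A a \<omega> = 0" using A(2) by eventually_elim (use mem in simp)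
    qed simp
  qed simp
  show "\<exists>V. second_moment_le M V (T * (c * exp (\<alpha> * T) / \<alpha>)) \<and> (AE \<omega> in M. \<forall>t\<in>{0..T}. \<bar>A t \<omega>\<bar> \<le> \<bar>V \<omega>\<bar>)"
  proof (intro exI[of _ "\<lambda>_. 0"] conjI)
    show "second_moment_le M (\<lambda>_. 0) (T * (c * exp (\<alpha> * T) / \<alpha>))"
      by (rule second_moment_le_zero) (use T0 c \<alpha> in simp)
    show "AE \<omega> in M. \<forall>t\<in>{0..T}. \<bar>A t \<omega>\<bar> \<le> \<bar>0\<bar>" using A(2) by eventually_elim simp
  qed
qed (rule A)

text \<open>
  The bracket is zero or the time integral of \<open>S (butlast u)\<close>; dividing by \<open>\<rho>\<close> accounts for the missing
  letter.
\<close>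

lemma regular_part_bracket:
  assumes u: "bracket_formula u" and m: "u \<noteq> [] \<Longrightarrow> weighted_moments \<rho> \<alpha> (butlast u)"
    and \<rho>: "0 < \<rho>" "\<rho> \<le> 1" and \<alpha>: "0 < \<alpha>"
    and A: "has_quadratic_covariation M F T (S u) (time_extension W i) A"
  shows "regular_part (\<rho> ^ length u / \<rho>) \<alpha> A"
proof -
  have AA: "continuous_adapted M F T A" using A by (simp add: has_quadratic_covariation_def)
  have A_eq: "AE \<omega> in M. \<forall>t\<in>{0..T}. A t \<omega> = bracket u i t \<omega>"
    using u A by (simp add: bracket_formula_def)
  show ?thesis
  proof (cases "u \<noteq> [] \<and> last u = i \<and> i \<noteq> None")
    case True
    then have "has_time_integral M F T (S (butlast u)) A"
      using AA A_eq by (simp add: has_time_integral_def bracket_def)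
    then have "regular_part (\<rho> ^ length (butlast u)) \<alpha> A"
      using m True \<rho> \<alpha> by (intro regular_part_time_integral) auto
    moreover have "\<rho> ^ length (butlast u) = \<rho> ^ length u / \<rho>"
      using True \<rho> by (cases u rule: rev_cases) auto
    ultimately show ?thesis by simp
  next
    case False
    then have "bracket u i t \<omega> = 0" for t \<omega> unfolding bracket_def by (rule if_not_P)
    then have "AE \<omega> in M. \<forall>t\<in>{0..T}. A t \<omega> = 0" using A_eq by simp
    then show ?thesis using \<rho> by (intro regular_part_zero[OF _ \<alpha> AA]) auto
  qed
qed

lemma signature_stratonovich:
  obtains J A where
    "case i of None \<Rightarrow> has_time_integral M F T (S u) J
       | Some j \<Rightarrow> has_ito_integral M F T (S u) (time_extension W (Some j)) J"
    "has_quadratic_covariation M F T (S u) (time_extension W i) A"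
    "AE \<omega> in M. \<forall>t\<in>{0..T}. S (u @ [i]) t \<omega> = J t \<omega> + A t \<omega> / 2"
proof -
  have "has_stratonovich_integral M F T W (S u) i (S (u @ [i]))"
    using sig by (simp add: is_signature_def)
  then show thesis unfolding has_stratonovich_integral_def using that by blast
qed

text \<open>
  The Ito part costs \<open>1 / \<alpha>\<close>, a time integral \<open>T / \<alpha>\<close>, and the bracket \<open>T / (\<rho> \<alpha>)\<close> because it comes from the
  level below \<open>u\<close>.  The condition on \<open>\<alpha>\<close> makes the total at most \<open>\<rho>\<close>, the weight of the new letter.
\<close>

lemma moments_step:
  assumes m: "weighted_moments \<rho> \<alpha> u" and m': "u \<noteq> [] \<Longrightarrow> weighted_moments \<rho> \<alpha> (butlast u)"
    and br: "bracket_formula u" and \<rho>: "0 < \<rho>" "\<rho> \<le> 1"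
    and \<alpha>: "0 < \<alpha>" "2 * (1 + T) / \<rho> + T / (2 * \<rho>\<^sup>2) \<le> \<alpha>"
  shows "weighted_moments \<rho> \<alpha> (u @ [i])"
  unfolding weighted_moments_def
proof
  fix t assume t: "t \<in> {0..T}"
  obtain J A where J: "case i of None \<Rightarrow> has_time_integral M F T (S u) J
       | Some j \<Rightarrow> has_ito_integral M F T (S u) (time_extension W (Some j)) J"
    and A: "has_quadratic_covariation M F T (S u) (time_extension W i) A"
    and eq: "AE \<omega> in M. \<forall>t\<in>{0..T}. S (u @ [i]) t \<omega> = J t \<omega> + A t \<omega> / 2"
    by (rule signature_stratonovich)
  let ?n = "length u"
  define E where "E = exp (\<alpha> * t)"
  have E: "E > 0" by (simp add: E_def)
  have c: "0 \<le> \<rho> ^ ?n" using \<rho> by simp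
  have "second_moment_le M (A t) (T * (\<rho> ^ ?n / \<rho> * E / \<alpha>))"
    using regular_part_bracket[OF br m' \<rho> \<alpha>(1) A] t unfolding regular_part_def E_def by blast
  then have A2: "second_moment_le M (\<lambda>\<omega>. 1 / 2 * A t \<omega>) ((1 / 2)\<^sup>2 * (T * (\<rho> ^ ?n / \<rho> * E / \<alpha>)))"
    by (rule second_moment_le_cmult)
  have J2: "second_moment_le M (J t) ((1 + T) * (\<rho> ^ ?n * E / \<alpha>))"
  proof (cases i)
    case None
    then have "regular_part (\<rho> ^ ?n) \<alpha> J"
      using regular_part_time_integral[OF m \<rho> \<alpha>(1)] J by simp
    then have "second_moment_le M (J t) (T * (\<rho> ^ ?n * E / \<alpha>))"
      using t unfolding regular_part_def E_def by blast
    then show ?thesis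
      by (rule second_moment_le_mono) (use c E \<alpha> in \<open>intro mult_right_mono, auto\<close>)
  next
    case (Some j)
    then have ito: "has_ito_integral M F T (S u) (time_extension W (Some j)) J" using J by simp
    have "second_moment_le M (J t) (\<rho> ^ ?n * E / \<alpha>)"
      unfolding E_def by (rule ito_second_moment[OF S_adapted \<alpha>(1) c weighted_momentsD[OF m] ito t])
    then show ?thesis
    proof (rule second_moment_le_mono)
      have "1 * (\<rho> ^ ?n * E / \<alpha>) \<le> (1 + T) * (\<rho> ^ ?n * E / \<alpha>)"
        using c E \<alpha> T_pos by (intro mult_right_mono) auto
      then show "\<rho> ^ ?n * E / \<alpha> \<le> (1 + T) * (\<rho> ^ ?n * E / \<alpha>)" by simp
    qed
  qed
  have "second_moment_le M (\<lambda>\<omega>. J t \<omega> + 1 / 2 * A t \<omega>)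
     (2 * ((1 + T) * (\<rho> ^ ?n * E / \<alpha>)) + 2 * ((1 / 2)\<^sup>2 * (T * (\<rho> ^ ?n / \<rho> * E / \<alpha>))))"
    by (rule second_moment_le_add[OF J2 A2])
  then have "second_moment_le M (\<lambda>\<omega>. J t \<omega> + 1 / 2 * A t \<omega>) (\<rho> ^ length (u @ [i]) * exp (\<alpha> * t))"
  proof (rule second_moment_le_mono)
    have "2 * ((1 + T) * (\<rho> ^ ?n * E / \<alpha>)) + 2 * ((1 / 2)\<^sup>2 * (T * (\<rho> ^ ?n / \<rho> * E / \<alpha>))) =
        \<rho> ^ ?n * \<rho> * E * ((2 * (1 + T) / \<rho> + T / (2 * \<rho>\<^sup>2)) / \<alpha>)"
      using \<rho> \<alpha> by (simp add: field_simps power2_eq_square)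
    also have "\<dots> \<le> \<rho> ^ ?n * \<rho> * E * 1"
      using \<rho> \<alpha> E c by (intro mult_left_mono) (auto simp: divide_le_eq)
    finally show "2 * ((1 + T) * (\<rho> ^ ?n * E / \<alpha>)) + 2 * ((1 / 2)\<^sup>2 * (T * (\<rho> ^ ?n / \<rho> * E / \<alpha>))) \<le>
        \<rho> ^ length (u @ [i]) * exp (\<alpha> * t)" by (simp add: E_def mult_ac)
  qed
  then show "second_moment_le M (S (u @ [i]) t) (\<rho> ^ length (u @ [i]) * exp (\<alpha> * t))"
    by (rule second_moment_le_cong_AE[OF _ S_measurable[OF t]])
      (use eq in eventually_elim, use t in simp)
qed

text \<open>
  The increments of \<open>S (u @ [i])\<close> have order \<open>b - a\<close> if \<open>i\<close> is the time letter, and then all brackets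
  vanish.  For \<open>i = Some j\<close> they have Brownian order with the first order term \<open>S u dW\<^sup>j\<close>, the Lipschitz
  moments of \<open>S u\<close> controlling the error, and the bracket formula is that of
  \<open>quadratic_covariation_brownian\<close>.
\<close>

lemma lipschitz_and_bracket_step:
  assumes m: "weighted_moments \<rho> \<alpha> u" and m': "u \<noteq> [] \<Longrightarrow> weighted_moments \<rho> \<alpha> (butlast u)"
    and br: "bracket_formula u" and lip: "lipschitz_moments u"
    and \<rho>: "0 < \<rho>" "\<rho> \<le> 1" and \<alpha>: "0 < \<alpha>"
  shows "lipschitz_moments (u @ [i]) \<and> bracket_formula (u @ [i])"
proof -
  let ?v = "u @ [i]"
  obtain J A where J: "case i of None \<Rightarrow> has_time_integral M F T (S u) J
       | Some j \<Rightarrow> has_ito_integral M F T (S u) (time_extension W (Some j)) J"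
    and A: "has_quadratic_covariation M F T (S u) (time_extension W i) A"
    and eq: "AE \<omega> in M. \<forall>t\<in>{0..T}. S ?v t \<omega> = J t \<omega> + A t \<omega> / 2"
    by (rule signature_stratonovich)
  have sq_le: "(b - a)\<^sup>2 \<le> T * (b - a)" if "0 \<le> a" "a < b" "b \<le> T" for a b
    unfolding power2_eq_square using that by (intro mult_right_mono) auto
  obtain K1 where K1: "K1 \<ge> 0" and A2: "\<And>a b. 0 \<le> a \<Longrightarrow> a < b \<Longrightarrow> b \<le> T \<Longrightarrow>
      second_moment_le M (\<lambda>\<omega>. A b \<omega> - A a \<omega>) (K1 * (b - a)\<^sup>2)"
    using regular_part_bracket[OF br m' \<rho> \<alpha> A] unfolding regular_part_def by blast
  have A2': "second_moment_le M (\<lambda>\<omega>. 1 / 2 * (A b \<omega> - A a \<omega>)) (K1 * (b - a)\<^sup>2)"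
    if "0 \<le> a" "a < b" "b \<le> T" for a b
    by (rule second_moment_le_mono[OF second_moment_le_cmult[OF A2[OF that]]])
      (use K1 in \<open>simp add: power2_eq_square\<close>)
  have meas: "(\<lambda>\<omega>. S w b \<omega> - S w a \<omega>) \<in> borel_measurable M" if "0 \<le> a" "a < b" "b \<le> T" for a b w
    using that by (intro borel_measurable_diff S_measurable) auto
  have incr_eq: "AE \<omega> in M. S ?v b \<omega> - S ?v a \<omega> = (J b \<omega> - J a \<omega>) + 1 / 2 * (A b \<omega> - A a \<omega>)"
    if "0 \<le> a" "a < b" "b \<le> T" for a b
    using eq by eventually_elim (use that in \<open>simp add: field_simps\<close>)
  have incr_lip: "lipschitz_moments ?v"
    if "L \<ge> 0" "\<And>a b. 0 \<le> a \<Longrightarrow> a < b \<Longrightarrow> b \<le> T \<Longrightarrow> second_moment_le M (\<lambda>\<omega>. J b \<omega> - J a \<omega>) (L * (b - a))" for L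
    unfolding lipschitz_moments_def
  proof (intro exI[of _ "2 * L + 2 * (K1 * T)"] conjI allI impI)
    fix a b assume ab: "0 \<le> a \<and> a < b \<and> b \<le> T"
    then have ab': "0 \<le> a" "a < b" "b \<le> T" by auto
    have "second_moment_le M (\<lambda>\<omega>. S ?v b \<omega> - S ?v a \<omega>) (2 * (L * (b - a)) + 2 * (K1 * (b - a)\<^sup>2))"
      by (rule second_moment_le_cong_AE[OF second_moment_le_add[OF that(2)[OF ab'] A2'[OF ab']] meas[OF ab'] incr_eq[OF ab']])
    then show "second_moment_le M (\<lambda>\<omega>. S ?v b \<omega> - S ?v a \<omega>) ((2 * L + 2 * (K1 * T)) * (b - a))"
    proof (rule second_moment_le_mono)
      have "K1 * (b - a)\<^sup>2 \<le> K1 * (T * (b - a))" by (rule mult_left_mono[OF sq_le[OF ab'] K1])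
      then show "2 * (L * (b - a)) + 2 * (K1 * (b - a)\<^sup>2) \<le> (2 * L + 2 * (K1 * T)) * (b - a)"
        by (simp add: algebra_simps)
    qed
  qed (use that(1) K1 T_pos in simp)
  note te = time_extension_increment
  show ?thesis
  proof (cases i)
    case None
    then have "regular_part (\<rho> ^ length u) \<alpha> J"
      using regular_part_time_integral[OF m \<rho> \<alpha>] J by simp
    then obtain K2 where K2: "K2 \<ge> 0" and J2: "\<And>a b. 0 \<le> a \<Longrightarrow> a < b \<Longrightarrow> b \<le> T \<Longrightarrow>
      second_moment_le M (\<lambda>\<omega>. J b \<omega> - J a \<omega>) (K2 * (b - a)\<^sup>2)"
      unfolding regular_part_def by blast
    have "lipschitz_moments ?v"
    proof (rule incr_lip)
      fix a b assume ab: "0 \<le> a" "a < b" "b \<le> T"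
      have "K2 * (b - a)\<^sup>2 \<le> K2 * T * (b - a)"
        using mult_left_mono[OF sq_le[OF ab] K2] by (simp add: mult_ac)
      then show "second_moment_le M (\<lambda>\<omega>. J b \<omega> - J a \<omega>) (K2 * T * (b - a))"
        by (rule second_moment_le_mono[OF J2[OF ab]])
    qed (use K2 T_pos in simp)
    moreover have "bracket_formula ?v"
      unfolding bracket_formula_def
    proof (intro allI impI)
      fix k B assume B: "has_quadratic_covariation M F T (S ?v) (time_extension W k) B"
      have "AE \<omega> in M. \<forall>t\<in>{0..T}. B t \<omega> = 0"
      proof (rule quadratic_covariation_zero[OF disjI1[OF B] S_measurable time_extension_measurable _ te])
        fix a b assume ab: "0 \<le> a" "a < b" "b \<le> T"
        have "second_moment_le M (\<lambda>\<omega>. S ?v b \<omega> - S ?v a \<omega>) (2 * (K2 * (b - a)\<^sup>2) + 2 * (K1 * (b - a)\<^sup>2))"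
          by (rule second_moment_le_cong_AE[OF second_moment_le_add[OF J2[OF ab] A2'[OF ab]] meas[OF ab] incr_eq[OF ab]])
        then show "second_moment_le M (\<lambda>\<omega>. S ?v b \<omega> - S ?v a \<omega>) ((2 * K2 + 2 * K1) * (b - a)\<^sup>2)"
          by (simp add: algebra_simps)
      qed
      moreover have "bracket ?v k t \<omega> = 0" for t \<omega> using None by (auto simp: bracket_def)
      ultimately show "AE \<omega> in M. \<forall>t\<in>{0..T}. B t \<omega> = bracket ?v k t \<omega>" by simp
    qed
    ultimately show ?thesis ..
  next
    case (Some j)
    then have ito: "has_ito_integral M F T (S u) (time_extension W (Some j)) J" using J by simp
    have Su2: "integrable M (\<lambda>\<omega>. (S u s \<omega>)\<^sup>2)" if "s \<in> {0..T}" for s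
      by (rule second_moment_leD(2)[OF weighted_momentsD[OF m that]])
    obtain K where K: "K \<ge> 0" and Su_lip: "\<And>a b. 0 \<le> a \<Longrightarrow> a < b \<Longrightarrow> b \<le> T \<Longrightarrow>
      second_moment_le M (\<lambda>\<omega>. S u b \<omega> - S u a \<omega>) (K * (b - a))"
      using lip unfolding lipschitz_moments_def by blast
    have lip_v: "lipschitz_moments ?v"
    proof (rule incr_lip)
      fix a b assume ab: "0 \<le> a" "a < b" "b \<le> T"
      have "second_moment_le M (\<lambda>\<omega>. J b \<omega> - J a \<omega> - 0 * dW j a b \<omega>) (exp (\<alpha> * T) * (b - a))"
      proof (rule ito_increment_second_moment[OF S_adapted Su2 ito])
        fix s assume "a \<le> s" "s \<le> b"
        then show "second_moment_le M (\<lambda>\<omega>. S u s \<omega> - 0) (exp (\<alpha> * T))"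
          using weighted_moments_const[OF m \<rho> \<alpha>, of s] ab by simp
      qed (use ab in auto)
      then show "second_moment_le M (\<lambda>\<omega>. J b \<omega> - J a \<omega>) (exp (\<alpha> * T) * (b - a))" by simp
    qed simp
    moreover have "bracket_formula ?v"
      unfolding bracket_formula_def
    proof (intro allI impI)
      fix k B assume B: "has_quadratic_covariation M F T (S ?v) (time_extension W k) B"
      show "AE \<omega> in M. \<forall>t\<in>{0..T}. B t \<omega> = bracket ?v k t \<omega>"
      proof (cases k)
        case None
        obtain L where L: "\<And>a b. 0 \<le> a \<Longrightarrow> a < b \<Longrightarrow> b \<le> T \<Longrightarrow>
          second_moment_le M (\<lambda>\<omega>. S ?v b \<omega> - S ?v a \<omega>) (L * (b - a))"
          using lip_v unfolding lipschitz_moments_def by blast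
        have "AE \<omega> in M. \<forall>t\<in>{0..T}. B t \<omega> = 0"
        proof (rule quadratic_covariation_zero[OF disjI2[OF B] time_extension_measurable S_measurable _ L])
          fix a b :: real assume ab: "0 \<le> a" "a < b" "b \<le> T"
          show "second_moment_le M (\<lambda>\<omega>. time_extension W k b \<omega> - time_extension W k a \<omega>) (1 * (b - a)\<^sup>2)"
            using None by (simp add: time_extension_def second_moment_le_def prob_space)
        qed
        then show ?thesis using None by (simp add: bracket_def)
      next
        case k: (Some l)
        have "AE \<omega> in M. \<forall>t\<in>{0..T}. B t \<omega> = of_bool (j = l) * (LINT s:{0..t}|lborel. S u s \<omega>)"
        proof (rule quadratic_covariation_brownian[where j = j, OF B[unfolded k] S_measurable S_adapted weighted_moments_const[OF m \<rho> \<alpha>]])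
          fix a b assume ab: "0 \<le> a" "a < b" "b \<le> T"
          have aT: "a \<in> {0..T}" "b \<in> {0..T}" using ab by auto
          have J2: "second_moment_le M (\<lambda>\<omega>. J b \<omega> - J a \<omega> - S u a \<omega> * dW j a b \<omega>) (K * (b - a) * (b - a))"
          proof (rule ito_increment_second_moment[OF S_adapted Su2 ito ab(1) less_imp_le[OF ab(2)] ab(3) adapted_measurable[OF S_adapted aT(1)]])
            fix s assume s: "a \<le> s" "s \<le> b"
            show "second_moment_le M (\<lambda>\<omega>. S u s \<omega> - S u a \<omega>) (K * (b - a))"
            proof (cases "s = a")
              case True
              then show ?thesis using K ab second_moment_le_zero[of "K * (b - a)" M] by simp
            next
              case False
              then have "a < s" "s \<le> T" using s ab by auto
              from Su_lip[OF ab(1) this] show ?thesis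
                by (rule second_moment_le_mono) (use s K in \<open>intro mult_left_mono, auto\<close>)
            qed
          qed
          have "second_moment_le M (\<lambda>\<omega>. S ?v b \<omega> - S ?v a \<omega> - S u a \<omega> * dW j a b \<omega>)
              (2 * (K * (b - a) * (b - a)) + 2 * (K1 * (b - a)\<^sup>2))"
          proof (rule second_moment_le_cong_AE[OF second_moment_le_add[OF J2 A2'[OF ab]]])
            show "(\<lambda>\<omega>. S ?v b \<omega> - S ?v a \<omega> - S u a \<omega> * dW j a b \<omega>) \<in> borel_measurable M"
              using ab aT by (intro borel_measurable_diff borel_measurable_times S_measurable W_component_measurable_M) auto
            show "AE \<omega> in M. S ?v b \<omega> - S ?v a \<omega> - S u a \<omega> * dW j a b \<omega> =
                J b \<omega> - J a \<omega> - S u a \<omega> * dW j a b \<omega> + 1 / 2 * (A b \<omega> - A a \<omega>)"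
              using incr_eq[OF ab] by eventually_elim simp
          qed
          then show "second_moment_le M (\<lambda>\<omega>. S ?v b \<omega> - S ?v a \<omega> - S u a \<omega> * dW j a b \<omega>) ((2 * K + 2 * K1) * (b - a)\<^sup>2)"
            by (simp add: algebra_simps power2_eq_square)
        qed
        then show ?thesis using k Some by (auto simp: bracket_def)
      qed
    qed
    ultimately show ?thesis ..
  qed
qed

lemma empty_word_properties:
  assumes "0 < \<alpha>"
  shows "weighted_moments \<rho> \<alpha> [] \<and> lipschitz_moments [] \<and> bracket_formula []"
proof -
  have one: "AE \<omega> in M. S [] t \<omega> = 1" if "t \<in> {0..T}" for t
    using S_Nil by eventually_elim (use that in blast)
  have incr: "second_moment_le M (\<lambda>\<omega>. S [] b \<omega> - S [] a \<omega>) 0" if ab: "0 \<le> a" "a < b" "b \<le> T" for a b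
  proof (rule second_moment_le_cong_AE[OF second_moment_le_zero])
    show "AE \<omega> in M. S [] b \<omega> - S [] a \<omega> = 0"
      using S_Nil by eventually_elim (use ab in simp)
  qed (use ab in \<open>auto intro!: borel_measurable_diff S_measurable\<close>)
  have "weighted_moments \<rho> \<alpha> []"
    unfolding weighted_moments_def
  proof
    fix t assume t: "t \<in> {0..T}"
    have "second_moment_le M (\<lambda>_. 1) (\<rho> ^ length [] * exp (\<alpha> * t))"
      using assms t by (simp add: second_moment_le_def prob_space)
    then show "second_moment_le M (S [] t) (\<rho> ^ length [] * exp (\<alpha> * t))"
      by (rule second_moment_le_cong_AE[OF _ S_measurable[OF t] one[OF t]])
  qed
  moreover have "lipschitz_moments []"
    unfolding lipschitz_moments_def by (intro exI[of _ 0]) (use incr in simp)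
  moreover have "bracket_formula []"
    unfolding bracket_formula_def
  proof (intro allI impI)
    fix k B assume B: "has_quadratic_covariation M F T (S []) (time_extension W k) B"
    have "AE \<omega> in M. \<forall>t\<in>{0..T}. B t \<omega> = 0"
    proof (rule quadratic_covariation_zero[OF disjI1[OF B] S_measurable time_extension_measurable _ time_extension_increment])
      show "second_moment_le M (\<lambda>\<omega>. S [] b \<omega> - S [] a \<omega>) (0 * (b - a)\<^sup>2)" if "0 \<le> a" "a < b" "b \<le> T" for a b
        using incr[OF that] by simp
    qed
    then show "AE \<omega> in M. \<forall>t\<in>{0..T}. B t \<omega> = bracket [] k t \<omega>" by (simp add: bracket_def)
  qed
  ultimately show ?thesis by simp
qed

lemma signature_moments:
  assumes \<rho>: "0 < \<rho>" "\<rho> \<le> 1" and \<alpha>: "0 < \<alpha>" "2 * (1 + T) / \<rho> + T / (2 * \<rho>\<^sup>2) \<le> \<alpha>"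
  shows "weighted_moments \<rho> \<alpha> v \<and> lipschitz_moments v \<and> bracket_formula v"
proof (induction v rule: length_induct)
  case (1 v)
  show ?case
  proof (cases v rule: rev_cases)
    case Nil
    then show ?thesis using empty_word_properties[OF \<alpha>(1)] by simp
  next
    case (snoc u i)
    then have u: "weighted_moments \<rho> \<alpha> u" "lipschitz_moments u" "bracket_formula u" using 1 by auto
    have u': "weighted_moments \<rho> \<alpha> (butlast u)" if "u \<noteq> []" using 1 snoc that by auto
    show ?thesis
      using moments_step[OF u(1) u' u(3) \<rho> \<alpha>] lipschitz_and_bracket_step[OF u(1) u' u(3) u(2) \<rho> \<alpha>(1)]
      unfolding snoc by blast
  qed
qed

end

context brownian
begin

text \<open>
  A bound that is uniform over finite sets of times extends to the supremum of a continuous process: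
  exhaust a countable dense set of times by finite ones.
\<close>

lemma supremum_event:
  assumes X: "\<And>t. t \<in> {0..T} \<Longrightarrow> X t \<in> borel_measurable M" "AE \<omega> in M. continuous_on {0..T} (\<lambda>t. X t \<omega> :: real)"
    and le: "\<And>R. finite R \<Longrightarrow> R \<subseteq> {0..T} \<Longrightarrow> prob {\<omega>\<in>space M. \<exists>r\<in>R. x \<le> \<bar>X r \<omega>\<bar>} \<le> b"
  obtains E where "E \<in> sets M" "prob E \<le> b" "AE \<omega> in M. \<omega> \<notin> E \<longrightarrow> (\<forall>t\<in>{0..T}. \<bar>X t \<omega>\<bar> \<le> x)"
proof -
  obtain D where D: "countable D" "D \<subseteq> {0<..<T}" "closure D = {0..T}"
    by (rule dense_countable_times[OF T_pos])
  have "D \<noteq> {}" using D(3) T_pos by auto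
  then have range: "range (from_nat_into D) = D" using D(1) by (rule range_from_nat_into)
  have mem: "from_nat_into D k \<in> {0..T}" for k
  proof -
    have "from_nat_into D k \<in> D" using range by blast
    then show ?thesis using D(2) by auto
  qed
  let ?E = "\<lambda>N. {\<omega>\<in>space M. \<exists>r\<in>from_nat_into D ` {..<N}. x \<le> \<bar>X r \<omega>\<bar>}"
  have E_sets: "?E N \<in> sets M" for N
  proof -
    have "?E N = (\<Union>k\<in>{..<N}. {\<omega>\<in>space M. x \<le> \<bar>X (from_nat_into D k) \<omega>\<bar>})" by auto
    also have "\<dots> \<in> sets M"
    proof (rule sets.finite_UN)
      fix k
      have [measurable]: "X (from_nat_into D k) \<in> borel_measurable M" by (rule X(1)[OF mem])
      show "{\<omega>\<in>space M. x \<le> \<bar>X (from_nat_into D k) \<omega>\<bar>} \<in> sets M" by measurable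
    qed simp
    finally show ?thesis .
  qed
  have "incseq ?E" by (rule incseq_SucI) auto
  then have "(\<lambda>N. prob (?E N)) \<longlonglongrightarrow> prob (\<Union>N. ?E N)"
    using E_sets by (intro finite_Lim_measure_incseq) auto
  moreover have "prob (?E N) \<le> b" for N by (rule le) (use mem in auto)
  ultimately have "prob (\<Union>N. ?E N) \<le> b" by (intro LIMSEQ_le_const2[where a = b]) auto
  moreover have "(\<Union>N. ?E N) \<in> sets M" by (rule sets.countable_UN) (use E_sets in blast)
  moreover have "AE \<omega> in M. \<omega> \<notin> (\<Union>N. ?E N) \<longrightarrow> (\<forall>t\<in>{0..T}. \<bar>X t \<omega>\<bar> \<le> x)"
    using X(2) AE_space
  proof eventually_elim
    case (elim \<omega>)
    show ?case
    proof (intro impI ballI)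
      fix t assume \<omega>: "\<omega> \<notin> (\<Union>N. ?E N)" and t: "t \<in> {0..T}"
      have D_le: "\<bar>X d \<omega>\<bar> \<le> x" if d: "d \<in> D" for d
      proof -
        obtain k where k: "d = from_nat_into D k" using range d by blast
        have "\<omega> \<notin> ?E (Suc k)" using \<omega> by blast
        then show ?thesis using k elim(2) by (auto simp: not_le intro: less_imp_le)
      qed
      have "continuous_on (closure D) (\<lambda>t. \<bar>X t \<omega>\<bar>)"
        unfolding D(3) by (intro continuous_intros elim(1))
      then show "\<bar>X t \<omega>\<bar> \<le> x"
        by (rule continuous_le_on_closure) (use t D(3) D_le in auto)
    qed
  qed
  ultimately show thesis by (intro that)
qed

end

context signature
begin

text \<open>
  If \<open>|J + A / 2| \<ge> x\<close> then \<open>|J| \<ge> x / 2\<close> or \<open>|A| \<ge> x\<close>.  The Ito part is controlled by the maximal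
  inequality, the other parts by their dominating variables.
\<close>

lemma signature_maximal_inequality:
  assumes \<rho>: "0 < \<rho>" "\<rho> \<le> 1" and \<alpha>: "0 < \<alpha>" "2 * (1 + T) / \<rho> + T / (2 * \<rho>\<^sup>2) \<le> \<alpha>"
    and R: "finite R" "R \<subseteq> {0..T}" and x: "x > 0"
  shows "prob {\<omega>\<in>space M. \<exists>r\<in>R. x \<le> \<bar>S (u @ [i]) r \<omega>\<bar>} \<le>
    (16 * (1 + T) + T / \<rho>) * exp (\<alpha> * T) / \<alpha> * \<rho> ^ length u / x\<^sup>2"
proof -
  note props = signature_moments[OF \<rho> \<alpha>]
  have m: "weighted_moments \<rho> \<alpha> w" and br: "bracket_formula w" for w using props[of w] by auto
  obtain J A where J: "case i of None \<Rightarrow> has_time_integral M F T (S u) J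
       | Some j \<Rightarrow> has_ito_integral M F T (S u) (time_extension W (Some j)) J"
    and A: "has_quadratic_covariation M F T (S u) (time_extension W i) A"
    and eq: "AE \<omega> in M. \<forall>t\<in>{0..T}. S (u @ [i]) t \<omega> = J t \<omega> + A t \<omega> / 2"
    by (rule signature_stratonovich)
  define Q where "Q = \<rho> ^ length u * exp (\<alpha> * T) / \<alpha>"
  have Q: "Q \<ge> 0" using \<rho> \<alpha> by (simp add: Q_def)
  have c: "0 \<le> \<rho> ^ length u" using \<rho> by simp
  have "regular_part (\<rho> ^ length u / \<rho>) \<alpha> A" by (rule regular_part_bracket[OF br m \<rho> \<alpha>(1) A])
  then obtain V where V: "second_moment_le M V (T * (\<rho> ^ length u / \<rho> * exp (\<alpha> * T) / \<alpha>))"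
    "AE \<omega> in M. \<forall>t\<in>{0..T}. \<bar>A t \<omega>\<bar> \<le> \<bar>V \<omega>\<bar>"
    unfolding regular_part_def by blast
  have V': "prob {\<omega>\<in>space M. x \<le> \<bar>V \<omega>\<bar>} \<le> T / \<rho> * Q / x\<^sup>2"
    using second_moment_le_Chebyshev[OF V(1) x] by (simp add: Q_def mult_ac)
  have VM: "{\<omega>\<in>space M. x \<le> \<bar>V \<omega>\<bar>} \<in> sets M"
    using second_moment_leD(1)[OF V(1)] by measurable
  \<comment> \<open>an event that contains the large values of \<open>J\<close>\<close>
  obtain B where B: "B \<in> sets M" "prob B \<le> 16 * (1 + T) * Q / x\<^sup>2"
    "AE \<omega> in M. (\<exists>r\<in>R. x / 2 \<le> \<bar>J r \<omega>\<bar>) \<longrightarrow> \<omega> \<in> B"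
  proof (cases i)
    case None
    then have "regular_part (\<rho> ^ length u) \<alpha> J"
      using regular_part_time_integral[OF m \<rho> \<alpha>(1)] J by simp
    then obtain V' where V': "second_moment_le M V' (T * (\<rho> ^ length u * exp (\<alpha> * T) / \<alpha>))"
      "AE \<omega> in M. \<forall>t\<in>{0..T}. \<bar>J t \<omega>\<bar> \<le> \<bar>V' \<omega>\<bar>"
      unfolding regular_part_def by blast
    show thesis
    proof (rule that[of "{\<omega>\<in>space M. x / 2 \<le> \<bar>V' \<omega>\<bar>}"])
      show "{\<omega>\<in>space M. x / 2 \<le> \<bar>V' \<omega>\<bar>} \<in> sets M"
        using second_moment_leD(1)[OF V'(1)] by measurable
      have "prob {\<omega>\<in>space M. x / 2 \<le> \<bar>V' \<omega>\<bar>} \<le> T * Q / (x / 2)\<^sup>2"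
        using second_moment_le_Chebyshev[OF V'(1), of "x / 2"] x by (simp add: Q_def)
      also have "\<dots> = 4 * T * Q / x\<^sup>2" by (simp add: power_divide)
      also have "\<dots> \<le> 16 * (1 + T) * Q / x\<^sup>2"
        using Q T_pos by (intro divide_right_mono mult_right_mono) auto
      finally show "prob {\<omega>\<in>space M. x / 2 \<le> \<bar>V' \<omega>\<bar>} \<le> 16 * (1 + T) * Q / x\<^sup>2" .
      show "AE \<omega> in M. (\<exists>r\<in>R. x / 2 \<le> \<bar>J r \<omega>\<bar>) \<longrightarrow> \<omega> \<in> {\<omega>\<in>space M. x / 2 \<le> \<bar>V' \<omega>\<bar>}"
        using V'(2) AE_space
      proof eventually_elim
        case (elim \<omega>)
        have "x / 2 \<le> \<bar>V' \<omega>\<bar>" if "r \<in> R" "x / 2 \<le> \<bar>J r \<omega>\<bar>" for r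
          using order_trans[OF that(2) bspec[OF elim(1)]] that(1) R(2) by blast
        then show ?case using elim(2) by blast
      qed
    qed
  next
    case (Some j)
    then have ito: "has_ito_integral M F T (S u) (time_extension W (Some j)) J" using J by simp
    then have JA: "continuous_adapted M F T J" by (simp add: has_ito_integral_def)
    let ?B = "{\<omega>\<in>space M. \<exists>r\<in>R. x / 2 \<le> \<bar>J r \<omega>\<bar>}"
    show thesis
    proof (rule that[of ?B])
      have "?B = (\<Union>r\<in>R. {\<omega>\<in>space M. x / 2 \<le> \<bar>J r \<omega>\<bar>})" by auto
      also have "\<dots> \<in> sets M"
      proof (rule sets.finite_UN[OF R(1)])
        fix r assume "r \<in> R"
        then have [measurable]: "J r \<in> borel_measurable M" using adapted_measurable_M[OF JA] R(2) by blast
        show "{\<omega>\<in>space M. x / 2 \<le> \<bar>J r \<omega>\<bar>} \<in> sets M" by measurable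
      qed
      finally show "?B \<in> sets M" .
      have "prob ?B \<le> 4 * (\<rho> ^ length u * exp (\<alpha> * T) / \<alpha>) / (x / 2)\<^sup>2"
        by (rule ito_maximal_inequality[OF S_adapted \<alpha>(1) c weighted_momentsD[OF m] ito R]) (use x in auto)
      also have "\<dots> = 16 * 1 * Q / x\<^sup>2" by (simp add: Q_def power_divide)
      also have "\<dots> \<le> 16 * (1 + T) * Q / x\<^sup>2"
        using Q T_pos by (intro divide_right_mono mult_right_mono mult_left_mono) auto
      finally show "prob ?B \<le> 16 * (1 + T) * Q / x\<^sup>2" .
      show "AE \<omega> in M. (\<exists>r\<in>R. x / 2 \<le> \<bar>J r \<omega>\<bar>) \<longrightarrow> \<omega> \<in> ?B"
        using AE_space by eventually_elim simp
    qed
  qed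
  have "prob {\<omega>\<in>space M. \<exists>r\<in>R. x \<le> \<bar>S (u @ [i]) r \<omega>\<bar>} \<le> prob (B \<union> {\<omega>\<in>space M. x \<le> \<bar>V \<omega>\<bar>})"
  proof (rule finite_measure_mono_AE)
    show "AE \<omega> in M. \<omega> \<in> {\<omega>\<in>space M. \<exists>r\<in>R. x \<le> \<bar>S (u @ [i]) r \<omega>\<bar>} \<longrightarrow> \<omega> \<in> B \<union> {\<omega>\<in>space M. x \<le> \<bar>V \<omega>\<bar>}"
      using eq V(2) B(3)
    proof eventually_elim
      case (elim \<omega>)
      show ?case
      proof
        assume "\<omega> \<in> {\<omega>\<in>space M. \<exists>r\<in>R. x \<le> \<bar>S (u @ [i]) r \<omega>\<bar>}"
        then obtain r where r: "\<omega> \<in> space M" "r \<in> R" "x \<le> \<bar>S (u @ [i]) r \<omega>\<bar>" by auto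
        then have rT: "r \<in> {0..T}" using R by auto
        have "x / 2 \<le> \<bar>J r \<omega>\<bar> \<or> x \<le> \<bar>A r \<omega>\<bar>"
          using r(3) bspec[OF elim(1) rT] by (simp add: field_simps) linarith
        then show "\<omega> \<in> B \<union> {\<omega>\<in>space M. x \<le> \<bar>V \<omega>\<bar>}"
        proof
          assume "x / 2 \<le> \<bar>J r \<omega>\<bar>"
          then show ?thesis using elim(3) r(2) by blast
        next
          assume "x \<le> \<bar>A r \<omega>\<bar>"
          then have "x \<le> \<bar>V \<omega>\<bar>" using bspec[OF elim(2) rT] by linarith
          then show ?thesis using r(1) by simp
        qed
      qed
    qed
  qed (intro sets.Un B VM)
  also have "\<dots> \<le> prob B + prob {\<omega>\<in>space M. x \<le> \<bar>V \<omega>\<bar>}" by (rule measure_Un_le[OF B(1) VM])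
  also have "\<dots> \<le> 16 * (1 + T) * Q / x\<^sup>2 + T / \<rho> * Q / x\<^sup>2" by (rule add_mono[OF B(2) V'])
  also have "\<dots> = (16 * (1 + T) + T / \<rho>) * Q / x\<^sup>2"
    by (simp only: add_divide_distrib distrib_right)
  also have "\<dots> = (16 * (1 + T) + T / \<rho>) * exp (\<alpha> * T) / \<alpha> * \<rho> ^ length u / x\<^sup>2"
    by (simp add: Q_def mult_ac)
  finally show ?thesis .
qed

section \<open>Geometric decay of the signature\<close>

text \<open>
  There are \<open>q\<^sup>n\<close> words of length \<open>n\<close>, each exceeding \<open>y\<^sup>n\<close> with probability of order \<open>(\<rho> / y\<^sup>2)\<^sup>n\<close>.  With
  \<open>\<rho> = y\<^sup>2 / (2 q)\<close> these probabilities sum to a geometric series of ratio \<open>1 / 2\<close>, and the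
  Borel--Cantelli lemma applies.
\<close>

lemma signature_eventually_small:
  fixes y :: real
  assumes y: "0 < y" "y \<le> 1"
  shows "AE \<omega> in M. eventually (\<lambda>n. \<forall>v\<in>words (Suc n). \<forall>t\<in>{0..T}. \<bar>S v t \<omega>\<bar> \<le> y ^ Suc n) sequentially"
proof -
  define q where "q = real (CARD('n) + 1)"
  have q: "q \<ge> 1" by (simp add: q_def)
  define \<rho> where "\<rho> = y\<^sup>2 / (2 * q)"
  have \<rho>: "0 < \<rho>" "\<rho> \<le> 1"
  proof -
    show "0 < \<rho>" using y q by (simp add: \<rho>_def)
    have "y\<^sup>2 \<le> 1" using y by (simp add: power_le_one)
    then show "\<rho> \<le> 1" using q by (simp add: \<rho>_def divide_le_eq)
  qed
  define \<alpha> where "\<alpha> = 2 * (1 + T) / \<rho> + T / (2 * \<rho>\<^sup>2)"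
  have \<alpha>: "0 < \<alpha>" "2 * (1 + T) / \<rho> + T / (2 * \<rho>\<^sup>2) \<le> \<alpha>"
    using \<rho> T_pos by (auto simp: \<alpha>_def intro!: add_pos_pos)
  define c where "c = (16 * (1 + T) + T / \<rho>) * exp (\<alpha> * T) / \<alpha>"
  have c: "c \<ge> 0" using \<rho> \<alpha> T_pos by (simp add: c_def)
  have ex: "\<exists>E. E \<in> sets M \<and> prob E \<le> c * \<rho> ^ n / (y ^ Suc n)\<^sup>2 \<and>
      (AE \<omega> in M. \<omega> \<notin> E \<longrightarrow> (\<forall>t\<in>{0..T}. \<bar>S v t \<omega>\<bar> \<le> y ^ Suc n))" if v: "v \<in> words (Suc n)" for v n
  proof -
    obtain u i where ui: "v = u @ [i]" "length u = n"
      using v by (cases v rule: rev_cases) (auto simp: words_def)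
    have x: "0 < y ^ Suc n" using y by simp
    have le: "prob {\<omega>\<in>space M. \<exists>r\<in>R. y ^ Suc n \<le> \<bar>S v r \<omega>\<bar>} \<le> c * \<rho> ^ n / (y ^ Suc n)\<^sup>2"
      if "finite R" "R \<subseteq> {0..T}" for R
      using signature_maximal_inequality[OF \<rho> \<alpha> that x, of u i] unfolding ui(2) ui(1)[symmetric] c_def .
    show ?thesis
      using supremum_event[OF S_measurable S_continuous le] by blast
  qed
  define E where "E n v = (SOME E. E \<in> sets M \<and> prob E \<le> c * \<rho> ^ n / (y ^ Suc n)\<^sup>2 \<and>
      (AE \<omega> in M. \<omega> \<notin> E \<longrightarrow> (\<forall>t\<in>{0..T}. \<bar>S v t \<omega>\<bar> \<le> y ^ Suc n)))" for n v
  have E: "E n v \<in> sets M" "prob (E n v) \<le> c * \<rho> ^ n / (y ^ Suc n)\<^sup>2"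
    "AE \<omega> in M. \<omega> \<notin> E n v \<longrightarrow> (\<forall>t\<in>{0..T}. \<bar>S v t \<omega>\<bar> \<le> y ^ Suc n)"
    if "v \<in> words (Suc n)" for v n
    using someI_ex[OF ex[OF that]] unfolding E_def by blast+
  define B where "B n = (\<Union>v\<in>words (Suc n). E n v)" for n
  have B_sets: "B n \<in> sets M" for n
    unfolding B_def by (rule sets.finite_UN[OF finite_words E(1)])
  have B_le: "prob (B n) \<le> c * q / y\<^sup>2 * (1 / 2) ^ n" for n
  proof -
    have "prob (B n) \<le> (\<Sum>v\<in>words (Suc n). prob (E n v))"
      unfolding B_def by (rule finite_measure_subadditive_finite[OF finite_words]) (use E(1) in blast)
    also have "\<dots> \<le> (\<Sum>v\<in>(words (Suc n) :: 'n word set). c * \<rho> ^ n / (y ^ Suc n)\<^sup>2)"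
      by (intro sum_mono E(2))
    also have "\<dots> = q ^ Suc n * (c * \<rho> ^ n / (y ^ Suc n)\<^sup>2)"
      by (simp only: sum_constant card_words q_def of_nat_power)
    also have "\<dots> = c * q / y\<^sup>2 * (q * \<rho> / y\<^sup>2) ^ n"
      by (simp add: power_mult_distrib power_divide power2_eq_square mult_ac)
    also have "q * \<rho> / y\<^sup>2 = 1 / 2" using q y by (simp add: \<rho>_def)
    finally show ?thesis .
  qed
  have "summable (\<lambda>n. prob (B n))"
  proof (rule summable_comparison_test')
    show "summable (\<lambda>n. c * q / y\<^sup>2 * (1 / 2) ^ n :: real)"
      by (intro summable_mult summable_geometric) simp
    show "norm (prob (B n)) \<le> c * q / y\<^sup>2 * (1 / 2) ^ n" if "n \<ge> 0" for n using B_le[of n] by simp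
  qed
  then have "AE \<omega> in M. eventually (\<lambda>n. \<omega> \<in> space M - B n) sequentially"
    by (intro borel_cantelli_AE1 B_sets) (simp_all add: emeasure_eq_measure)
  moreover have "AE \<omega> in M. \<forall>n. \<forall>v\<in>words (Suc n). \<omega> \<notin> E n v \<longrightarrow> (\<forall>t\<in>{0..T}. \<bar>S v t \<omega>\<bar> \<le> y ^ Suc n)"
    using E(3) finite_words by (simp add: AE_all_countable AE_ball_countable countable_finite)
  ultimately show ?thesis
  proof eventually_elim
    case (elim \<omega>)
    from elim(1) show ?case
      by (rule eventually_mono) (use elim(2) in \<open>auto simp: B_def\<close>)
  qed
qed

text \<open>
  The finitely many levels that are not yet small are bounded because their paths are continuous.
\<close>

lemma signature_geometric_bound:
  assumes C: "C \<ge> 0"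
  shows "AE \<omega> in M. \<exists>B\<ge>0. \<forall>t\<in>{0..T}. \<forall>n. C ^ n * (\<Sum>v\<in>words n. \<bar>S v t \<omega>\<bar>) \<le> B * (1 / 2) ^ n"
proof -
  define q where "q = real (CARD('n) + 1)"
  have q: "q \<ge> 1" by (simp add: q_def)
  \<comment> \<open>makes \<open>C q y \<le> 1 / 2\<close>, with \<open>C + 1\<close> covering \<open>C = 0\<close>\<close>
  define y where "y = 1 / (2 * q * (C + 1))"
  have qC: "1 \<le> 2 * q * (C + 1)"
  proof -
    have "1 * 1 \<le> q * (C + 1)" using q C by (intro mult_mono) auto
    then show ?thesis by simp
  qed
  then have y: "0 < y" "y \<le> 1" using q C by (simp_all add: y_def divide_le_eq)
  have qy: "C * q * y \<le> 1 / 2"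
  proof -
    have "C * q * y \<le> (C + 1) * q * y" using q y by (intro mult_right_mono) auto
    also have "\<dots> = y * (2 * q * (C + 1)) / 2" by simp
    also have "y * (2 * q * (C + 1)) = 1"
    proof -
      have "1 / z * z = 1" if "z \<noteq> 0" for z :: real using that by simp
      moreover have "2 * q * (C + 1) \<noteq> 0" using qC by linarith
      ultimately show ?thesis unfolding y_def by blast
    qed
    finally show ?thesis .
  qed
  have "AE \<omega> in M. \<forall>v. continuous_on {0..T} (\<lambda>t. S v t \<omega>)"
    using S_continuous by (simp add: AE_all_countable)
  then show ?thesis using signature_eventually_small[OF y]
  proof eventually_elim
    case (elim \<omega>)
    let ?f = "\<lambda>n t. C ^ n * (\<Sum>v\<in>words n. \<bar>S v t \<omega>\<bar>)"
    have "\<exists>b\<ge>0. \<forall>t\<in>{0..T}. ?f n t \<le> b" for n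
    proof -
      have "continuous_on {0..T} (?f n)" using elim(1) by (intro continuous_intros) auto
      then have "bounded (?f n ` {0..T})" by (intro compact_imp_bounded compact_continuous_image) auto
      then obtain b where b: "\<And>t. t \<in> {0..T} \<Longrightarrow> norm (?f n t) \<le> b" unfolding bounded_iff by blast
      have "?f n t \<le> max 0 b" if "t \<in> {0..T}" for t using b[OF that] by (simp add: le_max_iff_disj)
      then show ?thesis by (intro exI[of _ "max 0 b"]) auto
    qed
    then obtain b where b: "\<And>n. b n \<ge> 0" "\<And>n t. t \<in> {0..T} \<Longrightarrow> ?f n t \<le> b n" by metis
    obtain N where N: "\<And>n v t. n \<ge> N \<Longrightarrow> v \<in> words (Suc n) \<Longrightarrow> t \<in> {0..T} \<Longrightarrow> \<bar>S v t \<omega>\<bar> \<le> y ^ Suc n"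
      using elim(2) unfolding eventually_sequentially by blast
    define B where "B = 1 + (\<Sum>n\<le>N. b n * 2 ^ n)"
    have B1: "B \<ge> 1" using b(1) by (simp add: B_def sum_nonneg)
    have "?f n t \<le> B * (1 / 2) ^ n" if t: "t \<in> {0..T}" for n t
    proof (cases "n \<le> N")
      case True
      have "b n * 2 ^ n \<le> (\<Sum>n\<le>N. b n * 2 ^ n)"
        using True b(1) by (intro member_le_sum) auto
      then have "b n * 2 ^ n \<le> B" by (simp add: B_def)
      then have "b n \<le> B * (1 / 2) ^ n" by (simp add: power_one_over field_simps)
      then show ?thesis using b(2)[OF t, of n] by linarith
    next
      case False
      then obtain k where k: "n = Suc k" "k \<ge> N" by (cases n) auto
      have "(\<Sum>v\<in>words n. \<bar>S v t \<omega>\<bar>) \<le> (\<Sum>v\<in>(words n :: 'n word set). y ^ n)"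
        using N[OF k(2)] t k(1) by (intro sum_mono) auto
      also have "\<dots> = q ^ n * y ^ n" by (simp only: sum_constant card_words q_def of_nat_power)
      finally have "?f n t \<le> C ^ n * (q ^ n * y ^ n)" using C by (intro mult_left_mono) auto
      also have "\<dots> = (C * q * y) ^ n" by (simp add: power_mult_distrib)
      also have "\<dots> \<le> (1 / 2) ^ n" using qy C q y by (intro power_mono) auto
      also have "\<dots> \<le> B * (1 / 2) ^ n" using B1 by simp
      finally show ?thesis .
    qed
    then show ?case using B1 by (intro exI[of _ B]) auto
  qed
qed

lemma sig_norm_bounded:
  assumes l: "l \<in> A_exp"
  shows "AE \<omega> in M. \<exists>B\<ge>0. \<forall>t\<in>{0..T}. sig_norm S l t \<omega> \<le> ennreal B"
proof -
  obtain C where C: "C \<ge> 0" "\<And>v. \<bar>l v\<bar> \<le> C * C ^ length v"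
    using l by (auto simp: A_exp_iff)
  show ?thesis using signature_geometric_bound[OF C(1)]
  proof eventually_elim
    case (elim \<omega>)
    then obtain B where B: "B \<ge> 0" "\<And>t n. t \<in> {0..T} \<Longrightarrow> C ^ n * (\<Sum>v\<in>words n. \<bar>S v t \<omega>\<bar>) \<le> B * (1 / 2) ^ n"
      by blast
    have "sig_norm S l t \<omega> \<le> ennreal (C * B * 2)" if t: "t \<in> {0..T}" for t
    proof -
      have "\<bar>\<Sum>v\<in>words n. l v * S v t \<omega>\<bar> \<le> C * B * (1 / 2) ^ n" for n
      proof -
        have "\<bar>\<Sum>v\<in>words n. l v * S v t \<omega>\<bar> \<le> (\<Sum>v\<in>words n. \<bar>l v * S v t \<omega>\<bar>)" by (rule sum_abs)
        also have "\<dots> \<le> (\<Sum>v\<in>words n. C * C ^ n * \<bar>S v t \<omega>\<bar>)"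
        proof (rule sum_mono)
          fix v :: "'n word" assume "v \<in> words n"
          then show "\<bar>l v * S v t \<omega>\<bar> \<le> C * C ^ n * \<bar>S v t \<omega>\<bar>"
            using C(2)[of v] unfolding abs_mult by (intro mult_right_mono) (auto simp: words_def)
        qed
        also have "\<dots> = C * (C ^ n * (\<Sum>v\<in>words n. \<bar>S v t \<omega>\<bar>))"
          by (simp only: sum_distrib_left mult.assoc)
        also have "\<dots> \<le> C * (B * (1 / 2) ^ n)" by (rule mult_left_mono[OF B(2)[OF t] C(1)])
        finally show ?thesis by (simp only: mult.assoc)
      qed
      then have "sig_norm S l t \<omega> \<le> (\<Sum>n. ennreal (C * B * (1 / 2) ^ n))"
        unfolding sig_norm_def by (intro suminf_le ennreal_leI) auto
      also have "\<dots> = ennreal (C * B * 2)"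
      proof (rule suminf_ennreal_eq)
        have "(\<lambda>n. (1 / 2 :: real) ^ n) sums (1 / (1 - 1 / 2))" by (rule geometric_sums) simp
        then have "(\<lambda>n. (1 / 2 :: real) ^ n) sums 2" by simp
        then show "(\<lambda>n. C * B * (1 / 2) ^ n) sums (C * B * 2)" by (rule sums_mult)
      qed (use C(1) B(1) in simp)
      finally show ?thesis .
    qed
    moreover have "C * B * 2 \<ge> 0" using C(1) B(1) by simp
    ultimately show ?case by blast
  qed
qed

lemma A_exp_subset_A_space: "l \<in> A_exp \<Longrightarrow> l \<in> A_space M T S"
  unfolding A_space_def
proof clarify
  assume "l \<in> A_exp"
  from sig_norm_bounded[OF this] show "AE \<omega> in M. \<forall>t\<in>{0..T}. sig_norm S l t \<omega> < \<infinity>"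
    by eventually_elim (auto intro: le_less_trans)
qed

text \<open>
  Since the norms are bounded uniformly in time, all the integrals are finite.
\<close>

lemma A_exp_subset_I_space:
  assumes l: "l \<in> A_exp"
  shows "l \<in> I_space M T S"
proof -
  note P = A_exp_projection[OF l]
  have fin: "(\<integral>\<^sup>+ t\<in>{0..T}. f t \<partial>lborel) < \<infinity>" if "\<And>t. t \<in> {0..T} \<Longrightarrow> f t \<le> ennreal B" for f B
  proof -
    have "(\<integral>\<^sup>+ t\<in>{0..T}. f t \<partial>lborel) \<le> (\<integral>\<^sup>+ t\<in>{0..T}. ennreal B \<partial>lborel)"
      using that by (intro nn_integral_mono) (auto simp: indicator_def)
    also have "\<dots> < \<infinity>"
      using T_pos by (simp add: nn_integral_cmult_indicator ennreal_mult_less_top)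
    finally show ?thesis .
  qed
  have "AE \<omega> in M. \<forall>j. \<exists>B\<ge>0. \<forall>t\<in>{0..T}. sig_norm S (projection l [Some j]) t \<omega> \<le> ennreal B"
    "AE \<omega> in M. \<forall>j. \<exists>B\<ge>0. \<forall>t\<in>{0..T}. sig_norm S (projection l [Some j, Some j]) t \<omega> \<le> ennreal B"
    unfolding AE_all_countable by (intro allI sig_norm_bounded P)+
  then have "AE \<omega> in M.
        (\<integral>\<^sup>+ t\<in>{0..T}. sig_norm S (projection l [None]) t \<omega> \<partial>lborel) +
        (\<Sum>j\<in>UNIV. \<integral>\<^sup>+ t\<in>{0..T}. (sig_norm S (projection l [Some j, Some j]) t \<omega> +
                                (sig_norm S (projection l [Some j]) t \<omega>)\<^sup>2) \<partial>lborel) < \<infinity>"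
    using sig_norm_bounded[OF P[of "[None]"]]
  proof eventually_elim
    case (elim \<omega>)
    have "(\<integral>\<^sup>+ t\<in>{0..T}. sig_norm S (projection l [None]) t \<omega> \<partial>lborel) < \<infinity>"
    proof -
      obtain B where "\<And>t. t \<in> {0..T} \<Longrightarrow> sig_norm S (projection l [None]) t \<omega> \<le> ennreal B"
        using elim(3) by blast
      then show ?thesis by (rule fin)
    qed
    moreover have "(\<integral>\<^sup>+ t\<in>{0..T}. (sig_norm S (projection l [Some j, Some j]) t \<omega> +
        (sig_norm S (projection l [Some j]) t \<omega>)\<^sup>2) \<partial>lborel) < \<infinity>" for j
    proof -
      obtain B1 B2 where B: "B1 \<ge> 0" "B2 \<ge> 0"
        "\<And>t. t \<in> {0..T} \<Longrightarrow> sig_norm S (projection l [Some j]) t \<omega> \<le> ennreal B1"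
        "\<And>t. t \<in> {0..T} \<Longrightarrow> sig_norm S (projection l [Some j, Some j]) t \<omega> \<le> ennreal B2"
        using elim(1,2) by blast
      show ?thesis
      proof (rule fin)
        fix t assume t: "t \<in> {0..T}"
        have "sig_norm S (projection l [Some j, Some j]) t \<omega> + (sig_norm S (projection l [Some j]) t \<omega>)\<^sup>2 \<le>
            ennreal B2 + (ennreal B1)\<^sup>2"
          by (intro add_mono power_mono B t) simp
        also have "\<dots> = ennreal (B2 + B1\<^sup>2)" using B(1,2) by (simp add: ennreal_power ennreal_plus)
        finally show "sig_norm S (projection l [Some j, Some j]) t \<omega> + (sig_norm S (projection l [Some j]) t \<omega>)\<^sup>2
            \<le> ennreal (B2 + B1\<^sup>2)" .
      qed
    qed
    ultimately show ?case by (simp add: less_top)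
  qed
  then show ?thesis
    unfolding I_space_def using A_exp_subset_A_space[OF l] A_exp_subset_A_space[OF P] by simp
qed

end

section \<open>The solution of the linear equation\<close>

theorem corollary3p13:
  fixes M :: "'a measure" and F :: "real \<Rightarrow> 'a measure" and T :: real
    and W :: "real \<Rightarrow> 'a \<Rightarrow> real ^ ('n::finite)"
    and S :: "'n word \<Rightarrow> real \<Rightarrow> 'a \<Rightarrow> real"
    and p q :: "'n series"
  assumes "T > 0"
    and "usual_conditions M F"
    and "brownian_motion M F W"
    and "is_signature M F T W S"
    and "p \<in> A_exp" and "q \<in> A_exp" and "q [] \<noteq> 1"
  shows "(\<exists>!l. l = (\<lambda>w. p w + (l \<odot> q) w)) \<and>
         (\<forall>l. l = (\<lambda>w. p w + (l \<odot> q) w) \<longrightarrow> l \<in> A_exp \<and> l \<in> I_space M T S)"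
proof (intro conjI allI impI)
  show "\<exists>!l. l = (\<lambda>w. p w + (l \<odot> q) w)"
    by (rule linear_equation_unique_solution) fact
  fix l assume "l = (\<lambda>w. p w + (l \<odot> q) w)"
  then show l: "l \<in> A_exp"
    by (rule linear_equation_A_exp[OF assms(7,5,6)])
  interpret prob_space M
    using assms(2) by (simp add: usual_conditions_def)
  interpret signature M F T W S
    by unfold_locales (use assms in auto)
  show "l \<in> I_space M T S"
    by (rule A_exp_subset_I_space[OF l])
qed

end
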